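(* Let $(M,J)$ be an almost complex manifold and let $\Omega\subset M$ be a relatively compact Levi convex domain with $C^3$ boundary $b\Omega$, such that there exists a $C^2$ strictly plurisubharmonic function $\psi$ on a neighborhood $U$ of $b\Omega$. Let $r:U\to\mathbb R$ be any $C^3$ defining function for $\Omega\cap U$. Then there exist a neighborhood $U'$ of $b\Omega$ and constants $A>0$, $0<\eta_0<1$ such that for every $0<\eta\le\eta_0$ the function $$\rho=-\left(-r\,e^{-A\psi}\right)^{\eta}$$ is strictly plurisubharmonic on $\Omega\cap U'$. If moreover $U$ is a neighborhood of $\overline\Omega$, then (for suitable such constants $A$ and $\eta_0$, and every $0<\eta\le\eta_0$) the function $\rho$ is strictly plurisubharmonic on $\Omega$.
   Context: Manifolds and almost complex structures are of class $C^\infty$. A domain is a connected open set. For a real $C^2$ function $u$ on an open subset of $(M,J)$, $J^*du$ is the 1-form $X\mapsto du(JX)$, and the Levi form of $u$ at $p$ on $t\in T_p(M)$ is $L^J_u(p;t):=-d(J^*du)(X,JX)(p)$, where $X$ is any smooth vector field near $p$ with $X(p)=t$ (independent of the choice of $X$). A $C^2$ function $u$ is strictly plurisubharmonic if $L^J_u(p;t)>0$ for all $p$ in its domain and all $t\in T_p(M)\setminus\{0\}$. A $C^k$ defining function for $\Omega\cap U$ is a real $C^k$ function $r$ on $U$ with $\Omega\cap U=\{q\in U: r(q)<0\}$ and $dr\neq0$ on $b\Omega$. A relatively compact domain $\Omega$ with $C^2$ boundary is Levi convex if for every $p\in b\Omega$ and a $C^2$ defining function $r$ near $p$ one has $L^J_r(p;t)\ge0$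 for all $t\in T_p(b\Omega)\cap J(T_p(b\Omega))$ (independent of the choice of $r$). *)

theory Defs
  imports "HOL-Analysis.Analysis"
begin

text \<open>Functions of class \<open>C\<^sup>k\<close> on an open subset of a Euclidean space. On a finite-dimensional
  domain, continuity of all iterated directional derivatives up to order \<open>k\<close> is continuity of the
  iterated Frechet derivatives.\<close>

primrec Ck_on :: "nat \<Rightarrow> ('a::euclidean_space \<Rightarrow> 'b::real_normed_vector) \<Rightarrow> 'a set \<Rightarrow> bool" where
  "Ck_on 0 f S \<longleftrightarrow> continuous_on S f"
| "Ck_on (Suc k) f S \<longleftrightarrow> (\<forall>x\<in>S. f differentiable (at x)) \<and>
     (\<forall>v. Ck_on k (\<lambda>x. frechet_derivative f (at x) v) S)"

definition smooth_on :: "('a::euclidean_space \<Rightarrow> 'b::real_normed_vector) \<Rightarrow> 'a set \<Rightarrow> bool" where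
  "smooth_on f S \<longleftrightarrow> (\<forall>k. Ck_on k f S)"

text \<open>The manifold is the whole Hausdorff second countable space \<open>'m\<close>, modelled on \<open>'e\<close>. A chart
  \<open>(W, \<phi>)\<close> consists of a coordinate neighbourhood and a coordinate map; \<open>\<phi>\<close> is irrelevant off \<open>W\<close>.\<close>

type_synonym ('m, 'e) chart = "'m set \<times> ('m \<Rightarrow> 'e)"

abbreviation chart_dom :: "('m, 'e) chart \<Rightarrow> 'm set" where
  "chart_dom c \<equiv> fst c"

abbreviation chart_map :: "('m, 'e) chart \<Rightarrow> 'm \<Rightarrow> 'e" where
  "chart_map c \<equiv> snd c"

definition chart_inv :: "('m, 'e) chart \<Rightarrow> 'e \<Rightarrow> 'm" where
  "chart_inv c = inv_into (chart_dom c) (chart_map c)"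

definition is_chart :: "('m::topological_space, 'e::euclidean_space) chart \<Rightarrow> bool" where
  "is_chart c \<longleftrightarrow> open (chart_dom c) \<and> open (chart_map c ` chart_dom c) \<and>
     homeomorphism (chart_dom c) (chart_map c ` chart_dom c) (chart_map c) (chart_inv c)"

definition transition :: "('m, 'e) chart \<Rightarrow> ('m, 'e) chart \<Rightarrow> 'e \<Rightarrow> 'e" where
  "transition c c' = chart_map c' \<circ> chart_inv c"

definition smooth_atlas ::
    "('m::{t2_space, second_countable_topology}, 'e::euclidean_space) chart set \<Rightarrow> bool" where
  "smooth_atlas \<A> \<longleftrightarrow> (\<forall>c\<in>\<A>. is_chart c) \<and> (\<Union>c\<in>\<A>. chart_dom c) = UNIV \<and>
     (\<forall>c\<in>\<A>. \<forall>c'\<in>\<A>. smooth_on (transition c c') (chart_map c ` (chart_dom c \<inter> chart_dom c')))"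

definition Ck_fun_on ::
    "('m, 'e::euclidean_space) chart set \<Rightarrow> nat \<Rightarrow> ('m \<Rightarrow> real) \<Rightarrow> 'm set \<Rightarrow> bool" where
  "Ck_fun_on \<A> k u W \<longleftrightarrow>
     (\<forall>c\<in>\<A>. Ck_on k (u \<circ> chart_inv c) (chart_map c ` (chart_dom c \<inter> W)))"

text \<open>A tangent vector at \<open>p\<close> is the family of its component vectors with respect to the charts of
  the atlas around \<open>p\<close>, related by the derivatives of the transition maps. The components
  with respect to all other charts are set to \<open>0\<close>, so that the zero vector is \<open>\<lambda>_. 0\<close>.\<close>

type_synonym ('m, 'e) tvec = "('m, 'e) chart \<Rightarrow> 'e"

definition charts_at :: "('m, 'e) chart set \<Rightarrow> 'm \<Rightarrow> ('m, 'e) chart set" where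
  "charts_at \<A> p = {c \<in> \<A>. p \<in> chart_dom c}"

definition tangent_space ::
    "('m, 'e::euclidean_space) chart set \<Rightarrow> 'm \<Rightarrow> ('m, 'e) tvec set" where
  "tangent_space \<A> p = {t. (\<forall>c. c \<notin> charts_at \<A> p \<longrightarrow> t c = 0) \<and>
     (\<forall>c\<in>charts_at \<A> p. \<forall>c'\<in>charts_at \<A> p.
        t c' = frechet_derivative (transition c c') (at (chart_map c p)) (t c))}"

text \<open>The tangent vector at \<open>p\<close> whose components in the chart \<open>c\<close> are \<open>v\<close>; for fixed \<open>v\<close> this is the
  coordinate vector field with constant components \<open>v\<close>.\<close>

definition coord_vec ::
    "('m, 'e::euclidean_space) chart set \<Rightarrow> ('m, 'e) chart \<Rightarrow> 'm \<Rightarrow> 'e \<Rightarrow> ('m, 'e) tvec" where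
  "coord_vec \<A> c p v = (\<lambda>c'. if c' \<in> charts_at \<A> p
     then frechet_derivative (transition c c') (at (chart_map c p)) v else 0)"

definition almost_complex_manifold ::
    "('m::{t2_space, second_countable_topology}, 'e::euclidean_space) chart set
      \<Rightarrow> ('m \<Rightarrow> ('m, 'e) tvec \<Rightarrow> ('m, 'e) tvec) \<Rightarrow> bool" where
  "almost_complex_manifold \<A> J \<longleftrightarrow> smooth_atlas \<A> \<and>
     (\<forall>p. \<forall>t\<in>tangent_space \<A> p.
        J p t \<in> tangent_space \<A> p \<and> J p (J p t) = (\<lambda>c. - t c)) \<and>
     (\<forall>p. \<forall>s\<in>tangent_space \<A> p. \<forall>t\<in>tangent_space \<A> p. \<forall>a b.
        J p (\<lambda>c. a *\<^sub>R s c + b *\<^sub>R t c) = (\<lambda>c. a *\<^sub>R J p s c + b *\<^sub>R J p t c)) \<and>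
     (\<forall>c\<in>\<A>. \<forall>v. smooth_on (\<lambda>x. J (chart_inv c x) (coord_vec \<A> c (chart_inv c x) v) c)
        (chart_map c ` chart_dom c))"

text \<open>Real-valued 1-forms are functions of a point and a tangent vector there. The differential and
  the exterior derivative are computed in one chart around the point; for a \<open>C\<^sup>1\<close> function and a
  \<open>C\<^sup>1\<close> form, respectively, the values do not depend on that chart.\<close>

type_synonym ('m, 'e) one_form = "'m \<Rightarrow> ('m, 'e) tvec \<Rightarrow> real"

definition chart_at :: "('m, 'e) chart set \<Rightarrow> 'm \<Rightarrow> ('m, 'e) chart" where
  "chart_at \<A> p = (SOME c. c \<in> charts_at \<A> p)"

definition differential ::
    "('m, 'e::euclidean_space) chart set \<Rightarrow> ('m \<Rightarrow> real) \<Rightarrow> ('m, 'e) one_form" where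
  "differential \<A> u p t = (let c = chart_at \<A> p in
     frechet_derivative (u \<circ> chart_inv c) (at (chart_map c p)) (t c))"

definition local_form ::
    "('m, 'e::euclidean_space) chart set \<Rightarrow> ('m, 'e) one_form \<Rightarrow> ('m, 'e) chart \<Rightarrow> 'e \<Rightarrow> 'e \<Rightarrow> real" where
  "local_form \<A> \<omega> c v x = \<omega> (chart_inv c x) (coord_vec \<A> c (chart_inv c x) v)"

text \<open>Normalised so that \<open>d\<omega>(X,Y) = X(\<omega>(Y)) - Y(\<omega>(X)) - \<omega>([X,Y])\<close>, without a factor \<open>1/2\<close>; below,
  \<open>X\<close> and \<open>Y\<close> are taken to be the (commuting) fields with constant components in the chart.\<close>

definition ext_deriv ::
    "('m, 'e::euclidean_space) chart set \<Rightarrow> ('m, 'e) one_form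
      \<Rightarrow> 'm \<Rightarrow> ('m, 'e) tvec \<Rightarrow> ('m, 'e) tvec \<Rightarrow> real" where
  "ext_deriv \<A> \<omega> p s t = (let c = chart_at \<A> p; x = chart_map c p in
     frechet_derivative (local_form \<A> \<omega> c (t c)) (at x) (s c)
     - frechet_derivative (local_form \<A> \<omega> c (s c)) (at x) (t c))"

definition J_pullback ::
    "('m \<Rightarrow> ('m, 'e) tvec \<Rightarrow> ('m, 'e) tvec) \<Rightarrow> ('m, 'e) one_form \<Rightarrow> ('m, 'e) one_form" where
  "J_pullback J \<omega> p t = \<omega> p (J p t)"

text \<open>A 2-form is pointwise, so \<open>-d(J\<^sup>*du)(X,JX)(p)\<close> is its value on \<open>X(p) = t\<close> and \<open>J X(p) = J t\<close>.\<close>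

definition levi_form ::
    "('m, 'e::euclidean_space) chart set \<Rightarrow> ('m \<Rightarrow> ('m, 'e) tvec \<Rightarrow> ('m, 'e) tvec)
      \<Rightarrow> ('m \<Rightarrow> real) \<Rightarrow> 'm \<Rightarrow> ('m, 'e) tvec \<Rightarrow> real" where
  "levi_form \<A> J u p t = - ext_deriv \<A> (J_pullback J (differential \<A> u)) p t (J p t)"

definition strictly_psh_on ::
    "('m, 'e::euclidean_space) chart set \<Rightarrow> ('m \<Rightarrow> ('m, 'e) tvec \<Rightarrow> ('m, 'e) tvec)
      \<Rightarrow> ('m \<Rightarrow> real) \<Rightarrow> 'm set \<Rightarrow> bool" where
  "strictly_psh_on \<A> J u W \<longleftrightarrow> Ck_fun_on \<A> 2 u W \<and>
     (\<forall>p\<in>W. \<forall>t\<in>tangent_space \<A> p. t \<noteq> (\<lambda>_. 0) \<longrightarrow> levi_form \<A> J u p t > 0)"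

definition defining_function ::
    "('m::topological_space, 'e::euclidean_space) chart set \<Rightarrow> nat \<Rightarrow> 'm set \<Rightarrow> 'm set
      \<Rightarrow> ('m \<Rightarrow> real) \<Rightarrow> bool" where
  "defining_function \<A> k \<Omega> U r \<longleftrightarrow> Ck_fun_on \<A> k r U \<and> \<Omega> \<inter> U = {q \<in> U. r q < 0} \<and>
     (\<forall>p\<in>frontier \<Omega> \<inter> U. \<exists>t\<in>tangent_space \<A> p. differential \<A> r p t \<noteq> 0)"

definition Ck_boundary ::
    "('m::topological_space, 'e::euclidean_space) chart set \<Rightarrow> nat \<Rightarrow> 'm set \<Rightarrow> bool" where
  "Ck_boundary \<A> k \<Omega> \<longleftrightarrow>
     (\<forall>p\<in>frontier \<Omega>. \<exists>V r. open V \<and> p \<in> V \<and> defining_function \<A> k \<Omega> V r)"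

text \<open>The tangent space at \<open>p\<close> of the hypersurface \<open>b\<Omega> = {r = 0}\<close>, for a defining function \<open>r\<close> near \<open>p\<close>.\<close>

definition bdry_tangent ::
    "('m, 'e::euclidean_space) chart set \<Rightarrow> ('m \<Rightarrow> real) \<Rightarrow> 'm \<Rightarrow> ('m, 'e) tvec set" where
  "bdry_tangent \<A> r p = {t \<in> tangent_space \<A> p. differential \<A> r p t = 0}"

definition relatively_compact_domain :: "'m::topological_space set \<Rightarrow> bool" where
  "relatively_compact_domain \<Omega> \<longleftrightarrow> open \<Omega> \<and> connected \<Omega> \<and> compact (closure \<Omega>)"

text \<open>The condition does not depend on the choice of the local defining function, so it is required
  for one; in particular the boundary is \<open>C\<^sup>2\<close>.\<close>

definition levi_convex ::
    "('m::topological_space, 'e::euclidean_space) chart set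
      \<Rightarrow> ('m \<Rightarrow> ('m, 'e) tvec \<Rightarrow> ('m, 'e) tvec) \<Rightarrow> 'm set \<Rightarrow> bool" where
  "levi_convex \<A> J \<Omega> \<longleftrightarrow> relatively_compact_domain \<Omega> \<and>
     (\<forall>p\<in>frontier \<Omega>. \<exists>V r. open V \<and> p \<in> V \<and> defining_function \<A> 2 \<Omega> V r \<and>
        (\<forall>t \<in> bdry_tangent \<A> r p \<inter> J p ` bdry_tangent \<A> r p. levi_form \<A> J r p t \<ge> 0))"

end

(*
  Diederich-Fornaess construction. With u = -log(-r) + A psi one has rho = -exp(-eta u), so the Levi form
  of rho is eta exp(-eta u) times L_u - eta (du^2 + (du o J)^2), where
    L_u(t) = L_r(t) / |r| + (dr(t)^2 + dr(Jt)^2) / r^2 + A L_psi(t).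
  The only dangerous term is the first one. Levi convexity on the boundary, carried inwards along a
  transversal (this costs |r|, because L_r is Lipschitz as r is of class C^3), gives
    L_r(t) >= - C |r| |t|^2 - C |t| (|dr(t)| + |dr(Jt)|),
  and the last term, divided by |r|, is absorbed by half of the second summand of L_u and a multiple of
  |t|^2, hence by A L_psi if A is large. For eta <= 1/4, small depending on A, the other half of the second
  summand absorbs eta (du^2 + (du o J)^2). At interior points the bound on L_r is trivial, so
  compactness of the boundary, or of the closure, gives both claims.
*)

theory Submission
  imports Defs
begin

section \<open>Functions of class \<open>C\<^sup>k\<close>\<close>

text \<open>Levi convexity supplies at a boundary point only some C^2 defining function
  \<open>s\<close>, whereas the estimate is about \<open>r\<close>. The quotient s/r is in general
  only of class C^1, so the two Levi forms are compared by testing signs along parabolas, not by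
  differentiating a product. Also, \<open>r\<close> may vanish in \<open>U\<close> away from the
  boundary; zeros reached along a transversal have nonzero differential, and this forces them onto
  the boundary. The Levi form is quadratic in the vector. It is polarised to a bilinear form whose
  finitely many coefficients are two derivatives less regular than the function: C^1 for
  \<open>r\<close>, merely continuous for \<open>\<psi>\<close>, for which only positivity near a
  point is wanted. The order of choices shapes the local statement. The threshold for A depends on
  the bounds for L_r and L_psi alone; the one for eta also depends on A and on bounds for d psi,
  because du = dr/|r| + A d psi. So each point has a neighbourhood and a threshold fixed before A,
  and eta_0 is found after A. A finite subcover then yields first a common A and then a common
  eta_0.\<close>

abbreviation fd :: "('a::euclidean_space \<Rightarrow> 'b::real_normed_vector) \<Rightarrow> 'a \<Rightarrow> 'a \<Rightarrow> 'b" where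
  "fd f x \<equiv> frechet_derivative f (at x)"

lemma fd_eqI: "(f has_derivative f') (at x) \<Longrightarrow> fd f x = f'"
  by (rule frechet_derivative_at[symmetric])

lemma fd_works: "f differentiable (at x) \<Longrightarrow> (f has_derivative fd f x) (at x)"
  by (simp add: frechet_derivative_works)

lemma fd_linear: "f differentiable (at x) \<Longrightarrow> linear (fd f x)"
  by (rule linear_frechet_derivative)

lemma differentiable_cong_open:
  assumes "open S" "x \<in> S" "\<And>y. y \<in> S \<Longrightarrow> f y = g y" "f differentiable (at x)"
  shows "g differentiable (at x)"
  using assms has_derivative_transform_within_open[of f _ x UNIV S g] unfolding differentiable_def by blast

lemma fd_cong_open:
  assumes "open S" "x \<in> S" "\<And>y. y \<in> S \<Longrightarrow> f y = g y"
  shows "fd f x = fd g x"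
proof -
  have "(f has_derivative f') (at x) \<longleftrightarrow> (g has_derivative f') (at x)" for f'
    using assms has_derivative_transform_within_open[of f _ x UNIV S g]
      has_derivative_transform_within_open[of g _ x UNIV S f] by metis
  then show ?thesis unfolding frechet_derivative_def by simp
qed

text \<open>The derivatives are taken with respect to full neighbourhoods, so agreement on
  \<open>S\<close> passes to them because \<open>S\<close> is open.\<close>

lemma Ck_on_cong:
  assumes "open S" "\<And>y. y \<in> S \<Longrightarrow> f y = g y" "Ck_on k f S"
  shows "Ck_on k g S"
  using assms(2,3)
proof (induction k arbitrary: f g)
  case 0
  then show ?case by (simp cong: continuous_on_cong)
next
  case (Suc k)
  have "\<forall>x\<in>S. g differentiable (at x)"
    using Suc.prems differentiable_cong_open[OF assms(1)] by (metis Ck_on.simps(2))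
  moreover have "Ck_on k (\<lambda>x. fd g x v) S" for v
  proof (rule Suc.IH)
    show "Ck_on k (\<lambda>x. fd f x v) S" using Suc.prems by simp
    show "fd f y v = fd g y v" if "y \<in> S" for y
      using fd_cong_open[OF assms(1) that] Suc.prems(1) by metis
  qed
  ultimately show ?case by simp
qed

lemma Ck_on_subset: "Ck_on k f S \<Longrightarrow> T \<subseteq> S \<Longrightarrow> Ck_on k f T"
proof (induction k arbitrary: f)
  case 0 then show ?case by (auto intro: continuous_on_subset)
next
  case (Suc k) then show ?case by (simp add: subset_eq)
qed

lemma Ck_on_Suc_differentiable: "Ck_on (Suc k) f S \<Longrightarrow> x \<in> S \<Longrightarrow> f differentiable (at x)"
  by simp

lemma Ck_on_fd: "Ck_on (Suc k) f S \<Longrightarrow> Ck_on k (\<lambda>x. fd f x v) S"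
  by simp

lemma Ck_on_SucD: "Ck_on (Suc k) f S \<Longrightarrow> Ck_on k f S"
proof (induction k arbitrary: f)
  case 0
  then show ?case
    by (auto intro!: continuous_at_imp_continuous_on differentiable_imp_continuous_within)
next
  case (Suc k)
  have "\<forall>v. Ck_on k (\<lambda>x. fd f x v) S"
    using Suc.prems Suc.IH by (metis Ck_on.simps(2))
  moreover have "\<forall>x\<in>S. f differentiable (at x)" using Suc.prems(1) by simp
  ultimately show ?case using Ck_on.simps(2)[of k f S] by blast
qed

lemma Ck_on_mono: "Ck_on n f S \<Longrightarrow> m \<le> n \<Longrightarrow> Ck_on m f S"
proof (induction n)
  case (Suc n)
  then show ?case using Ck_on_SucD[of n f S] by (cases "m = Suc n") auto
qed simp

lemma Ck_on_continuous_on: "Ck_on k f S \<Longrightarrow> continuous_on S f"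
  using Ck_on_mono[of k f S 0] by simp

text \<open>The induction step shared by the closure rules below: it is enough to exhibit a
  derivative formula of class \<open>C\<^sup>k\<close>.\<close>

lemma Ck_on_SucI:
  assumes "open S" "\<And>x. x \<in> S \<Longrightarrow> (f has_derivative f' x) (at x)" "\<And>v. Ck_on k (\<lambda>x. f' x v) S"
  shows "Ck_on (Suc k) f S"
proof -
  have "f differentiable (at x)" if "x \<in> S" for x
    using assms(2)[OF that] differentiable_def by blast
  moreover have "Ck_on k (\<lambda>x. fd f x v) S" for v
    by (rule Ck_on_cong[OF assms(1) _ assms(3)]) (simp add: fd_eqI[OF assms(2)])
  ultimately show ?thesis by simp
qed

lemma Ck_on_const: "Ck_on k (\<lambda>x. c) S"
proof (induction k arbitrary: c)
  case (Suc k) then show ?case by simp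
qed simp

lemma Ck_on_linear:
  assumes "open S" "bounded_linear L" "Ck_on k f S"
  shows "Ck_on k (\<lambda>x. L (f x)) S"
  using assms(3)
proof (induction k arbitrary: f)
  case 0
  then show ?case using assms(2) by (simp add: bounded_linear.continuous_on)
next
  case (Suc k)
  show ?case
    by (rule Ck_on_SucI[OF assms(1) bounded_linear.has_derivative[OF assms(2) fd_works]])
      (use Suc in auto)
qed

lemma Ck_on_add:
  assumes "open S" "Ck_on k f S" "Ck_on k g S"
  shows "Ck_on k (\<lambda>x. f x + g x) S"
  using assms(2,3)
proof (induction k arbitrary: f g)
  case 0 then show ?case by (auto intro: continuous_intros)
next
  case (Suc k)
  show ?case
    by (rule Ck_on_SucI[OF assms(1) has_derivative_add[OF fd_works fd_works]])
      (use Suc in auto)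
qed

lemma Ck_on_minus:
  assumes "open S" "Ck_on k f S" 
  shows "Ck_on k (\<lambda>x. - f x) S"
  using Ck_on_linear[OF assms(1) bounded_linear_minus[OF bounded_linear_ident] assms(2)] .

lemma Ck_on_diff:
  assumes "open S" "Ck_on k f S" "Ck_on k g S"
  shows "Ck_on k (\<lambda>x. f x - g x) S"
  using Ck_on_add[OF assms(1,2) Ck_on_minus[OF assms(1,3)]] by simp

lemma Ck_on_scaleR:
  assumes "open S" "Ck_on k f S" "Ck_on k g S"
  shows "Ck_on k (\<lambda>x. f x *\<^sub>R g x) S"
  using assms(2,3)
proof (induction k arbitrary: f g)
  case 0 then show ?case by (auto intro: continuous_intros)
next
  case (Suc k)
  show ?case
  proof (rule Ck_on_SucI[OF assms(1) has_derivative_scaleR[OF fd_works fd_works]])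
    show "Ck_on k (\<lambda>x. f x *\<^sub>R fd g x v + fd f x v *\<^sub>R g x) S" for v
      using Suc by (intro Ck_on_add[OF assms(1)] Suc.IH) (auto simp del: Ck_on.simps intro: Ck_on_fd Ck_on_SucD)
  qed (use Suc in auto)
qed

lemma Ck_on_mult:
  fixes f g :: "'a::euclidean_space \<Rightarrow> real"
  assumes "open S" "Ck_on k f S" "Ck_on k g S"
  shows "Ck_on k (\<lambda>x. f x * g x) S"
  using Ck_on_scaleR[OF assms] by simp

lemma Ck_on_sum:
  assumes "open S" "\<And>i. i \<in> I \<Longrightarrow> Ck_on k (f i) S"
  shows "Ck_on k (\<lambda>x. \<Sum>i\<in>I. f i x) S"
  using assms(2)
  by (induction I rule: infinite_finite_induct) (simp_all add: Ck_on_const Ck_on_add[OF assms(1)])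

lemma Ck_on_inner:
  fixes f :: "'a::euclidean_space \<Rightarrow> 'b::real_inner"
  assumes "open S" "Ck_on k f S"
  shows "Ck_on k (\<lambda>x. f x \<bullet> b) S"
  using Ck_on_linear[OF assms(1) bounded_linear_inner_left assms(2)] .

lemma linear_basis_expand:
  fixes L :: "'a::euclidean_space \<Rightarrow> 'b::real_vector"
  assumes "linear L" shows "L v = (\<Sum>b\<in>Basis. (v \<bullet> b) *\<^sub>R L b)"
proof -
  have "L v = L (\<Sum>b\<in>Basis. (v \<bullet> b) *\<^sub>R b)" by (simp add: euclidean_representation)
  also have "\<dots> = (\<Sum>b\<in>Basis. (v \<bullet> b) *\<^sub>R L b)"
    using assms by (simp add: linear_sum linear_cmul)
  finally show ?thesis .
qed

text \<open>The regularity of \<open>L\<close> is known for one fixed vector at a time. Expanding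
  \<open>V x\<close> in the basis turns the expression into a finite sum of products of known
  regularity.\<close>

lemma Ck_on_linear_family:
  fixes L :: "'a::euclidean_space \<Rightarrow> 'c::euclidean_space \<Rightarrow> 'b::real_normed_vector"
  assumes "open S" "\<And>x. x \<in> S \<Longrightarrow> linear (L x)" "\<And>v. Ck_on k (\<lambda>x. L x v) S" "Ck_on k V S"
  shows "Ck_on k (\<lambda>x. L x (V x)) S"
proof (rule Ck_on_cong[OF assms(1)])
  show "Ck_on k (\<lambda>x. \<Sum>b\<in>Basis. (V x \<bullet> b) *\<^sub>R L x b) S"
    by (intro Ck_on_sum Ck_on_scaleR Ck_on_inner assms)
qed (use linear_basis_expand[OF assms(2)] in metis)

lemma Ck_on_fd_field:
  assumes "open S" "Ck_on (Suc k) f S" "Ck_on k V S"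
  shows "Ck_on k (\<lambda>x. fd f x (V x)) S"
  by (rule Ck_on_linear_family[OF assms(1)])
    (use assms in \<open>auto intro: linear_frechet_derivative\<close>)

lemma has_derivative_real_compose:
  fixes f :: "'a::euclidean_space \<Rightarrow> real"
  assumes "(f has_derivative f') (at x)" "(h has_real_derivative h') (at (f x))"
  shows "((\<lambda>x. h (f x)) has_derivative (\<lambda>v. h' * f' v)) (at x)"
  using has_derivative_compose[OF assms(1), of h "(*) h'"] assms(2) 
  by (simp add: has_field_derivative_def)

lemma Ck_on_exp:
  fixes f :: "'a::euclidean_space \<Rightarrow> real"
  assumes "open S" "Ck_on k f S"
  shows "Ck_on k (\<lambda>x. exp (f x)) S"
  using assms(2)
proof (induction k arbitrary: f)
  case 0 then show ?case by (auto intro: continuous_intros)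
next
  case (Suc k)
  show ?case
  proof (rule Ck_on_SucI[OF assms(1) has_derivative_real_compose[OF fd_works DERIV_exp]])
    show "Ck_on k (\<lambda>x. exp (f x) * fd f x v) S" for v
      using Suc by (intro Ck_on_mult[OF assms(1)] Suc.IH) (auto simp del: Ck_on.simps intro: Ck_on_fd Ck_on_SucD)
  qed (use Suc in auto)
qed

lemma Ck_on_powr:
  fixes f :: "'a::euclidean_space \<Rightarrow> real"
  assumes "open S" "Ck_on k f S" "\<And>x. x \<in> S \<Longrightarrow> f x > 0"
  shows "Ck_on k (\<lambda>x. f x powr a) S"
  using assms(2)
proof (induction k arbitrary: a)
  case 0 then show ?case using assms(3) by (force intro!: continuous_intros)
next
  case (Suc k)
  show ?case
  proof (rule Ck_on_SucI[OF assms(1) has_derivative_real_compose[OF fd_works has_real_derivative_powr]])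
    show "Ck_on k (\<lambda>x. a * f x powr (a - 1) * fd f x v) S" for v
      using Suc.prems by (intro Ck_on_mult[OF assms(1)] Ck_on_const Suc.IH) (auto simp del: Ck_on.simps intro: Ck_on_fd Ck_on_SucD)
  qed (use Suc assms(3) in auto)
qed

text \<open>Leibniz rule; the first summand freezes the argument at \<open>V x\<close>. It is
  applied to df evaluated on the field \<open>J y v\<close>, and to a pulled back form evaluated on
  the derivative of a coordinate change.\<close>

lemma linear_family_has_derivative:
  fixes L :: "'a::euclidean_space \<Rightarrow> 'c::euclidean_space \<Rightarrow> 'b::real_normed_vector"
  assumes "open S" "x \<in> S" "\<And>y. y \<in> S \<Longrightarrow> linear (L y)" "\<And>v. (\<lambda>y. L y v) differentiable (at x)"
    and V: "(V has_derivative V') (at x)"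
  shows "((\<lambda>y. L y (V y)) has_derivative (\<lambda>s. fd (\<lambda>y. L y (V x)) x s + L x (V' s))) (at x)"
proof -
  have "((\<lambda>y. \<Sum>b\<in>Basis. (V y \<bullet> b) *\<^sub>R L y b) has_derivative
     (\<lambda>s. \<Sum>b\<in>Basis. (V x \<bullet> b) *\<^sub>R fd (\<lambda>y. L y b) x s + (V' s \<bullet> b) *\<^sub>R L x b)) (at x)"
    by (intro has_derivative_sum has_derivative_scaleR has_derivative_inner_left V fd_works assms(4))
  then have d: "((\<lambda>y. L y (V y)) has_derivative
     (\<lambda>s. \<Sum>b\<in>Basis. (V x \<bullet> b) *\<^sub>R fd (\<lambda>y. L y b) x s + (V' s \<bullet> b) *\<^sub>R L x b)) (at x)"
    by (rule has_derivative_transform_within_open[OF _ assms(1,2)])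
      (use linear_basis_expand[OF assms(3)] in metis)
  have "((\<lambda>y. \<Sum>b\<in>Basis. (V x \<bullet> b) *\<^sub>R L y b) has_derivative
     (\<lambda>s. \<Sum>b\<in>Basis. (V x \<bullet> b) *\<^sub>R fd (\<lambda>y. L y b) x s)) (at x)"
    by (intro has_derivative_sum has_derivative_scaleR_right fd_works assms(4))
  then have "((\<lambda>y. L y (V x)) has_derivative
     (\<lambda>s. \<Sum>b\<in>Basis. (V x \<bullet> b) *\<^sub>R fd (\<lambda>y. L y b) x s)) (at x)"
    by (rule has_derivative_transform_within_open[OF _ assms(1,2)])
      (use linear_basis_expand[OF assms(3)] in metis)
  note e = fd_eqI[OF this]
  have "(\<Sum>b\<in>Basis. (V x \<bullet> b) *\<^sub>R fd (\<lambda>y. L y b) x s + (V' s \<bullet> b) *\<^sub>R L x b)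
     = fd (\<lambda>y. L y (V x)) x s + L x (V' s)" for s
    using linear_basis_expand[OF assms(3)[OF assms(2)], of "V' s"] by (simp add: e sum.distrib)
  with d show ?thesis by simp
qed

text \<open>With \<open>L y\<close> the derivative of a function at \<open>y\<close>, this is
  linearity of the second derivative in its other argument.\<close>

lemma fd_linear_in_parameter:
  fixes L :: "'a::euclidean_space \<Rightarrow> 'c::euclidean_space \<Rightarrow> 'b::real_normed_vector"
  assumes "open S" "x \<in> S" "\<And>y. y \<in> S \<Longrightarrow> linear (L y)" "\<And>v. (\<lambda>y. L y v) differentiable (at x)"
  shows "linear (\<lambda>v. fd (\<lambda>y. L y v) x s)"
proof (rule linearI)
  fix v w :: 'c and c :: real
  have "((\<lambda>y. L y v + L y w) has_derivative (\<lambda>s. fd (\<lambda>y. L y v) x s + fd (\<lambda>y. L y w) x s)) (at x)"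
    by (intro has_derivative_add fd_works assms(4))
  from fd_eqI[OF this] fd_cong_open[OF assms(1,2), of "\<lambda>y. L y (v+w)" "\<lambda>y. L y v + L y w"] assms(3)
  show "fd (\<lambda>y. L y (v + w)) x s = fd (\<lambda>y. L y v) x s + fd (\<lambda>y. L y w) x s"
    by (simp add: linear_add)
  have "((\<lambda>y. c *\<^sub>R L y v) has_derivative (\<lambda>s. c *\<^sub>R fd (\<lambda>y. L y v) x s)) (at x)"
    by (intro has_derivative_scaleR_right fd_works assms(4))
  from fd_eqI[OF this] fd_cong_open[OF assms(1,2), of "\<lambda>y. L y (c *\<^sub>R v)" "\<lambda>y. c *\<^sub>R L y v"] assms(3)
  show "fd (\<lambda>y. L y (c *\<^sub>R v)) x s = c *\<^sub>R fd (\<lambda>y. L y v) x s"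
    by (simp add: linear_cmul)
qed

section \<open>Symmetry of second derivatives\<close>

lemma has_real_derivative_along_line:
  fixes f :: "'a::euclidean_space \<Rightarrow> real"
  assumes "f differentiable (at (p + a *\<^sub>R v))"
  shows "((\<lambda>a. f (p + a *\<^sub>R v)) has_real_derivative fd f (p + a *\<^sub>R v) v) (at a)"
proof -
  have "((\<lambda>a. f (p + a *\<^sub>R v)) has_derivative (\<lambda>h. fd f (p + a *\<^sub>R v) (h *\<^sub>R v))) (at a)"
    by (rule has_derivative_compose[of "\<lambda>a. p + a *\<^sub>R v" "\<lambda>h. h *\<^sub>R v" a UNIV f, OF _ fd_works[OF assms]])
      (auto intro!: derivative_eq_intros)
  moreover have "(\<lambda>h. fd f (p + a *\<^sub>R v) (h *\<^sub>R v)) = (*) (fd f (p + a *\<^sub>R v) v)"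
    using linear_cmul[OF fd_linear[OF assms]] by (auto simp: mult.commute)
  ultimately show ?thesis by (simp add: has_field_derivative_def)
qed

text \<open>The second difference does not change when \<open>s\<close> and \<open>t\<close> are
  exchanged, so this one-sided estimate yields symmetry. The mean value theorem is used once in
  direction \<open>s\<close> and once in direction \<open>t\<close>, and continuity of the second
  derivative controls the intermediate point.\<close>

lemma second_difference_estimate:
  fixes f :: "'a::euclidean_space \<Rightarrow> real"
  assumes "open S" "Ck_on 2 f S" "x \<in> S" "e > 0"
  shows "\<exists>h0>0. \<forall>h. 0 < h \<and> h < h0 \<longrightarrow>
    \<bar>(f (x + h *\<^sub>R s + h *\<^sub>R t) - f (x + h *\<^sub>R s) - f (x + h *\<^sub>R t) + f x) / h\<^sup>2 - fd (\<lambda>y. fd f y s) x t\<bar> < e"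
proof -
  have 2: "Ck_on (Suc (Suc 0)) f S" using assms(2) by (simp only: numeral_2_eq_2)
  then have d1: "f differentiable (at y)" "(\<lambda>z. fd f z s) differentiable (at y)" if "y \<in> S" for y
    using that by auto
  have "continuous_on S (\<lambda>y. fd (\<lambda>y. fd f y s) y t)" using 2 by auto
  then obtain d1 where d1': "d1 > 0" "\<And>y. y \<in> S \<Longrightarrow> dist y x < d1 \<Longrightarrow> \<bar>fd (\<lambda>y. fd f y s) y t - fd (\<lambda>y. fd f y s) x t\<bar> < e"
    using assms(3,4) unfolding continuous_on_iff dist_real_def by metis
  obtain d2 where d2: "d2 > 0" "ball x d2 \<subseteq> S" using assms(1,3) open_contains_ball by blast
  define d where "d = min d1 d2"
  have d: "d > 0" using d1' d2 by (simp add: d_def)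
  \<comment> \<open>Keeps every \<open>x + a s + b t\<close> with a, b between 0 and h inside the
    ball of radius \<open>d\<close>; the 1 avoids a zero denominator when both vectors
    vanish.\<close>
  define h0 where "h0 = d / (norm s + norm t + 1)"
  have pos: "norm s + norm t + 1 > 0" by (simp add: add_nonneg_pos)
  have in_ball: "x + a *\<^sub>R s + b *\<^sub>R t \<in> S" "dist (x + a *\<^sub>R s + b *\<^sub>R t) x < d1"
    if "0 \<le> a" "a \<le> h" "0 \<le> b" "b \<le> h" "h < h0" for a b h
  proof -
    have "norm (a *\<^sub>R s + b *\<^sub>R t) \<le> a * norm s + b * norm t"
      using norm_triangle_ineq[of "a *\<^sub>R s" "b *\<^sub>R t"] that by simp
    also have "\<dots> \<le> h * norm s + h * norm t" using that by (intro add_mono mult_right_mono) auto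
    also have "\<dots> \<le> h * (norm s + norm t + 1)" using that by (simp add: algebra_simps)
    also have "\<dots> < d" using that(5) pos by (simp add: h0_def pos_less_divide_eq)
    finally have *: "dist (x + a *\<^sub>R s + b *\<^sub>R t) x < d" by (simp add: dist_norm add.assoc)
    then show "dist (x + a *\<^sub>R s + b *\<^sub>R t) x < d1" by (simp add: d_def)
    show "x + a *\<^sub>R s + b *\<^sub>R t \<in> S" using * d2(2) by (auto simp: d_def dist_commute)
  qed
  show ?thesis
  proof (intro exI[of _ h0] conjI allI impI)
    show "h0 > 0" using d pos by (simp add: h0_def)
    fix h assume h: "0 < h \<and> h < h0"
    define g where "g a = f ((x + h *\<^sub>R t) + a *\<^sub>R s) - f (x + a *\<^sub>R s)" for a
    have "\<exists>z. 0 < z \<and> z < h \<and> g h - g 0 = (h - 0) * (fd f ((x + h *\<^sub>R t) + z *\<^sub>R s) s - fd f (x + z *\<^sub>R s) s)"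
      unfolding g_def
    proof (rule MVT2)
      fix a assume a: "0 \<le> a" "a \<le> h"
      have "x + h *\<^sub>R t + a *\<^sub>R s \<in> S" "x + a *\<^sub>R s \<in> S"
        using in_ball(1)[of a h h] in_ball(1)[of a h 0] a h by (auto simp: algebra_simps)
      then show "((\<lambda>a. f ((x + h *\<^sub>R t) + a *\<^sub>R s) - f (x + a *\<^sub>R s)) has_real_derivative
        fd f ((x + h *\<^sub>R t) + a *\<^sub>R s) s - fd f (x + a *\<^sub>R s) s) (at a)"
        by (intro DERIV_diff has_real_derivative_along_line d1)
    qed (use h in auto)
    then obtain a where a: "0 < a" "a < h"
      "g h - g 0 = h * (fd f ((x + h *\<^sub>R t) + a *\<^sub>R s) s - fd f (x + a *\<^sub>R s) s)" by auto
    have "\<exists>z. 0 < z \<and> z < h \<and> fd f ((x + a *\<^sub>R s) + h *\<^sub>R t) s - fd f ((x + a *\<^sub>R s) + 0 *\<^sub>R t) s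
      = (h - 0) * fd (\<lambda>y. fd f y s) ((x + a *\<^sub>R s) + z *\<^sub>R t) t"
    proof (rule MVT2)
      fix b assume b: "0 \<le> b" "b \<le> h"
      show "((\<lambda>b. fd f ((x + a *\<^sub>R s) + b *\<^sub>R t) s) has_real_derivative
        fd (\<lambda>y. fd f y s) ((x + a *\<^sub>R s) + b *\<^sub>R t) t) (at b)"
        using in_ball(1)[of a h b] a b h by (intro has_real_derivative_along_line d1) auto
    qed (use h in auto)
    then obtain b where b: "0 < b" "b < h" "fd f ((x + a *\<^sub>R s) + h *\<^sub>R t) s - fd f (x + a *\<^sub>R s) s
      = h * fd (\<lambda>y. fd f y s) ((x + a *\<^sub>R s) + b *\<^sub>R t) t" by auto
    have "f (x + h *\<^sub>R s + h *\<^sub>R t) - f (x + h *\<^sub>R s) - f (x + h *\<^sub>R t) + f x = g h - g 0"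
      by (simp add: g_def algebra_simps)
    also have "\<dots> = h\<^sup>2 * fd (\<lambda>y. fd f y s) ((x + a *\<^sub>R s) + b *\<^sub>R t) t"
      using a(3) b(3) by (simp add: algebra_simps power2_eq_square)
    finally show "\<bar>(f (x + h *\<^sub>R s + h *\<^sub>R t) - f (x + h *\<^sub>R s) - f (x + h *\<^sub>R t) + f x) / h\<^sup>2
      - fd (\<lambda>y. fd f y s) x t\<bar> < e"
      using d1'(2)[of "(x + a *\<^sub>R s) + b *\<^sub>R t"] in_ball[of a h b] a b h by simp
  qed
qed

lemma second_derivative_symmetric_real:
  fixes f :: "'a::euclidean_space \<Rightarrow> real"
  assumes "open S" "Ck_on 2 f S" "x \<in> S"
  shows "fd (\<lambda>y. fd f y s) x t = fd (\<lambda>y. fd f y t) x s"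
proof (rule ccontr)
  assume ne: "\<not> ?thesis"
  \<comment> \<open>Half of the supposed gap: both derivatives are within \<open>e\<close> of the
    same difference quotient, which is impossible.\<close>
  define e where "e = \<bar>fd (\<lambda>y. fd f y s) x t - fd (\<lambda>y. fd f y t) x s\<bar> / 2"
  have e: "e > 0" using ne by (simp add: e_def)
  obtain h1 h2 where h: "h1 > 0" "h2 > 0" and
    1: "\<forall>h. 0 < h \<and> h < h1 \<longrightarrow>
    \<bar>(f (x + h *\<^sub>R s + h *\<^sub>R t) - f (x + h *\<^sub>R s) - f (x + h *\<^sub>R t) + f x) / h\<^sup>2 - fd (\<lambda>y. fd f y s) x t\<bar> < e"
    and 2: "\<forall>h. 0 < h \<and> h < h2 \<longrightarrow>
    \<bar>(f (x + h *\<^sub>R t + h *\<^sub>R s) - f (x + h *\<^sub>R t) - f (x + h *\<^sub>R s) + f x) / h\<^sup>2 - fd (\<lambda>y. fd f y t) x s\<bar> < e"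
    using second_difference_estimate[OF assms e] by metis
  define h where "h = min h1 h2 / 2"
  have hh: "0 < h" "h < h1" "h < h2" using h by (auto simp: h_def)
  have "f (x + h *\<^sub>R t + h *\<^sub>R s) - f (x + h *\<^sub>R t) - f (x + h *\<^sub>R s) + f x =
    f (x + h *\<^sub>R s + h *\<^sub>R t) - f (x + h *\<^sub>R s) - f (x + h *\<^sub>R t) + f x"
    by (simp add: algebra_simps)
  then obtain q where "\<bar>q - fd (\<lambda>y. fd f y s) x t\<bar> < e" "\<bar>q - fd (\<lambda>y. fd f y t) x s\<bar> < e"
    using 1[rule_format, of h] 2[rule_format, of h] hh by metis
  then have "\<bar>fd (\<lambda>y. fd f y s) x t - fd (\<lambda>y. fd f y t) x s\<bar> < 2 * e" by linarith
  then show False unfolding e_def by simp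
qed

lemma fd_inner:
  fixes f :: "'a::euclidean_space \<Rightarrow> 'b::euclidean_space"
  assumes "f differentiable (at x)"
  shows "fd (\<lambda>y. f y \<bullet> b) x v = fd f x v \<bullet> b"
proof -
  have "((\<lambda>y. f y \<bullet> b) has_derivative (\<lambda>v. fd f x v \<bullet> b)) (at x)"
    by (intro has_derivative_inner_left fd_works assms)
  from fd_eqI[OF this] show ?thesis by (rule fun_cong)
qed

text \<open>The vector-valued case serves the transition maps, where it makes the Levi form
  independent of the chart.\<close>

lemma second_derivative_symmetric:
  fixes f :: "'a::euclidean_space \<Rightarrow> 'b::euclidean_space"
  assumes "open S" "Ck_on 2 f S" "x \<in> S"
  shows "fd (\<lambda>y. fd f y s) x t = fd (\<lambda>y. fd f y t) x s"
proof (rule euclidean_eqI)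
  fix b :: 'b
  have 2: "Ck_on (Suc (Suc 0)) f S" using assms(2) by (simp only: numeral_2_eq_2)
  have "fd (\<lambda>y. fd (\<lambda>z. f z \<bullet> b) y u) x v = fd (\<lambda>y. fd f y u) x v \<bullet> b" for u v
  proof -
    have "fd (\<lambda>z. f z \<bullet> b) y u = fd f y u \<bullet> b" if "y \<in> S" for y
      by (rule fd_inner[OF Ck_on_Suc_differentiable[OF 2 that]])
    from fd_cong_open[OF assms(1,3) this]
    have "fd (\<lambda>y. fd (\<lambda>z. f z \<bullet> b) y u) x v = fd (\<lambda>y. fd f y u \<bullet> b) x v" by (rule fun_cong)
    also have "\<dots> = fd (\<lambda>y. fd f y u) x v \<bullet> b"
      by (rule fd_inner[OF Ck_on_Suc_differentiable[OF Ck_on_fd[OF 2] assms(3)]])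
    finally show ?thesis .
  qed
  from this[of s t] this[of t s]
  show "fd (\<lambda>y. fd f y s) x t \<bullet> b = fd (\<lambda>y. fd f y t) x s \<bullet> b"
    using second_derivative_symmetric_real[OF assms(1) Ck_on_inner[OF assms(1,2), of b] assms(3), of s t]
    by argo
qed

section \<open>The Levi form in coordinates\<close>

text \<open>With \<open>\<omega>\<close> the pullback of \<open>df\<close> under \<open>J\<close>, this is \<open>- d\<omega>(t, Jt)\<close> computed with constant vector fields.\<close>

definition lev :: "('e::euclidean_space \<Rightarrow> 'e \<Rightarrow> 'e) \<Rightarrow> ('e \<Rightarrow> real) \<Rightarrow> 'e \<Rightarrow> 'e \<Rightarrow> real" where
  "lev J f x t = fd (\<lambda>y. fd f y (J y t)) x (J x t) - fd (\<lambda>y. fd f y (J y (J x t))) x t"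

text \<open>A bilinear form, linear in the 2-jet of \<open>f\<close>, whose diagonal is the Levi form: the second
  derivatives of \<open>f\<close> at \<open>(s,t)\<close> and at \<open>(Js,Jt)\<close>, plus \<open>df\<close> of the terms in which \<open>J\<close> is differentiated.\<close>

definition lev_bil :: "('e::euclidean_space \<Rightarrow> 'e \<Rightarrow> 'e) \<Rightarrow> ('e \<Rightarrow> real) \<Rightarrow> 'e \<Rightarrow> 'e \<Rightarrow> 'e \<Rightarrow> real" where
  "lev_bil J f x s t = fd (\<lambda>y. fd f y t) x s + fd (\<lambda>y. fd f y (J x t)) x (J x s)
     + fd f x (fd (\<lambda>y. J y t) x (J x s) - fd (\<lambda>y. J y (J x t)) x s)"

lemma lev_cong:
  assumes "open S" "x \<in> S" "\<And>y. y \<in> S \<Longrightarrow> f y = g y"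
  shows "lev J f x t = lev J g x t"
proof -
  have "fd f y = fd g y" if "y \<in> S" for y
    by (rule fd_cong_open[OF assms(1) that]) (rule assms(3))
  then have "fd (\<lambda>y. fd f y (V y)) x = fd (\<lambda>y. fd g y (V y)) x" for V
    by (intro fd_cong_open[OF assms(1,2)]) simp
  then show ?thesis by (simp add: lev_def)
qed

text \<open>An almost complex structure read in coordinates. The order \<open>k\<close> in
  \<open>J_smooth\<close> is universally quantified, so the coefficients of \<open>J\<close> are
  smooth.\<close>

locale local_acs =
  fixes G :: "'e::euclidean_space set" and J :: "'e \<Rightarrow> 'e \<Rightarrow> 'e"
  assumes open_G: "open G"
    and J_linear: "x \<in> G \<Longrightarrow> linear (J x)"
    and J_J: "x \<in> G \<Longrightarrow> J x (J x v) = - v"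
    and J_smooth: "Ck_on k (\<lambda>x. J x v) G"
begin

lemma restrict:
  assumes "open S" "S \<subseteq> G" shows "local_acs S J"
proof (rule local_acs.intro)
  show "linear (J x)" if "x \<in> S" for x using that assms(2) by (auto intro: J_linear)
  show "J x (J x v) = - v" if "x \<in> S" for x v using that assms(2) by (auto intro: J_J)
  show "Ck_on k (\<lambda>x. J x v) S" for k v by (rule Ck_on_subset[OF J_smooth assms(2)])
qed (rule assms(1))

lemma J_differentiable: "x \<in> G \<Longrightarrow> (\<lambda>y. J y v) differentiable (at x)"
  using J_smooth[of "Suc 0"] by simp

lemma form_C: "Ck_on (Suc k) f G \<Longrightarrow> Ck_on k (\<lambda>y. fd f y (J y v)) G"
  by (rule Ck_on_fd_field[OF open_G _ J_smooth])

lemma form_differentiable: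
  assumes "Ck_on 2 f G" "x \<in> G" shows "(\<lambda>y. fd f y (J y v)) differentiable (at x)"
  using form_C[of "Suc 0" f v] assms by (simp add: numeral_2_eq_2)

lemma C2_differentiable: 
  assumes "Ck_on 2 f G" "x \<in> G"
  shows "f differentiable (at x)" "(\<lambda>y. fd f y v) differentiable (at x)"
  using assms by (auto simp: numeral_2_eq_2)

text \<open>Product rule for both derivatives in \<open>lev\<close>. The identity
  \<open>J x (J x t) = - t\<close> turns the subtracted second derivative into an added one.\<close>

lemma lev_eq_bil:
  assumes "Ck_on 2 f G" "x \<in> G"
  shows "lev J f x t = lev_bil J f x t t"
proof -
  have d: "fd (\<lambda>y. fd f y (J y v)) x s = fd (\<lambda>y. fd f y (J x v)) x s + fd f x (fd (\<lambda>y. J y v) x s)" for s v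
  proof -
    have "((\<lambda>y. fd f y (J y v)) has_derivative
       (\<lambda>s. fd (\<lambda>y. fd f y (J x v)) x s + fd f x (fd (\<lambda>y. J y v) x s))) (at x)"
      by (intro linear_family_has_derivative[OF open_G assms(2)] fd_linear fd_works
        J_differentiable C2_differentiable[OF assms(1)] assms(2))
    from fd_eqI[OF this] show ?thesis by (rule fun_cong)
  qed
  have "linear (fd f x)" by (rule fd_linear[OF C2_differentiable(1)[OF assms]])
  note l = linear_diff[OF this] linear_neg[OF this]
  have "linear (\<lambda>v. fd (\<lambda>y. fd f y v) x t)"
    by (rule fd_linear_in_parameter[OF open_G assms(2) fd_linear[OF C2_differentiable(1)[OF assms(1)]]
          C2_differentiable(2)[OF assms]])
  note m = linear_neg[OF this]
  show ?thesis
    unfolding lev_def lev_bil_def d by (simp add: l m J_J[OF assms(2)])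
qed

lemma lev_bil_bilinear:
  assumes "Ck_on 2 f G" "x \<in> G"
  shows "bilinear (lev_bil J f x)"
proof -
  note d = C2_differentiable[OF assms(1)]
  have 1: "linear (fd f x)" by (intro fd_linear d assms)
  have 2: "linear (fd (\<lambda>y. fd f y t) x)" for t by (intro fd_linear d assms)
  have 3: "linear (\<lambda>t. fd (\<lambda>y. fd f y t) x s)" for s
    by (rule fd_linear_in_parameter[OF open_G assms(2) fd_linear[OF d(1)] d(2)[OF assms(2)]])
  have 4: "linear (fd (\<lambda>y. J y t) x)" for t by (intro fd_linear J_differentiable assms)
  have 5: "linear (\<lambda>t. fd (\<lambda>y. J y t) x s)" for s
    by (rule fd_linear_in_parameter[OF open_G assms(2) J_linear J_differentiable[OF assms(2)]])
  have 6: "linear (J x)" by (intro J_linear assms)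
  note comp = linear_compose[unfolded o_def]
  have "linear (\<lambda>s. lev_bil J f x s t)" for t unfolding lev_bil_def
    by (rule linear_compose_add[OF linear_compose_add[OF 2 comp[OF 6 2]]
        comp[OF linear_compose_sub[OF comp[OF 6 4] 4] 1]])
  moreover have "linear (\<lambda>t. lev_bil J f x s t)" for s unfolding lev_bil_def
    by (rule linear_compose_add[OF linear_compose_add[OF 3 comp[OF 6 3]]
        comp[OF linear_compose_sub[OF 5 comp[OF 6 5]] 1]])
  ultimately show ?thesis unfolding bilinear_def by blast
qed

text \<open>For \<open>k = 1\<close> this is where class \<open>C\<^sup>3\<close> of
  \<open>r\<close> is spent: the coefficients become C^1, hence locally Lipschitz. For
  \<open>k = 0\<close> it gives the continuity used for C^2 functions.\<close>

lemma lev_bil_coeff_C: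
  assumes "Ck_on (Suc (Suc k)) f G"
  shows "Ck_on k (\<lambda>x. lev_bil J f x s t) G"
proof -
  have 1: "Ck_on (Suc k) (\<lambda>y. fd f y v) G" for v using assms by (rule Ck_on_fd)
  have a: "Ck_on k (\<lambda>x. fd (\<lambda>y. fd f y (J x t)) x (J x s)) G"
  proof (rule Ck_on_linear_family[OF open_G _ _ J_smooth, of "\<lambda>x v. fd (\<lambda>y. fd f y v) x (J x s)"])
    show "linear (\<lambda>v. fd (\<lambda>y. fd f y v) x (J x s))" if "x \<in> G" for x
      by (rule fd_linear_in_parameter[OF open_G that fd_linear[OF Ck_on_Suc_differentiable[OF assms]]
            Ck_on_Suc_differentiable[OF 1 that]])
    show "Ck_on k (\<lambda>x. fd (\<lambda>y. fd f y v) x (J x s)) G" for v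
      by (rule Ck_on_fd_field[OF open_G 1 J_smooth])
  qed
  have b: "Ck_on k (\<lambda>x. fd (\<lambda>y. J y t) x (J x s)) G" for s t
    by (rule Ck_on_fd_field[OF open_G J_smooth J_smooth])
  have c: "Ck_on k (\<lambda>x. fd (\<lambda>y. J y (J x t)) x s) G"
  proof (rule Ck_on_linear_family[OF open_G _ _ J_smooth, of "\<lambda>x v. fd (\<lambda>y. J y v) x s"])
    show "linear (\<lambda>v. fd (\<lambda>y. J y v) x s)" if "x \<in> G" for x
      by (rule fd_linear_in_parameter[OF open_G that J_linear J_differentiable[OF that]])
    show "Ck_on k (\<lambda>x. fd (\<lambda>y. J y v) x s) G" for v
      by (rule Ck_on_fd[OF J_smooth])
  qed
  have "Ck_on (Suc k) f G" using assms by (rule Ck_on_SucD)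
  then show ?thesis unfolding lev_bil_def
    by (intro Ck_on_add Ck_on_fd_field Ck_on_diff open_G a b c Ck_on_fd[OF 1])
qed

lemma lev_add_scale:
  assumes "Ck_on 2 f G" "Ck_on 2 g G" "x \<in> G"
  shows "lev J (\<lambda>y. f y + a * g y) x t = lev J f x t + a * lev J g x t"
proof -
  have "fd (\<lambda>y. f y + a * g y) y = (\<lambda>v. fd f y v + a * fd g y v)" if "y \<in> G" for y
    using C2_differentiable(1)[OF assms(1) that] C2_differentiable(1)[OF assms(2) that]
    by (intro fd_eqI has_derivative_add has_derivative_mult_right fd_works)
  then have "fd (\<lambda>y. fd (\<lambda>y. f y + a * g y) y (J y v)) x s = fd (\<lambda>y. fd f y (J y v) + a * fd g y (J y v)) x s" for v s
    by (intro fd_cong_open[OF open_G assms(3), THEN fun_cong]) auto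
  also have "fd (\<lambda>y. fd f y (J y v) + a * fd g y (J y v)) x s
     = fd (\<lambda>y. fd f y (J y v)) x s + a * fd (\<lambda>y. fd g y (J y v)) x s" for v s
  proof -
    have "((\<lambda>y. fd f y (J y v) + a * fd g y (J y v)) has_derivative
       (\<lambda>s. fd (\<lambda>y. fd f y (J y v)) x s + a * fd (\<lambda>y. fd g y (J y v)) x s)) (at x)"
      using form_differentiable[OF assms(1,3)] form_differentiable[OF assms(2,3)]
      by (intro has_derivative_add has_derivative_mult_right fd_works)
    from fd_eqI[OF this] show ?thesis by (rule fun_cong)
  qed
  finally show ?thesis by (simp add: lev_def algebra_simps)
qed

text \<open>The pulled back form of the composition is h'(f) times that of \<open>f\<close>;
  differentiating the factor gives the term in \<open>h''\<close>. It is a sum of squares because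
  the subtracted product df(t) df(JJt) equals -df(t)^2.\<close>

lemma lev_compose:
  assumes f: "Ck_on 2 f G" "x \<in> G"
    and h: "\<And>y. y \<in> G \<Longrightarrow> (h has_real_derivative h' (f y)) (at (f y))"
    and h': "(h' has_real_derivative h'') (at (f x))"
  shows "lev J (\<lambda>y. h (f y)) x t = h' (f x) * lev J f x t + h'' * ((fd f x t)\<^sup>2 + (fd f x (J x t))\<^sup>2)"
proof -
  have "fd (\<lambda>y. h (f y)) y = (\<lambda>v. h' (f y) * fd f y v)" if "y \<in> G" for y
    using C2_differentiable(1)[OF f(1) that] by (intro fd_eqI has_derivative_real_compose fd_works h that)
  then have "fd (\<lambda>y. fd (\<lambda>y. h (f y)) y (J y v)) x s = fd (\<lambda>y. h' (f y) * fd f y (J y v)) x s" for v s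
    by (intro fd_cong_open[OF open_G f(2), THEN fun_cong]) auto
  also have "fd (\<lambda>y. h' (f y) * fd f y (J y v)) x s
     = h' (f x) * fd (\<lambda>y. fd f y (J y v)) x s + (h'' * fd f x s) * fd f x (J x v)" for v s
  proof -
    have "((\<lambda>y. h' (f y) * fd f y (J y v)) has_derivative (\<lambda>s. h' (f x) * fd (\<lambda>y. fd f y (J y v)) x s
      + (h'' * fd f x s) * fd f x (J x v))) (at x)"
      using form_differentiable[OF f] C2_differentiable[OF f]
      by (intro has_derivative_mult has_derivative_real_compose fd_works h')
    from fd_eqI[OF this] show ?thesis by (rule fun_cong)
  qed
  finally show ?thesis
    using linear_neg[OF fd_linear[OF C2_differentiable(1)[OF f]]]
    by (simp add: lev_def J_J[OF f(2)] algebra_simps power2_eq_square)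
qed

end

section \<open>Locally uniform bounds and Lipschitz estimates\<close>

lemma continuous_on_eventually_close:
  fixes h :: "'a::metric_space \<Rightarrow> 'b::metric_space"
  assumes "open G" "continuous_on G h" "x \<in> G" "e > 0"
  shows "eventually (\<lambda>y. y \<in> G \<and> dist (h y) (h x) < e) (nhds x)"
proof -
  have "isCont h x" using assms continuous_on_eq_continuous_at by blast
  then have "eventually (\<lambda>y. dist (h y) (h x) < e) (nhds x)"
    using assms(4) by (simp add: continuous_at_eps_delta eventually_nhds_metric)
  with eventually_nhds_in_open[OF assms(1,3)] show ?thesis by (rule eventually_conj)
qed

lemma eventually_nhds_ballE:
  fixes x :: "'a::metric_space"
  assumes "eventually P (nhds x)"
  obtains e where "e > 0" "\<forall>y\<in>ball x e. P y"
proof -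
  from assms obtain e where "e > 0" "\<forall>y. dist y x < e \<longrightarrow> P y" unfolding eventually_nhds_metric by blast
  then show ?thesis by (intro that[of e]) (simp_all add: dist_commute)
qed

lemma isCont_eventually_in_open:
  assumes "isCont c a" "open G" "c a \<in> G"
  shows "eventually (\<lambda>s. c s \<in> G) (nhds a)"
  using assms(1) topological_tendstoD[OF _ assms(2,3)]
  unfolding isCont_def tendsto_at_iff_tendsto_nhds by blast

lemma linear_basis_bound:
  fixes L :: "'a::euclidean_space \<Rightarrow> 'b::real_normed_vector"
  assumes "linear L" "\<And>b. b \<in> Basis \<Longrightarrow> norm (L b) \<le> K b"
  shows "norm (L v) \<le> (\<Sum>b\<in>Basis. K b) * norm v"
proof -
  have "norm (L v) \<le> (\<Sum>b\<in>Basis. norm ((v \<bullet> b) *\<^sub>R L b))"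
    unfolding linear_basis_expand[OF assms(1), of v] by (rule norm_sum)
  also have "\<dots> \<le> (\<Sum>b\<in>Basis. norm v * K b)"
    using assms(2) by (intro sum_mono) (auto intro!: mult_mono Basis_le_norm)
  finally show ?thesis by (simp add: sum_distrib_left mult.commute)
qed

lemma bilinear_coeff_bound:
  fixes B :: "'a::euclidean_space \<Rightarrow> 'a \<Rightarrow> real"
  assumes "bilinear B" "\<And>b b'. b \<in> Basis \<Longrightarrow> b' \<in> Basis \<Longrightarrow> \<bar>B b b'\<bar> \<le> L"
  shows "\<bar>B s t\<bar> \<le> (real DIM('a))\<^sup>2 * L * norm s * norm t"
proof -
  have 1: "norm (B b t) \<le> real DIM('a) * L * norm t" if "b \<in> Basis" for b
  proof -
    have "linear (B b)" using assms(1) by (simp add: bilinear_def)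
    from linear_basis_bound[OF this, of "\<lambda>_. L" t] show ?thesis using assms(2)[OF that] by simp
  qed
  have "linear (\<lambda>s. B s t)" using assms(1) by (simp add: bilinear_def)
  from linear_basis_bound[OF this 1, of s]
  show ?thesis by (simp add: power2_eq_square algebra_simps)
qed

text \<open>Continuity is assumed for each vector separately; uniformity in the vector comes from
  the finitely many basis vectors, each allowed to vary by at most 1.\<close>

lemma linear_family_bounded:
  fixes L :: "'a::euclidean_space \<Rightarrow> 'c::euclidean_space \<Rightarrow> 'b::real_normed_vector"
  assumes "open G" "x \<in> G" "\<And>y. y \<in> G \<Longrightarrow> linear (L y)" "\<And>v. continuous_on G (\<lambda>y. L y v)"
  shows "\<exists>K\<ge>0. eventually (\<lambda>y. y \<in> G \<and> (\<forall>v. norm (L y v) \<le> K * norm v)) (nhds x)"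
proof -
  define K where "K = (\<Sum>b\<in>Basis. norm (L x b) + 1)"
  have "eventually (\<lambda>y. \<forall>b\<in>Basis. y \<in> G \<and> dist (L y b) (L x b) < 1) (nhds x)"
    by (intro eventually_ball_finite ballI continuous_on_eventually_close assms) auto
  then have "eventually (\<lambda>y. y \<in> G \<and> (\<forall>v. norm (L y v) \<le> K * norm v)) (nhds x)"
  proof eventually_elim
    fix y assume y: "\<forall>b\<in>Basis. y \<in> G \<and> dist (L y b) (L x b) < 1"
    then have "y \<in> G" using nonempty_Basis by blast
    have "norm (L y b) \<le> norm (L x b) + 1" if "b \<in> Basis" for b
      using y that norm_triangle_ineq2[of "L y b" "L x b"] by (force simp: dist_norm)
    from linear_basis_bound[OF assms(3)[OF \<open>y \<in> G\<close>] this] \<open>y \<in> G\<close>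
    show "y \<in> G \<and> (\<forall>v. norm (L y v) \<le> K * norm v)" by (simp add: K_def)
  qed
  moreover have "K \<ge> 0" unfolding K_def by (intro sum_nonneg) simp
  ultimately show ?thesis by blast
qed

lemma C1_lipschitz:
  fixes h :: "'a::euclidean_space \<Rightarrow> real"
  assumes "open G" "Ck_on 1 h G" "x \<in> G"
  shows "\<exists>K\<ge>0. \<exists>e>0. \<forall>y\<in>ball x e. \<forall>z\<in>ball x e. \<bar>h y - h z\<bar> \<le> K * norm (y - z)"
proof -
  have d: "h differentiable (at y)" if "y \<in> G" for y using assms(2) that by simp
  have c: "continuous_on G (\<lambda>y. fd h y v)" for v using assms(2) by simp
  have "\<exists>K\<ge>0. eventually (\<lambda>y. y \<in> G \<and> (\<forall>v. norm (fd h y v) \<le> K * norm v)) (nhds x)"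
    by (rule linear_family_bounded[OF assms(1,3)]) (rule fd_linear, erule d, rule c)
  then obtain K where K: "K \<ge> 0" "eventually (\<lambda>y. y \<in> G \<and> (\<forall>v. norm (fd h y v) \<le> K * norm v)) (nhds x)"
    by blast
  obtain e where e0: "e > 0" "\<forall>y\<in>ball x e. y \<in> G \<and> (\<forall>v. norm (fd h y v) \<le> K * norm v)"
    by (rule eventually_nhds_ballE[OF K(2)])
  note e = e0(1) e0(2)[rule_format]
  have "norm (h y - h z) \<le> K * norm (y - z)" if "y \<in> ball x e" "z \<in> ball x e" for y z
  proof (rule differentiable_bound[OF convex_ball _ _ that])
    show "(h has_derivative fd h y) (at y within ball x e)" if "y \<in> ball x e" for y
      by (rule has_derivative_at_withinI[OF fd_works[OF d]]) (use e(2)[OF that] in blast)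
    show "onorm (fd h y) \<le> K" if "y \<in> ball x e" for y
      by (rule onorm_bound[OF K(1)]) (use e(2)[OF that] in blast)
  qed
  then have "\<forall>y\<in>ball x e. \<forall>z\<in>ball x e. \<bar>h y - h z\<bar> \<le> K * norm (y - z)" by simp
  then show ?thesis using K(1) e(1) by blast
qed

lemma C1_lipschitz_family:
  fixes h :: "'i \<Rightarrow> 'a::euclidean_space \<Rightarrow> real"
  assumes "finite I" "open G" "x \<in> G" "\<forall>i\<in>I. Ck_on 1 (h i) G"
  shows "\<exists>K\<ge>0. \<exists>e>0. \<forall>i\<in>I. \<forall>y\<in>ball x e. \<forall>z\<in>ball x e. \<bar>h i y - h i z\<bar> \<le> K * norm (y - z)"
  using assms(1,4)
proof (induction I)
  case empty
  have "(0::real) \<le> 0" "(1::real) > 0" by auto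
  then show ?case by blast
next
  case (insert i I)
  have "\<exists>K\<ge>0. \<exists>e>0. \<forall>i\<in>I. \<forall>y\<in>ball x e. \<forall>z\<in>ball x e. \<bar>h i y - h i z\<bar> \<le> K * norm (y - z)"
    by (rule insert.IH) (use insert.prems in simp)
  then obtain K1 e1 where 1: "K1 \<ge> 0" "e1 > 0"
    "\<forall>i\<in>I. \<forall>y\<in>ball x e1. \<forall>z\<in>ball x e1. \<bar>h i y - h i z\<bar> \<le> K1 * norm (y - z)" by blast
  obtain K2 e2 where 2: "K2 \<ge> 0" "e2 > 0"
    "\<forall>y\<in>ball x e2. \<forall>z\<in>ball x e2. \<bar>h i y - h i z\<bar> \<le> K2 * norm (y - z)"
    using C1_lipschitz[OF assms(2) insert.prems[rule_format, OF insertI1] assms(3)] by blast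
  have m: "K1 * norm u \<le> max K1 K2 * norm u" "K2 * norm u \<le> max K1 K2 * norm u" for u :: 'a
    by (simp_all add: mult_right_mono)
  have "\<forall>j\<in>insert i I. \<forall>y\<in>ball x (min e1 e2). \<forall>z\<in>ball x (min e1 e2). \<bar>h j y - h j z\<bar> \<le> max K1 K2 * norm (y - z)"
  proof (intro ballI)
    fix j y z assume "j \<in> insert i I" "y \<in> ball x (min e1 e2)" "z \<in> ball x (min e1 e2)"
    then have "\<bar>h j y - h j z\<bar> \<le> K1 * norm (y - z) \<or> \<bar>h j y - h j z\<bar> \<le> K2 * norm (y - z)"
      using 1(3) 2(3) by auto
    then show "\<bar>h j y - h j z\<bar> \<le> max K1 K2 * norm (y - z)"
      using m[of "y - z"] by linarith
  qed
  moreover have "max K1 K2 \<ge> 0" "min e1 e2 > 0" using 1 2 by auto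
  ultimately show ?case by blast
qed

section \<open>Comparison of two functions at a common zero\<close>

text \<open>Second-order Taylor argument along a parabola. Value and first derivative vanish at
  \<open>s = 0\<close>; the second derivative there is the Hessian in direction \<open>t\<close>
  plus \<open>2 * fd f x w\<close>, the factor 2 coming from the square of \<open>s\<close>.
  Choosing \<open>w\<close> thus tunes the second derivative freely.\<close>

lemma curve_negative:
  fixes f :: "'a::euclidean_space \<Rightarrow> real"
  assumes "open G" "Ck_on 2 f G" "x \<in> G" "f x = 0" "fd f x t = 0"
    and neg: "fd (\<lambda>y. fd f y t) x t + 2 * fd f x w < 0"
  shows "\<exists>d>0. \<forall>s. 0 < s \<and> s < d \<longrightarrow> f (x + s *\<^sub>R t + s\<^sup>2 *\<^sub>R w) < 0"
proof -
  have 2: "Ck_on (Suc (Suc 0)) f G" using assms(2) by (simp only: numeral_2_eq_2)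
  note d1 = Ck_on_Suc_differentiable[OF 2] and d2 = Ck_on_Suc_differentiable[OF Ck_on_fd[OF 2]]
  define c where "c s = x + s *\<^sub>R t + s\<^sup>2 *\<^sub>R w" for s :: real
  have c': "(c has_derivative (\<lambda>h. h *\<^sub>R (t + (2 * s) *\<^sub>R w))) (at s)" for s
    unfolding c_def by (auto intro!: derivative_eq_intros simp: algebra_simps)
  have "isCont c 0" using c' has_derivative_continuous by blast
  moreover have "c 0 = x" by (simp add: c_def)
  ultimately have "eventually (\<lambda>s. c s \<in> G) (nhds 0)"
    using assms(1,3) by (intro isCont_eventually_in_open) simp_all
  then obtain d0 where d00: "d0 > 0" "\<forall>s\<in>ball 0 d0. c s \<in> G" by (rule eventually_nhds_ballE)
  have d0: "d0 > 0" "\<bar>s\<bar> < d0 \<Longrightarrow> c s \<in> G" for s using d00 by simp_all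
  define D where "D s = fd f (c s) (t + (2 * s) *\<^sub>R w)" for s
  have D: "((\<lambda>s. f (c s)) has_real_derivative D s) (at s)" if "\<bar>s\<bar> < d0" for s
  proof -
    have "((\<lambda>s. f (c s)) has_derivative (\<lambda>h. fd f (c s) (h *\<^sub>R (t + (2 * s) *\<^sub>R w)))) (at s)"
      by (rule has_derivative_compose[OF c' fd_works[OF d1[OF d0(2)[OF that]]]])
    moreover have "(\<lambda>h. fd f (c s) (h *\<^sub>R (t + (2 * s) *\<^sub>R w))) = (*) (D s)"
      using linear_cmul[OF fd_linear[OF d1[OF d0(2)[OF that]]]] by (simp add: D_def fun_eq_iff)
    ultimately show ?thesis by (simp only: has_field_derivative_def)
  qed
  have l: "linear (fd f y)" if "y \<in> G" for y by (rule fd_linear[OF d1[OF that]])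
  \<comment> \<open>\<open>D\<close> splits into the derivative of \<open>f\<close> in the fixed
    direction \<open>t\<close> and \<open>2 * s\<close> times the one in direction \<open>w\<close>.
    At 0 the second part contributes only its value, since the other term of the product rule
    carries the factor \<open>s\<close>.\<close>
  have D0: "(D has_real_derivative (fd (\<lambda>y. fd f y t) x t + 2 * fd f x w)) (at 0)"
  proof -
    have a: "((\<lambda>s. fd f (c s) v) has_real_derivative fd (\<lambda>y. fd f y v) x t) (at 0)" for v
    proof -
      have "(c has_derivative (\<lambda>h. h *\<^sub>R t)) (at 0)" using c'[of 0] by simp
      moreover have "((\<lambda>y. fd f y v) has_derivative fd (\<lambda>y. fd f y v) x) (at (c 0))"
        unfolding \<open>c 0 = x\<close> by (rule fd_works[OF d2[OF assms(3)]])
      ultimately have "((\<lambda>s. fd f (c s) v) has_derivative (\<lambda>h. fd (\<lambda>y. fd f y v) x (h *\<^sub>R t))) (at 0)"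
        by (rule has_derivative_compose)
      moreover have "(\<lambda>h. fd (\<lambda>y. fd f y v) x (h *\<^sub>R t)) = (*) (fd (\<lambda>y. fd f y v) x t)"
        using linear_cmul[OF fd_linear[OF d2[OF assms(3)]]] by (simp add: fun_eq_iff)
      ultimately show ?thesis by (simp only: has_field_derivative_def)
    qed
    have "((\<lambda>s. 2 * s * fd f (c s) w) has_real_derivative
        (2 * fd f (c 0) w + fd (\<lambda>y. fd f y w) x t * (2 * 0))) (at 0)"
      by (rule DERIV_mult[OF _ a]) (auto intro!: derivative_eq_intros)
    then have sum: "((\<lambda>s. fd f (c s) t + (2 * s) * fd f (c s) w) has_real_derivative
        (fd (\<lambda>y. fd f y t) x t + 2 * fd f x w)) (at 0)"
      using DERIV_add[OF a[of t]] \<open>c 0 = x\<close> by simp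
    have "fd f (c s) t + (2 * s) * fd f (c s) w = D s" if "s \<in> {-d0<..<d0}" for s
    proof -
      have "\<bar>s\<bar> < d0" using that by auto
      from l[OF d0(2)[OF this]] show ?thesis by (simp add: D_def linear_add linear_cmul)
    qed
    then show ?thesis
      by (intro has_field_derivative_transform_within_open[OF sum, of "{-d0<..<d0}"]) (use d0(1) in auto)
  qed
  from DERIV_neg_dec_right[OF this neg] obtain d3 where d3: "d3 > 0" "\<And>h. 0 < h \<Longrightarrow> h < d3 \<Longrightarrow> D h < D 0"
    by auto
  have "D 0 = 0" using assms(5) by (simp add: D_def \<open>c 0 = x\<close>)
  show ?thesis
  proof (intro exI[of _ "min d0 d3"] conjI allI impI)
    fix s assume s: "0 < s \<and> s < min d0 d3"
    have "\<exists>z. 0 < z \<and> z < s \<and> f (c s) - f (c 0) = (s - 0) * D z"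
      by (rule MVT2) (use s D in auto)
    then obtain z where z: "0 < z" "z < s" "f (c s) = s * D z" using assms(4) \<open>c 0 = x\<close> by auto
    have "D z < 0" using d3(2)[of z] z s \<open>D 0 = 0\<close> by simp
    then have "f (c s) < 0" using z s by (simp add: mult_pos_neg)
    then show "f (x + s *\<^sub>R t + s\<^sup>2 *\<^sub>R w) < 0" by (simp add: c_def)
  qed (use d0 d3 in auto)
qed

context local_acs
begin

text \<open>Moving along \<open>s \<mapsto> x + s t + s\<^sup>2 w\<close> with \<open>w\<close> transversal compares the second derivatives of \<open>f\<close> and
  \<open>g\<close> in tangential directions, although \<open>g / f\<close> need not be of class \<open>C\<^sup>2\<close>.\<close>

lemma lev_boundary_compare:
  assumes f: "Ck_on 2 f G" and g: "Ck_on 2 g G" and x: "x \<in> G" "f x = 0" "g x = 0"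
    and imp: "\<And>y. y \<in> G \<Longrightarrow> f y < 0 \<Longrightarrow> g y \<le> 0"
    and ne: "fd f x n > 0" "fd g x m \<noteq> 0"
  shows "\<exists>l>0. (\<forall>v. fd g x v = l * fd f x v) \<and>
    (\<forall>t. fd f x t = 0 \<longrightarrow> fd f x (J x t) = 0 \<longrightarrow> lev J g x t \<le> l * lev J f x t)"
proof -
  note df = C2_differentiable[OF f x(1)] and dg = C2_differentiable[OF g x(1)]
  note lf = fd_linear[OF df(1)] and lg = fd_linear[OF dg(1)]
  note f_lin = linear_add[OF lf] linear_diff[OF lf] linear_cmul[OF lf] linear_neg[OF lf]
  note g_lin = linear_add[OF lg] linear_diff[OF lg] linear_cmul[OF lg] linear_neg[OF lg]
  have near: "\<exists>d>0. \<forall>s. 0 < s \<and> s < d \<longrightarrow> x + s *\<^sub>R t + s\<^sup>2 *\<^sub>R w \<in> G" for t w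
  proof -
    have "isCont (\<lambda>s::real. x + s *\<^sub>R t + s\<^sup>2 *\<^sub>R w) 0" by (intro continuous_intros)
    then have "eventually (\<lambda>s::real. x + s *\<^sub>R t + s\<^sup>2 *\<^sub>R w \<in> G) (nhds 0)"
      using open_G x(1) by (intro isCont_eventually_in_open) simp_all
    then obtain d where "d > 0" "\<forall>s\<in>ball 0 d. x + s *\<^sub>R t + s\<^sup>2 *\<^sub>R w \<in> G" by (rule eventually_nhds_ballE)
    then show ?thesis by auto
  qed
  \<comment> \<open>Otherwise a short step along \<open>v\<close> enters \<open>f < 0\<close> while
    \<open>g\<close> becomes positive.\<close>
  have 1: "fd g x v \<le> 0" if "fd f x v < 0" for v
  proof (rule ccontr)
    assume "\<not> fd g x v \<le> 0"
    then have gv: "fd g x v > 0" by simp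
    have "((\<lambda>a. f (x + a *\<^sub>R v)) has_real_derivative fd f x v) (at 0)"
      using has_real_derivative_along_line[of f x 0 v] df(1) by simp
    from DERIV_neg_dec_right[OF this that] x(2)
    obtain d1 where d1: "d1 > 0" "\<And>h. 0 < h \<Longrightarrow> h < d1 \<Longrightarrow> f (x + h *\<^sub>R v) < 0" by auto
    have "((\<lambda>a. g (x + a *\<^sub>R v)) has_real_derivative fd g x v) (at 0)"
      using has_real_derivative_along_line[of g x 0 v] dg(1) by simp
    from DERIV_pos_inc_right[OF this gv] x(3)
    obtain d2 where d2: "d2 > 0" "\<And>h. 0 < h \<Longrightarrow> h < d2 \<Longrightarrow> 0 < g (x + h *\<^sub>R v)" by auto
    obtain d3 where d3: "d3 > 0" "\<And>h. 0 < h \<Longrightarrow> h < d3 \<Longrightarrow> x + h *\<^sub>R v \<in> G" using near[of v 0] by auto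
    define h where "h = min d1 (min d2 d3) / 2"
    have "0 < h" "h < d1" "h < d2" "h < d3" using d1(1) d2(1) d3(1) by (auto simp: h_def)
    then show False using d1(2)[of h] d2(2)[of h] d3(2)[of h] imp[of "x + h *\<^sub>R v"] by auto
  qed
  have 2: "fd g x v \<le> 0" if "fd f x v = 0" for v
  proof (rule ccontr)
    assume gv: "\<not> fd g x v \<le> 0"
    \<comment> \<open>Tilting \<open>v\<close> by \<open>- e n\<close> makes the derivative of
      \<open>f\<close> negative, so the strict case applies; \<open>e\<close> is so small that the
      tilt changes the derivative of \<open>g\<close> by at most half of its value on
      \<open>v\<close>.\<close>
    define e where "e = fd g x v / (2 * (\<bar>fd g x n\<bar> + 1))"
    have e: "e > 0" using gv by (simp add: e_def)
    have "fd f x (v - e *\<^sub>R n) < 0" using that ne(1) e by (simp add: f_lin)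
    from 1[OF this] have "fd g x v \<le> e * fd g x n" by (simp add: g_lin)
    also have "\<dots> \<le> e * (\<bar>fd g x n\<bar> + 1)" using e by (intro mult_left_mono) auto
    also have "\<dots> = fd g x v / 2"
    proof -
      have "\<bar>fd g x n\<bar> + 1 \<noteq> 0" by linarith
      then show ?thesis unfolding e_def by (simp add: divide_simps)
    qed
    finally show False using gv by simp
  qed
  \<comment> \<open>Both \<open>v\<close> and \<open>- v\<close> lie in the kernel. Equality of the
    kernels then makes the two differentials proportional.\<close>
  have 3: "fd g x v = 0" if "fd f x v = 0" for v
    using 2[OF that] 2[of "- v"] that by (simp add: f_lin g_lin)
  define l where "l = fd g x n / fd f x n"
  have 4: "fd g x v = l * fd f x v" for v
    using 3[of "v - (fd f x v / fd f x n) *\<^sub>R n"] ne(1) by (simp add: f_lin g_lin l_def)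
  have "fd g x n \<ge> 0" using 1[of "- n"] ne(1) by (simp add: f_lin g_lin)
  then have "l \<ge> 0" using ne(1) by (simp add: l_def)
  moreover have "l \<noteq> 0" using 4[of m] ne(2) by auto
  ultimately have l: "l > 0" by simp
  have 5: "fd (\<lambda>y. fd g y t) x t \<le> l * fd (\<lambda>y. fd f y t) x t" (is "?Hg \<le> l * ?Hf")
    if t: "fd f x t = 0" for t
  proof (rule ccontr)
    assume "\<not> ?Hg \<le> l * ?Hf"
    then have lt: "?Hf < ?Hg / l" using l by (simp add: field_simps)
    \<comment> \<open>The midpoint between \<open>- ?Hf\<close> and \<open>- ?Hg / l\<close>. A
      parabola whose transversal part contributes \<open>mu\<close> gives \<open>f\<close> a
      negative second derivative, but gives \<open>g\<close> the positive one
      \<open>?Hg + l * mu\<close>, against the sign hypothesis.\<close>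
    define mu where "mu = - (?Hf + ?Hg / l) / 2"
    define w where "w = (mu / (2 * fd f x n)) *\<^sub>R n"
    have w: "2 * fd f x w = mu" using ne(1) by (simp add: w_def f_lin)
    have "?Hf + 2 * fd f x w < 0" using lt unfolding w mu_def by argo
    from curve_negative[OF open_G f x(1,2) t this]
    obtain d1 where d1: "d1 > 0" "\<And>h. 0 < h \<Longrightarrow> h < d1 \<Longrightarrow> f (x + h *\<^sub>R t + h\<^sup>2 *\<^sub>R w) < 0" by auto
    have neg: "fd (\<lambda>y. - g y) y v = - fd g y v" if "y \<in> G" for y v
    proof -
      have "((\<lambda>y. - g y) has_derivative (\<lambda>v. - fd g y v)) (at y)"
        by (intro has_derivative_minus fd_works C2_differentiable(1)[OF g that])
      from fd_eqI[OF this] show ?thesis by (rule fun_cong)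
    qed
    have "fd (\<lambda>y. fd (\<lambda>y. - g y) y t) x = fd (\<lambda>y. - fd g y t) x"
      by (rule fd_cong_open[OF open_G x(1) neg])
    also have "\<dots> = (\<lambda>v. - fd (\<lambda>y. fd g y t) x v)"
      by (intro fd_eqI has_derivative_minus fd_works dg(2))
    finally have Hneg: "fd (\<lambda>y. fd (\<lambda>y. - g y) y t) x t = - ?Hg" by simp
    have "l * mu > - ?Hg"
    proof -
      have "mu > - (?Hg / l)" using lt unfolding mu_def by argo
      then have "l * mu > l * - (?Hg / l)" using l by (rule mult_strict_left_mono)
      then show ?thesis using l by simp
    qed
    then have "fd (\<lambda>y. fd (\<lambda>y. - g y) y t) x t + 2 * fd (\<lambda>y. - g y) x w < 0"
      using w unfolding Hneg neg[OF x(1)] 4 by (simp add: algebra_simps)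
    from curve_negative[OF open_G Ck_on_minus[OF open_G g] x(1) _ _ this]
    obtain d2 where d2: "d2 > 0" "\<And>h. 0 < h \<Longrightarrow> h < d2 \<Longrightarrow> 0 < g (x + h *\<^sub>R t + h\<^sup>2 *\<^sub>R w)"
      using x(3) t by (auto simp: neg[OF x(1)] 4)
    obtain d3 where d3: "d3 > 0" "\<And>h. 0 < h \<Longrightarrow> h < d3 \<Longrightarrow> x + h *\<^sub>R t + h\<^sup>2 *\<^sub>R w \<in> G"
      using near[of t w] by auto
    define h where "h = min d1 (min d2 d3) / 2"
    have "0 < h" "h < d1" "h < d2" "h < d3" using d1(1) d2(1) d3(1) by (auto simp: h_def)
    then show False using d1(2)[of h] d2(2)[of h] d3(2)[of h] imp[of "x + h *\<^sub>R t + h\<^sup>2 *\<^sub>R w"] by auto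
  qed
  \<comment> \<open>On the complex tangent space the Hessian comparison is available for both
    \<open>t\<close> and \<open>J x t\<close>. The part of \<open>lev_bil\<close> with derivatives
    of \<open>J\<close> involves only the differential, so it scales exactly by
    \<open>l\<close>.\<close>
  have 6: "lev J g x t \<le> l * lev J f x t" if "fd f x t = 0" "fd f x (J x t) = 0" for t
    unfolding lev_eq_bil[OF f x(1)] lev_eq_bil[OF g x(1)] lev_bil_def
    using 5[OF that(1)] 5[OF that(2)] by (simp add: 4 distrib_left)
  show ?thesis using l 4 6 by blast
qed

lemma lev_bil_lipschitz:
  assumes "Ck_on 3 f G" "x \<in> G"
  shows "\<exists>K\<ge>0. \<exists>e>0. ball x e \<subseteq> G \<and> (\<forall>y\<in>ball x e. \<forall>z\<in>ball x e. \<forall>s t.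
    \<bar>lev_bil J f y s t - lev_bil J f z s t\<bar> \<le> K * norm (y - z) * norm s * norm t)"
proof -
  have f2: "Ck_on 2 f G" using Ck_on_mono[OF assms(1)] by simp
  have C1: "Ck_on 1 (\<lambda>x. lev_bil J f x (fst i) (snd i)) G" for i
    by (rule lev_bil_coeff_C) (use assms(1) in \<open>simp only: numeral_3_eq_3 One_nat_def\<close>)
  have "\<exists>K\<ge>0. \<exists>e>0. \<forall>i\<in>Basis \<times> Basis. \<forall>y\<in>ball x e. \<forall>z\<in>ball x e.
    \<bar>lev_bil J f y (fst i) (snd i) - lev_bil J f z (fst i) (snd i)\<bar> \<le> K * norm (y - z)"
    by (rule C1_lipschitz_family[OF _ open_G assms(2)]) (use C1 in simp_all)
  then obtain K e1 where K0: "K \<ge> 0" "e1 > 0" "\<forall>i\<in>Basis \<times> Basis. \<forall>y\<in>ball x e1. \<forall>z\<in>ball x e1.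
    \<bar>lev_bil J f y (fst i) (snd i) - lev_bil J f z (fst i) (snd i)\<bar> \<le> K * norm (y - z)" by blast
  have K3: "\<bar>lev_bil J f y b b' - lev_bil J f z b b'\<bar> \<le> K * norm (y - z)"
    if "b \<in> Basis" "b' \<in> Basis" "y \<in> ball x e1" "z \<in> ball x e1" for b b' y z
    using K0(3)[rule_format, of "(b, b')" y z] that by simp
  note K = K0(1,2) K3
  obtain e2 where e2: "e2 > 0" "ball x e2 \<subseteq> G" using open_G assms(2) open_contains_ball by blast
  have "\<forall>y\<in>ball x (min e1 e2). \<forall>z\<in>ball x (min e1 e2). \<forall>s t. \<bar>lev_bil J f y s t - lev_bil J f z s t\<bar>
    \<le> (real DIM('e))\<^sup>2 * K * norm (y - z) * norm s * norm t"
  proof (intro ballI allI)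
    fix y z s t assume yz: "y \<in> ball x (min e1 e2)" "z \<in> ball x (min e1 e2)"
    then have "y \<in> G" "z \<in> G" using e2(2) by auto
    then have "bilinear (\<lambda>s t. lev_bil J f y s t - lev_bil J f z s t)"
      using lev_bil_bilinear[OF f2] by (simp add: bilinear_def linear_compose_sub)
    from bilinear_coeff_bound[OF this, of "K * norm (y - z)" s t]
    show "\<bar>lev_bil J f y s t - lev_bil J f z s t\<bar> \<le> (real DIM('e))\<^sup>2 * K * norm (y - z) * norm s * norm t"
      using K(3) yz by (simp add: mult.assoc)
  qed
  moreover have "(real DIM('e))\<^sup>2 * K \<ge> 0" "min e1 e2 > 0" "ball x (min e1 e2) \<subseteq> G"
    using K(1,2) e2 by auto
  ultimately show ?thesis by blast
qed

lemma lev_bil_continuous: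
  assumes "Ck_on 2 f G" "x \<in> G" "c > 0"
  shows "eventually (\<lambda>y. y \<in> G \<and> (\<forall>s t. \<bar>lev_bil J f y s t - lev_bil J f x s t\<bar> \<le> c * norm s * norm t)) (nhds x)"
proof -
  \<comment> \<open>Passing from the coefficients to the whole form costs the square of the
    dimension, which is divided out in advance.\<close>
  define L where "L = c / (real DIM('e))\<^sup>2"
  have D: "real DIM('e) > 0" by simp
  have L: "L > 0" using assms(3) D by (simp add: L_def)
  have "continuous_on G (\<lambda>x. lev_bil J f x b b')" for b b'
    using lev_bil_coeff_C[of 0 f b b'] assms(1) by (simp add: numeral_2_eq_2)
  then have "eventually (\<lambda>y. \<forall>i\<in>Basis \<times> Basis. y \<in> G \<and> dist (lev_bil J f y (fst i) (snd i)) (lev_bil J f x (fst i) (snd i)) < L) (nhds x)"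
    by (intro eventually_ball_finite ballI continuous_on_eventually_close open_G assms L) auto
  moreover have "eventually (\<lambda>y. y \<in> G) (nhds x)" using eventually_nhds_in_open[OF open_G assms(2)] .
  ultimately show ?thesis
  proof eventually_elim
    case (elim y)
    have "bilinear (\<lambda>s t. lev_bil J f y s t - lev_bil J f x s t)"
      using lev_bil_bilinear[OF assms(1)] elim(2) assms(2) by (simp add: bilinear_def linear_compose_sub)
    moreover have "\<bar>lev_bil J f y b b' - lev_bil J f x b b'\<bar> \<le> L" if "b \<in> Basis" "b' \<in> Basis" for b b'
      using elim(1) that by (force simp: dist_real_def)
    ultimately have "\<bar>lev_bil J f y s t - lev_bil J f x s t\<bar> \<le> (real DIM('e))\<^sup>2 * L * norm s * norm t" for s t
      by (rule bilinear_coeff_bound)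
    then show ?case using elim(2) D by (simp add: L_def)
  qed
qed

lemma lev_bil_bounded:
  assumes "Ck_on 2 f G" "x \<in> G"
  shows "\<exists>K\<ge>0. eventually (\<lambda>y. y \<in> G \<and> (\<forall>s t. \<bar>lev_bil J f y s t\<bar> \<le> K * norm s * norm t)) (nhds x)"
proof -
  obtain K where K: "K > 0" "\<And>s t. norm (lev_bil J f x s t) \<le> norm s * norm t * K"
    using bounded_bilinear.pos_bounded lev_bil_bilinear[OF assms] bilinear_conv_bounded_bilinear by blast
  show ?thesis
  proof (intro exI[of _ "K + 1"] conjI)
    show "eventually (\<lambda>y. y \<in> G \<and> (\<forall>s t. \<bar>lev_bil J f y s t\<bar> \<le> (K + 1) * norm s * norm t)) (nhds x)"
      using lev_bil_continuous[OF assms zero_less_one]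
    proof eventually_elim
      case (elim y)
      have "\<bar>lev_bil J f y s t\<bar> \<le> (K + 1) * norm s * norm t" for s t
      proof -
        have "\<bar>lev_bil J f y s t - lev_bil J f x s t\<bar> \<le> 1 * norm s * norm t" using elim by blast
        moreover have "\<bar>lev_bil J f x s t\<bar> \<le> norm s * norm t * K" using K(2) by simp
        ultimately show ?thesis by (simp add: algebra_simps)
      qed
      then show ?case using elim by blast
    qed
  qed (use K in simp)
qed

end

lemma linear_family_lipschitz:
  fixes L :: "'a::euclidean_space \<Rightarrow> 'a \<Rightarrow> real"
  assumes "open G" "x \<in> G" "\<And>y. y \<in> G \<Longrightarrow> linear (L y)" "\<And>v. Ck_on 1 (\<lambda>y. L y v) G"
  shows "\<exists>K\<ge>0. \<exists>e>0. \<forall>y\<in>ball x e. \<forall>z\<in>ball x e. \<forall>v. \<bar>L y v - L z v\<bar> \<le> K * norm (y - z) * norm v"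
proof -
  have "\<exists>K\<ge>0. \<exists>e>0. \<forall>b\<in>Basis. \<forall>y\<in>ball x e. \<forall>z\<in>ball x e. \<bar>L y b - L z b\<bar> \<le> K * norm (y - z)"
    by (rule C1_lipschitz_family[where h = "\<lambda>b y. L y b", OF finite_Basis assms(1,2)]) (intro ballI assms(4))
  then obtain K e1 where K: "K \<ge> 0" "e1 > 0"
    "\<forall>b\<in>Basis. \<forall>y\<in>ball x e1. \<forall>z\<in>ball x e1. \<bar>L y b - L z b\<bar> \<le> K * norm (y - z)" by blast
  obtain e2 where e2: "e2 > 0" "ball x e2 \<subseteq> G" using assms(1,2) open_contains_ball by blast
  have "\<forall>y\<in>ball x (min e1 e2). \<forall>z\<in>ball x (min e1 e2). \<forall>v. \<bar>L y v - L z v\<bar> \<le> real DIM('a) * K * norm (y - z) * norm v"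
  proof (intro ballI allI)
    fix y z v assume yz: "y \<in> ball x (min e1 e2)" "z \<in> ball x (min e1 e2)"
    then have "y \<in> G" "z \<in> G" using e2(2) by auto
    then have l: "linear (\<lambda>v. L y v - L z v)" by (intro linear_compose_sub assms(3))
    have "norm (L y v - L z v) \<le> (\<Sum>b\<in>(Basis::'a set). K * norm (y - z)) * norm v"
      by (rule linear_basis_bound[where L = "\<lambda>v. L y v - L z v", OF l]) (use K(3) yz in simp)
    then show "\<bar>L y v - L z v\<bar> \<le> real DIM('a) * K * norm (y - z) * norm v"
      by (simp add: mult.assoc)
  qed
  moreover have "real DIM('a) * K \<ge> 0" "min e1 e2 > 0" using K(1,2) e2 by auto
  ultimately show ?thesis by blast
qed

section \<open>Lower bounds for the Levi form up to the boundary\<close>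

text \<open>Along \<open>n\<close> the function grows at rate at least 1/2, so a deficit of
  \<open>\<bar>f y\<bar>\<close> is made up within time \<open>2 * \<bar>f y\<bar>\<close>. The last
  two size conditions on \<open>y\<close> each use half of the radius and keep the segment inside
  the ball.\<close>

lemma zero_along_line:
  fixes f :: "'a::euclidean_space \<Rightarrow> real"
  assumes d: "\<And>z. z \<in> ball x e \<Longrightarrow> f differentiable (at z)"
    and n: "\<And>z. z \<in> ball x e \<Longrightarrow> fd f z n \<ge> 1/2"
    and y: "y \<in> ball x (e/2)" "f y < 0" "2 * \<bar>f y\<bar> * norm n < e/2"
  shows "\<exists>s\<ge>0. s \<le> 2 * \<bar>f y\<bar> \<and> f (y + s *\<^sub>R n) = 0 \<and> y + s *\<^sub>R n \<in> ball x e"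
proof -
  have b: "y + s *\<^sub>R n \<in> ball x e" if "0 \<le> s" "s \<le> 2 * \<bar>f y\<bar>" for s
  proof -
    have "norm (s *\<^sub>R n) \<le> 2 * \<bar>f y\<bar> * norm n" using that by (simp add: mult_right_mono)
    then have "dist y (y + s *\<^sub>R n) < e/2" using y(3) by (simp add: dist_norm)
    then show ?thesis using y(1) dist_triangle[of x "y + s *\<^sub>R n" y] unfolding mem_ball by linarith
  qed
  have D: "((\<lambda>s. f (y + s *\<^sub>R n)) has_real_derivative fd f (y + s *\<^sub>R n) n) (at s)"
    if "0 \<le> s" "s \<le> 2 * \<bar>f y\<bar>" for s
    by (rule has_real_derivative_along_line[OF d[OF b[OF that]]])
  have "\<exists>z. 0 < z \<and> z < 2 * \<bar>f y\<bar> \<and> f (y + (2 * \<bar>f y\<bar>) *\<^sub>R n) - f (y + 0 *\<^sub>R n) = (2 * \<bar>f y\<bar> - 0) * fd f (y + z *\<^sub>R n) n"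
    by (rule MVT2) (use y(2) D in auto)
  then obtain z where z: "0 < z" "z < 2 * \<bar>f y\<bar>" "f (y + (2 * \<bar>f y\<bar>) *\<^sub>R n) - f y = 2 * \<bar>f y\<bar> * fd f (y + z *\<^sub>R n) n"
    by auto
  have "2 * \<bar>f y\<bar> * fd f (y + z *\<^sub>R n) n \<ge> 2 * \<bar>f y\<bar> * (1/2)"
    using z by (intro mult_left_mono n b) auto
  moreover have "\<bar>f y\<bar> = - f y" using y(2) by simp
  ultimately have pos: "f (y + (2 * \<bar>f y\<bar>) *\<^sub>R n) \<ge> 0" using z(3) by linarith
  have "continuous_on {0..2 * \<bar>f y\<bar>} (\<lambda>s. f (y + s *\<^sub>R n))"
    by (intro continuous_at_imp_continuous_on ballI DERIV_isCont[OF D]) auto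
  then have "\<exists>s\<ge>0. s \<le> 2 * \<bar>f y\<bar> \<and> f (y + s *\<^sub>R n) = 0"
    using y(2) pos by (intro IVT') auto
  then show ?thesis using b by blast
qed

text \<open>For the complex structure \<open>j\<close>, the functional F(v) - i F(j v) is complex
  linear. So \<open>w\<close> is the complex multiple of \<open>n\<close> with the same value as
  \<open>t\<close>; the coefficients \<open>al\<close> and \<open>be\<close> are the real and
  imaginary parts of (P - iQ)/(a - ib), whose squared denominator is \<open>d\<close>.\<close>

lemma complex_tangent_projection:
  fixes F :: "'a::euclidean_space \<Rightarrow> real" and j :: "'a \<Rightarrow> 'a"
  assumes F: "linear F" and j: "linear j" "\<And>v. j (j v) = - v" "\<And>v. norm (j v) \<le> K * norm v"
    and n: "F n \<ge> 1/2"
  shows "\<exists>w. F (t - w) = 0 \<and> F (j (t - w)) = 0 \<and> norm w \<le> 2 * (1 + K) * norm n * (\<bar>F t\<bar> + \<bar>F (j t)\<bar>)"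
proof -
  define a b P Q where "a = F n" and "b = F (j n)" and "P = F t" and "Q = F (j t)"
  define d where "d = a\<^sup>2 + b\<^sup>2"
  have a: "a \<ge> 1/2" using n by (simp add: a_def)
  have ad: "\<bar>a\<bar> \<le> 2 * d"
  proof -
    have "a * (1/2) \<le> a * a" using a by (intro mult_left_mono) auto
    moreover have "0 \<le> b * b" "\<bar>a\<bar> = a" using a by simp_all
    ultimately show ?thesis unfolding d_def power2_eq_square by argo
  qed
  \<comment> \<open>Nothing bounds \<open>b\<close> in advance, but by completing the square it is
    at most b^2 + 1/4, and 1/4 is at most a^2. Hence the size of \<open>b\<close> does not affect
    the bound on \<open>w\<close>.\<close>
  have bd: "\<bar>b\<bar> \<le> 2 * d"
  proof -
    have "(1/2) * (1/2) \<le> a * a" using a by (intro mult_mono) auto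
    moreover have "0 \<le> (\<bar>b\<bar> - 1/2) * (\<bar>b\<bar> - 1/2)" by simp
    then have "\<bar>b\<bar> \<le> b * b + 1/4" by (simp add: algebra_simps)
    ultimately show ?thesis by (simp add: d_def power2_eq_square)
  qed
  have d: "d > 0" using a unfolding d_def by (intro add_pos_nonneg) auto
  define al be where "al = (a * P + b * Q) / d" and "be = (b * P - a * Q) / d"
  define w where "w = al *\<^sub>R n + be *\<^sub>R j n"
  have 1: "a * al + b * be = P"
  proof -
    have "a * al + b * be = (a * (a * P + b * Q) + b * (b * P - a * Q)) / d"
      unfolding al_def be_def by (simp add: add_divide_distrib distrib_left right_diff_distrib diff_divide_distrib)
    also have "a * (a * P + b * Q) + b * (b * P - a * Q) = P * d"
      by (simp add: d_def power2_eq_square algebra_simps)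
    finally show ?thesis using d by simp
  qed
  have 2: "b * al - a * be = Q"
  proof -
    have "b * al - a * be = (b * (a * P + b * Q) - a * (b * P - a * Q)) / d"
      unfolding al_def be_def by (simp add: add_divide_distrib distrib_left right_diff_distrib diff_divide_distrib)
    also have "b * (a * P + b * Q) - a * (b * P - a * Q) = Q * d"
      by (simp add: d_def power2_eq_square algebra_simps)
    finally show ?thesis using d by simp
  qed
  have "F (t - w) = P - (al * a + be * b)"
    by (simp add: w_def linear_diff[OF F] linear_add[OF F] linear_cmul[OF F] a_def b_def P_def)
  then have F1: "F (t - w) = 0" using 1 by (simp add: mult.commute)
  have "F (j (t - w)) = Q - (al * b - be * a)"
    by (simp add: w_def linear_diff[OF F] linear_add[OF F] linear_cmul[OF F] linear_neg[OF F]
      linear_diff[OF j(1)] linear_add[OF j(1)] linear_cmul[OF j(1)] j(2) a_def b_def Q_def)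
  then have F2: "F (j (t - w)) = 0" using 2 by (simp add: mult.commute)
  have alb: "\<bar>al\<bar> \<le> 2 * (\<bar>P\<bar> + \<bar>Q\<bar>)"
  proof -
    have "\<bar>a * P + b * Q\<bar> \<le> \<bar>a\<bar> * \<bar>P\<bar> + \<bar>b\<bar> * \<bar>Q\<bar>" using abs_triangle_ineq[of "a * P" "b * Q"] by (simp add: abs_mult)
    also have "\<dots> \<le> (2 * d) * \<bar>P\<bar> + (2 * d) * \<bar>Q\<bar>" using ad bd by (intro add_mono mult_right_mono) auto
    finally show ?thesis using d by (simp add: al_def pos_divide_le_eq algebra_simps)
  qed
  have beb: "\<bar>be\<bar> \<le> 2 * (\<bar>P\<bar> + \<bar>Q\<bar>)"
  proof -
    have "\<bar>b * P - a * Q\<bar> \<le> \<bar>b\<bar> * \<bar>P\<bar> + \<bar>a\<bar> * \<bar>Q\<bar>" using abs_triangle_ineq4[of "b * P" "a * Q"] by (simp add: abs_mult)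
    also have "\<dots> \<le> (2 * d) * \<bar>P\<bar> + (2 * d) * \<bar>Q\<bar>" using ad bd by (intro add_mono mult_right_mono) auto
    finally show ?thesis using d by (simp add: be_def pos_divide_le_eq algebra_simps)
  qed
  have "norm w \<le> \<bar>al\<bar> * norm n + \<bar>be\<bar> * norm (j n)"
    unfolding w_def using norm_triangle_ineq[of "al *\<^sub>R n" "be *\<^sub>R j n"] by simp
  also have "\<dots> \<le> 2 * (\<bar>P\<bar> + \<bar>Q\<bar>) * norm n + 2 * (\<bar>P\<bar> + \<bar>Q\<bar>) * (K * norm n)"
    using alb beb j(3)[of n] by (intro add_mono mult_mono) auto
  also have "\<dots> = 2 * (1 + K) * norm n * (\<bar>P\<bar> + \<bar>Q\<bar>)" by (simp add: algebra_simps)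
  finally show ?thesis using F1 F2 unfolding P_def Q_def by blast
qed

text \<open>Here \<open>P\<close> and \<open>Q\<close> stand for \<open>dr(t)/|r|\<close> and \<open>dr(Jt)/|r|\<close>, \<open>X\<close> and \<open>Y\<close> for \<open>d\<psi>(t)\<close> and \<open>d\<psi>(Jt)\<close>,
  and \<open>l\<close> for the Levi form of \<open>- ln(-r) + A \<psi>\<close> at \<open>t\<close>.\<close>

lemma levi_powr_inequality:
  fixes A C T P Q K M c l eta :: real
  assumes "c > 0" "A * c \<ge> C + C\<^sup>2 + 2" "T > 0"
    and l: "l \<ge> - C * T\<^sup>2 - C * T * (\<bar>P\<bar> + \<bar>Q\<bar>) + P\<^sup>2 + Q\<^sup>2 + A * (c * T\<^sup>2)"
    and X: "\<bar>X\<bar> \<le> K * T" and Y: "\<bar>Y\<bar> \<le> M * T"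
    and eta: "0 < eta" "eta \<le> 1/4" "eta * (2 * A\<^sup>2 * (K\<^sup>2 + M\<^sup>2)) \<le> 1"
  shows "l - eta * ((P + A * X)\<^sup>2 + (Q + A * Y)\<^sup>2) > 0"
proof -
  have sq: "(P + A * X)\<^sup>2 \<le> 2 * P\<^sup>2 + 2 * A\<^sup>2 * (K\<^sup>2 * T\<^sup>2)" if "\<bar>X\<bar> \<le> K * T" for P X K
  proof -
    have "(P + A * X)\<^sup>2 \<le> 2 * P\<^sup>2 + 2 * A\<^sup>2 * X\<^sup>2"
      using zero_le_power2[of "P - A * X"] by (simp add: power2_eq_square algebra_simps)
    also have "X\<^sup>2 \<le> K\<^sup>2 * T\<^sup>2"
      using power_mono[OF that, of 2] by (simp add: power_mult_distrib)
    then have "2 * P\<^sup>2 + 2 * A\<^sup>2 * X\<^sup>2 \<le> 2 * P\<^sup>2 + 2 * A\<^sup>2 * (K\<^sup>2 * T\<^sup>2)"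
      by (intro add_left_mono mult_left_mono) auto
    finally show ?thesis .
  qed
  have "(P + A * X)\<^sup>2 + (Q + A * Y)\<^sup>2 \<le> 2 * (P\<^sup>2 + Q\<^sup>2) + (2 * A\<^sup>2 * (K\<^sup>2 + M\<^sup>2)) * T\<^sup>2"
    using sq[OF X, of P] sq[OF Y, of Q] by (simp add: algebra_simps)
  then have "eta * ((P + A * X)\<^sup>2 + (Q + A * Y)\<^sup>2) \<le> eta * (2 * (P\<^sup>2 + Q\<^sup>2) + (2 * A\<^sup>2 * (K\<^sup>2 + M\<^sup>2)) * T\<^sup>2)"
    using eta by (intro mult_left_mono) auto
  also have "\<dots> = eta * (2 * (P\<^sup>2 + Q\<^sup>2)) + (eta * (2 * A\<^sup>2 * (K\<^sup>2 + M\<^sup>2))) * T\<^sup>2" by (simp add: algebra_simps)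
  \<comment> \<open>The bound 1/4 on eta limits the use of \<open>P\<^sup>2 + Q\<^sup>2\<close> to
    one half of it; the other smallness condition leaves at most a single
    \<open>T\<^sup>2\<close>.\<close>
  also have "\<dots> \<le> 1/4 * (2 * (P\<^sup>2 + Q\<^sup>2)) + 1 * T\<^sup>2"
    using eta by (intro add_mono mult_right_mono) auto
  finally have 1: "eta * ((P + A * X)\<^sup>2 + (Q + A * Y)\<^sup>2) \<le> (P\<^sup>2 + Q\<^sup>2) / 2 + T\<^sup>2" by argo
  \<comment> \<open>Each of the two mixed terms takes half of its square and leaves
    \<open>C\<^sup>2 * T\<^sup>2 / 2\<close>. Together with \<open>C * T\<^sup>2\<close> this
    explains the threshold C + C^2 + 2 for A c: the surplus of two \<open>T\<^sup>2\<close> pays for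
    the one lost to eta and leaves one over.\<close>
  have am: "C * T * \<bar>P\<bar> \<le> P\<^sup>2 / 2 + C\<^sup>2 * T\<^sup>2 / 2" for P
    using zero_le_power2[of "\<bar>P\<bar> - C * T"] by (simp add: power2_diff power_mult_distrib algebra_simps)
  have *: "(A * c) * T\<^sup>2 \<ge> (C + C\<^sup>2 + 2) * T\<^sup>2" using assms(2) by (intro mult_right_mono) auto
  then have "l \<ge> (P\<^sup>2 + Q\<^sup>2) / 2 + 2 * T\<^sup>2"
  proof -
    have lin: "(p + q) / 2 + 2 * s \<le> l" if "- a - (x + y) + p + q + b \<le> l" "x \<le> p/2 + d/2" "y \<le> q/2 + d/2"
      "a + d + 2 * s \<le> b" for a b d p q s x y :: real
      using that by argo
    show ?thesis
    proof (rule lin[OF _ am[of P] am[of Q]])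
      show "- (C * T\<^sup>2) - (C * T * \<bar>P\<bar> + C * T * \<bar>Q\<bar>) + P\<^sup>2 + Q\<^sup>2 + A * c * T\<^sup>2 \<le> l"
        using l by (simp add: algebra_simps)
      show "C * T\<^sup>2 + C\<^sup>2 * T\<^sup>2 + 2 * T\<^sup>2 \<le> A * c * T\<^sup>2" using * by (simp add: algebra_simps)
    qed
  qed
  moreover have "T\<^sup>2 > 0" using assms(3) by simp
  ultimately show ?thesis using 1 by linarith
qed

context local_acs
begin

text \<open>Near \<open>x\<close> the size of \<open>f\<close> stays above \<open>- f x / 2\<close>,
  so a plain bound \<open>K\<close> can be rewritten with a factor \<open>\<bar>f y\<bar>\<close>.
  The artificial shape matches the boundary estimate, and a single continuation serves both.\<close>

lemma levi_lower_bound_interior: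
  assumes "Ck_on 2 f G" "x \<in> G" "f x < 0"
  shows "\<exists>C\<ge>0. eventually (\<lambda>y. y \<in> G \<and> (f y < 0 \<longrightarrow> (\<forall>t. lev J f y t \<ge>
    - C * \<bar>f y\<bar> * (norm t)\<^sup>2 - C * norm t * (\<bar>fd f y t\<bar> + \<bar>fd f y (J y t)\<bar>)))) (nhds x)"
proof -
  obtain K where K: "K \<ge> 0" "eventually (\<lambda>y. y \<in> G \<and> (\<forall>s t. \<bar>lev_bil J f y s t\<bar> \<le> K * norm s * norm t)) (nhds x)"
    using lev_bil_bounded[OF assms(1,2)] by blast
  have c: "continuous_on G f" by (rule Ck_on_continuous_on[OF assms(1)])
  have "- f x / 2 > 0" using assms(3) by simp
  from continuous_on_eventually_close[OF open_G c assms(2) this] K(2)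
  have "eventually (\<lambda>y. y \<in> G \<and> (f y < 0 \<longrightarrow> (\<forall>t. lev J f y t \<ge>
    - (K / (- f x / 2)) * \<bar>f y\<bar> * (norm t)\<^sup>2 - (K / (- f x / 2)) * norm t * (\<bar>fd f y t\<bar> + \<bar>fd f y (J y t)\<bar>)))) (nhds x)"
  proof eventually_elim
    case (elim y)
    have y: "y \<in> G" using elim by blast
    have f: "\<bar>f y\<bar> \<ge> - f x / 2" using elim(1) assms(3) unfolding dist_real_def by linarith
    have "lev J f y t \<ge> - (K / (- f x / 2)) * \<bar>f y\<bar> * (norm t)\<^sup>2 - (K / (- f x / 2)) * norm t * (\<bar>fd f y t\<bar> + \<bar>fd f y (J y t)\<bar>)" for t
    proof -
      have "\<bar>lev_bil J f y t t\<bar> \<le> K * norm t * norm t" using elim(2) by blast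
      then have 1: "lev J f y t \<ge> - (K * (norm t)\<^sup>2)"
        unfolding lev_eq_bil[OF assms(1) y] by (simp add: power2_eq_square abs_le_iff mult.assoc)
      have "K * 1 \<le> K * (\<bar>f y\<bar> / (- f x / 2))"
        using f assms(3) K(1) by (intro mult_left_mono) (simp_all add: field_simps)
      then have "K * 1 * (norm t)\<^sup>2 \<le> K * (\<bar>f y\<bar> / (- f x / 2)) * (norm t)\<^sup>2" by (rule mult_right_mono) simp
      moreover have "0 \<le> K / (- f x / 2) * norm t * (\<bar>fd f y t\<bar> + \<bar>fd f y (J y t)\<bar>)"
        using K(1) assms(3) by (intro mult_nonneg_nonneg divide_nonneg_nonneg) auto
      ultimately show ?thesis using 1 by (simp add: algebra_simps)
    qed
    then show ?case using y by blast
  qed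
  moreover have "K / (- f x / 2) \<ge> 0" using K(1) assms(3) by (intro divide_nonneg_nonneg) auto
  ultimately show ?thesis by blast
qed

text \<open>The bound is obtained by moving from \<open>y\<close> to the zero set of \<open>f\<close> along \<open>n\<close> and there splitting
  off from \<open>t\<close> its component transversal to the complex tangent space.\<close>

lemma levi_lower_bound_boundary:
  assumes f: "Ck_on 3 f G" and x: "x \<in> G" "f x = 0" "fd f x n0 \<noteq> 0"
    and convex: "\<And>y v t. y \<in> G \<Longrightarrow> f y = 0 \<Longrightarrow> fd f y v \<noteq> 0 \<Longrightarrow> fd f y t = 0 \<Longrightarrow> fd f y (J y t) = 0 \<Longrightarrow> lev J f y t \<ge> 0"
  shows "\<exists>C\<ge>0. eventually (\<lambda>y. y \<in> G \<and> (f y < 0 \<longrightarrow> (\<forall>t. lev J f y t \<ge>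
    - C * \<bar>f y\<bar> * (norm t)\<^sup>2 - C * norm t * (\<bar>fd f y t\<bar> + \<bar>fd f y (J y t)\<bar>)))) (nhds x)"
proof -
  have f2: "Ck_on 2 f G" using Ck_on_mono[OF f] by simp
  have f3: "Ck_on (Suc (Suc (Suc 0))) f G" using f by (simp only: numeral_3_eq_3)
  note f_diff = C2_differentiable(1)[OF f2]
  have lin_f: "linear (fd f y)" if "y \<in> G" for y by (rule fd_linear[OF f_diff[OF that]])
  have lin_w: "linear (\<lambda>v. fd f y (J y v))" if "y \<in> G" for y
    using linear_compose[OF J_linear[OF that] lin_f[OF that]] by (simp add: o_def)
  have C1f: "Ck_on 1 (\<lambda>y. fd f y v) G" for v
    using Ck_on_SucD[OF Ck_on_fd[OF f3, of v]] by (simp only: One_nat_def)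
  have C1w: "Ck_on 1 (\<lambda>y. fd f y (J y v)) G" for v
    using Ck_on_SucD[OF form_C[OF f3, of v]] by (simp only: One_nat_def)
  \<comment> \<open>Normalised to derivative 1 at \<open>x\<close>, so that it is at least 1/2
    throughout a neighbourhood.\<close>
  define n where "n = (1 / fd f x n0) *\<^sub>R n0"
  have n: "fd f x n = 1" using x(3) linear_cmul[OF lin_f[OF x(1)]] by (simp add: n_def)
  have "\<exists>K\<ge>0. eventually (\<lambda>y. y \<in> G \<and> (\<forall>v. norm (fd f y v) \<le> K * norm v)) (nhds x)"
    by (rule linear_family_bounded[OF open_G x(1) lin_f Ck_on_continuous_on[OF C1f]])
  then obtain K1 where K1: "K1 \<ge> 0" "eventually (\<lambda>y. y \<in> G \<and> (\<forall>v. norm (fd f y v) \<le> K1 * norm v)) (nhds x)" by blast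
  have "\<exists>K\<ge>0. eventually (\<lambda>y. y \<in> G \<and> (\<forall>v. norm (J y v) \<le> K * norm v)) (nhds x)"
    by (rule linear_family_bounded[OF open_G x(1) J_linear Ck_on_continuous_on[OF J_smooth]])
  then obtain K2 where K2: "K2 \<ge> 0" "eventually (\<lambda>y. y \<in> G \<and> (\<forall>v. norm (J y v) \<le> K2 * norm v)) (nhds x)" by blast
  obtain K3 where K3: "K3 \<ge> 0" "eventually (\<lambda>y. y \<in> G \<and> (\<forall>s t. \<bar>lev_bil J f y s t\<bar> \<le> K3 * norm s * norm t)) (nhds x)"
    using lev_bil_bounded[OF f2 x(1)] by blast
  obtain K4 e4 where K4: "K4 \<ge> 0" "e4 > 0" "\<forall>y\<in>ball x e4. \<forall>z\<in>ball x e4. \<forall>s t.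
    \<bar>lev_bil J f y s t - lev_bil J f z s t\<bar> \<le> K4 * norm (y - z) * norm s * norm t"
    using lev_bil_lipschitz[OF f x(1)] by blast
  have "\<exists>K\<ge>0. \<exists>e>0. \<forall>y\<in>ball x e. \<forall>z\<in>ball x e. \<forall>v. \<bar>fd f y v - fd f z v\<bar> \<le> K * norm (y - z) * norm v"
    by (rule linear_family_lipschitz[OF open_G x(1) lin_f C1f])
  then obtain K5 e5 where K5: "K5 \<ge> 0" "e5 > 0"
    "\<forall>y\<in>ball x e5. \<forall>z\<in>ball x e5. \<forall>v. \<bar>fd f y v - fd f z v\<bar> \<le> K5 * norm (y - z) * norm v" by blast
  have "\<exists>K\<ge>0. \<exists>e>0. \<forall>y\<in>ball x e. \<forall>z\<in>ball x e. \<forall>v. \<bar>fd f y (J y v) - fd f z (J z v)\<bar> \<le> K * norm (y - z) * norm v"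
    by (rule linear_family_lipschitz[where L = "\<lambda>y v. fd f y (J y v)", OF open_G x(1) lin_w C1w])
  then obtain K6 e6 where K6: "K6 \<ge> 0" "e6 > 0"
    "\<forall>y\<in>ball x e6. \<forall>z\<in>ball x e6. \<forall>v. \<bar>fd f y (J y v) - fd f z (J z v)\<bar> \<le> K6 * norm (y - z) * norm v" by blast
  have "eventually (\<lambda>y. y \<in> G \<and> dist (fd f y n) (fd f x n) < 1/2) (nhds x)"
    by (rule continuous_on_eventually_close[OF open_G Ck_on_continuous_on[OF C1f] x(1)]) simp
  with K1(2) K2(2) K3(2)
  have "eventually (\<lambda>y. y \<in> G \<and> (\<forall>v. norm (fd f y v) \<le> K1 * norm v) \<and> (\<forall>v. norm (J y v) \<le> K2 * norm v)
     \<and> (\<forall>s t. \<bar>lev_bil J f y s t\<bar> \<le> K3 * norm s * norm t) \<and> fd f y n \<ge> 1/2) (nhds x)"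
    by eventually_elim (auto simp: n dist_real_def abs_if split: if_splits)
  then obtain e0 where e0: "e0 > 0" "\<forall>y\<in>ball x e0. y \<in> G \<and> (\<forall>v. norm (fd f y v) \<le> K1 * norm v) \<and> (\<forall>v. norm (J y v) \<le> K2 * norm v)
     \<and> (\<forall>s t. \<bar>lev_bil J f y s t\<bar> \<le> K3 * norm s * norm t) \<and> fd f y n \<ge> 1/2"
    by (rule eventually_nhds_ballE)
  define e where "e = min e0 (min e4 (min e5 e6))"
  have e: "e > 0" using e0(1) K4(2) K5(2) K6(2) by (simp add: e_def)
  have in_e: "y \<in> ball x e0" "y \<in> ball x e4" "y \<in> ball x e5" "y \<in> ball x e6" if "y \<in> ball x e" for y
    using that by (auto simp: e_def)
  \<comment> \<open>\<open>K7\<close> bounds the transversal part \<open>w\<close> by the values of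
    df on \<open>t\<close> and \<open>J t\<close>, \<open>K8\<close> bounds it by \<open>t\<close>,
    \<open>C1\<close> bounds the cross terms at the zero, and \<open>N\<close> bounds the distance
    to that zero by a multiple of \<open>\<bar>f y\<bar>\<close>.\<close>
  define K7 where "K7 = 2 * (1 + K2) * norm n"
  define K8 where "K8 = K7 * (K1 + K1 * K2)"
  define C1 where "C1 = K3 * K7 * (2 + K8)"
  define N where "N = 2 * norm n"
  \<comment> \<open>Three sources: cross terms at the zero \<open>z\<close>, the change of df and of
    its pullback between \<open>z\<close> and \<open>y\<close>, and the change of the Levi form
    itself.\<close>
  define C where "C = C1 + C1 * (K5 + K6) * N + K4 * N"
  have nonneg: "K7 \<ge> 0" "K8 \<ge> 0" "C1 \<ge> 0" "N \<ge> 0"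
    using K1(1) K2(1) K3(1) by (simp_all add: K7_def K8_def C1_def N_def)
  have C: "C \<ge> C1" "C \<ge> C1 * (K5 + K6) * N + K4 * N" "C \<ge> 0"
    using nonneg K4(1) K5(1) K6(1) by (simp_all add: C_def)
  have main: "lev J f y t \<ge> - C * \<bar>f y\<bar> * (norm t)\<^sup>2 - C * norm t * (\<bar>fd f y t\<bar> + \<bar>fd f y (J y t)\<bar>)"
    if y: "y \<in> ball x (e/2)" "f y < 0" "2 * \<bar>f y\<bar> * norm n < e/2" for y t
  proof -
    have ye: "y \<in> ball x e" using y(1) e by simp
    have yG: "y \<in> G" using e0(2) in_e(1)[OF ye] by blast
    have "\<exists>s\<ge>0. s \<le> 2 * \<bar>f y\<bar> \<and> f (y + s *\<^sub>R n) = 0 \<and> y + s *\<^sub>R n \<in> ball x e"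
    proof (rule zero_along_line[where f = f and n = n and x = x and e = e and y = y])
      fix z assume "z \<in> ball x e"
      then have "z \<in> ball x e0" by (rule in_e)
      then show "f differentiable (at z)" "fd f z n \<ge> 1/2" using e0(2) f_diff by blast+
    qed (rule y)+
    then obtain s where s: "0 \<le> s" "s \<le> 2 * \<bar>f y\<bar>" "f (y + s *\<^sub>R n) = 0" "y + s *\<^sub>R n \<in> ball x e" by blast
    define z where "z = y + s *\<^sub>R n"
    have z: "f z = 0" "z \<in> ball x e" using s by (simp_all add: z_def)
    have yz: "norm (y - z) \<le> N * \<bar>f y\<bar>"
    proof -
      have "norm (y - z) = s * norm n" using s(1) by (simp add: z_def)
      also have "\<dots> \<le> 2 * \<bar>f y\<bar> * norm n" using s(2) by (rule mult_right_mono) simp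
      finally show ?thesis by (simp add: N_def mult_ac)
    qed
    have z0: "z \<in> G" "\<And>v. norm (fd f z v) \<le> K1 * norm v" "\<And>v. norm (J z v) \<le> K2 * norm v"
      "\<And>s t. \<bar>lev_bil J f z s t\<bar> \<le> K3 * norm s * norm t" "fd f z n \<ge> 1/2"
      using e0(2) in_e(1)[OF z(2)] by blast+
    define P Q where "P = fd f z t" and "Q = fd f z (J z t)"
    have "\<exists>w. fd f z (t - w) = 0 \<and> fd f z (J z (t - w)) = 0 \<and> norm w \<le> 2 * (1 + K2) * norm n * (\<bar>fd f z t\<bar> + \<bar>fd f z (J z t)\<bar>)"
      by (rule complex_tangent_projection[OF lin_f[OF z0(1)] J_linear[OF z0(1)] J_J[OF z0(1)] z0(3,5)])
    then obtain w where w: "fd f z (t - w) = 0" "fd f z (J z (t - w)) = 0" "norm w \<le> K7 * (\<bar>P\<bar> + \<bar>Q\<bar>)"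
      unfolding K7_def P_def Q_def by blast
    have "\<bar>P\<bar> \<le> K1 * norm t" using z0(2)[of t] by (simp add: P_def)
    moreover have "\<bar>Q\<bar> \<le> K1 * (K2 * norm t)"
    proof -
      have "\<bar>Q\<bar> \<le> K1 * norm (J z t)" using z0(2)[of "J z t"] by (simp add: Q_def)
      also have "\<dots> \<le> K1 * (K2 * norm t)" using z0(3) K1(1) by (rule mult_left_mono)
      finally show ?thesis .
    qed
    ultimately have "\<bar>P\<bar> + \<bar>Q\<bar> \<le> (K1 + K1 * K2) * norm t" by (simp add: algebra_simps)
    then have "K7 * (\<bar>P\<bar> + \<bar>Q\<bar>) \<le> K7 * ((K1 + K1 * K2) * norm t)" using nonneg(1) by (rule mult_left_mono)
    then have w8: "norm w \<le> K8 * norm t" using w(3) by (simp add: K8_def mult.assoc)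
    have tw: "norm (t - w) + norm t \<le> (2 + K8) * norm t"
      using norm_triangle_ineq4[of t w] w8 by (simp add: algebra_simps)
    have bl: "bilinear (lev_bil J f z)" by (rule lev_bil_bilinear[OF f2 z0(1)])
    \<comment> \<open>The growth of \<open>f\<close> along \<open>n\<close> supplies the
      nonvanishing derivative at \<open>z\<close> that the convexity hypothesis asks for.\<close>
    have "lev J f z (t - w) \<ge> 0" using convex[OF z0(1) z(1), of n] w z0(5) by simp
    then have "lev_bil J f z (t - w) (t - w) \<ge> 0" by (simp add: lev_eq_bil[OF f2 z0(1)])
    \<comment> \<open>\<open>lev_bil\<close> need not be symmetric, so the two cross terms stay
      distinct. Each contains \<open>w\<close> once and is therefore controlled by
      \<open>\<bar>P\<bar> + \<bar>Q\<bar>\<close>.\<close>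
    moreover have "lev_bil J f z t t = lev_bil J f z (t - w) (t - w) + lev_bil J f z (t - w) w + lev_bil J f z w t"
      by (simp add: bilinear_lsub[OF bl] bilinear_rsub[OF bl])
    moreover have "\<bar>lev_bil J f z (t - w) w\<bar> + \<bar>lev_bil J f z w t\<bar> \<le> C1 * norm t * (\<bar>P\<bar> + \<bar>Q\<bar>)"
    proof -
      have "\<bar>lev_bil J f z (t - w) w\<bar> + \<bar>lev_bil J f z w t\<bar> \<le> K3 * norm (t - w) * norm w + K3 * norm w * norm t"
        by (intro add_mono z0(4))
      also have "\<dots> = K3 * (norm w * (norm (t - w) + norm t))" by (simp add: algebra_simps)
      also have "\<dots> \<le> K3 * ((K7 * (\<bar>P\<bar> + \<bar>Q\<bar>)) * ((2 + K8) * norm t))"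
        using w(3) tw nonneg by (intro mult_left_mono[OF _ K3(1)] mult_mono) auto
      finally show ?thesis by (simp add: C1_def mult_ac)
    qed
    ultimately have 1: "lev_bil J f z t t \<ge> - (C1 * norm t * (\<bar>P\<bar> + \<bar>Q\<bar>))" by linarith
    have lip: "K * norm (y - z) * norm t \<le> K * (N * \<bar>f y\<bar>) * norm t" if "K \<ge> 0" for K
      using yz that by (intro mult_right_mono mult_left_mono) auto
    have "\<bar>lev_bil J f y t t - lev_bil J f z t t\<bar> \<le> K4 * norm (y - z) * norm t * norm t"
      using K4(3) in_e(2)[OF ye] in_e(2)[OF z(2)] by blast
    also have "\<dots> \<le> K4 * (N * \<bar>f y\<bar>) * norm t * norm t" using lip[OF K4(1)] by (rule mult_right_mono) simp
    finally have 2: "\<bar>lev_bil J f y t t - lev_bil J f z t t\<bar> \<le> K4 * N * \<bar>f y\<bar> * (norm t)\<^sup>2"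
      by (simp add: power2_eq_square mult_ac)
    have "\<bar>fd f y t - P\<bar> \<le> K5 * norm (y - z) * norm t"
      unfolding P_def using K5(3) in_e(3)[OF ye] in_e(3)[OF z(2)] by blast
    then have 3: "\<bar>P\<bar> \<le> \<bar>fd f y t\<bar> + K5 * (N * \<bar>f y\<bar>) * norm t" using lip[OF K5(1)] by linarith
    have "\<bar>fd f y (J y t) - Q\<bar> \<le> K6 * norm (y - z) * norm t"
      unfolding Q_def using K6(3) in_e(4)[OF ye] in_e(4)[OF z(2)] by blast
    then have 4: "\<bar>Q\<bar> \<le> \<bar>fd f y (J y t)\<bar> + K6 * (N * \<bar>f y\<bar>) * norm t" using lip[OF K6(1)] by linarith
    \<comment> \<open>The derivatives at \<open>z\<close> are now traded for those at
      \<open>y\<close>. The error carries both \<open>\<bar>f y\<bar>\<close> and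
      \<open>norm t\<close>, hence joins the first, harmless kind of term.\<close>
    define R where "R = \<bar>fd f y t\<bar> + \<bar>fd f y (J y t)\<bar>"
    have "\<bar>P\<bar> + \<bar>Q\<bar> \<le> R + (K5 + K6) * N * \<bar>f y\<bar> * norm t"
      using 3 4 by (simp add: R_def algebra_simps)
    then have "C1 * norm t * (\<bar>P\<bar> + \<bar>Q\<bar>) \<le> C1 * norm t * (R + (K5 + K6) * N * \<bar>f y\<bar> * norm t)"
      using nonneg(3) by (intro mult_left_mono) auto
    also have "\<dots> = C1 * norm t * R + (C1 * (K5 + K6) * N) * \<bar>f y\<bar> * (norm t)\<^sup>2"
      by (simp add: algebra_simps power2_eq_square)
    finally have "lev J f y t \<ge> - (C1 * norm t * R) - (C1 * (K5 + K6) * N) * \<bar>f y\<bar> * (norm t)\<^sup>2 - K4 * N * \<bar>f y\<bar> * (norm t)\<^sup>2"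
      using 1 2 unfolding lev_eq_bil[OF f2 yG] by linarith
    moreover have "C1 * norm t * R \<le> C * norm t * R" using C(1) by (intro mult_right_mono) (auto simp: R_def)
    moreover have "(C1 * (K5 + K6) * N + K4 * N) * \<bar>f y\<bar> * (norm t)\<^sup>2 \<le> C * \<bar>f y\<bar> * (norm t)\<^sup>2"
      using C(2) by (intro mult_right_mono) auto
    ultimately show ?thesis unfolding R_def by (simp add: distrib_right)
  qed
  \<comment> \<open>Smallness of \<open>f\<close> that lets the transversal through \<open>y\<close>
    reach the zero set before leaving the ball.\<close>
  have "e / (4 * (norm n + 1)) > 0" using e by (simp add: add_nonneg_pos)
  from continuous_on_eventually_close[OF open_G Ck_on_continuous_on[OF f2] x(1) this]
  have "eventually (\<lambda>y. y \<in> G \<and> \<bar>f y\<bar> < e / (4 * (norm n + 1))) (nhds x)"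
    by (simp add: x(2) dist_real_def)
  moreover have "eventually (\<lambda>y. y \<in> ball x (e/2)) (nhds x)" using e by (intro eventually_nhds_in_open) auto
  ultimately have "eventually (\<lambda>y. y \<in> G \<and> (f y < 0 \<longrightarrow> (\<forall>t. lev J f y t \<ge>
    - C * \<bar>f y\<bar> * (norm t)\<^sup>2 - C * norm t * (\<bar>fd f y t\<bar> + \<bar>fd f y (J y t)\<bar>)))) (nhds x)"
  proof eventually_elim
    case (elim y)
    have "2 * \<bar>f y\<bar> * norm n \<le> 2 * \<bar>f y\<bar> * (norm n + 1)" by (intro mult_left_mono) auto
    also have "\<dots> < e/2"
    proof -
      have "norm n + 1 > 0" by (simp add: add_nonneg_pos)
      with elim(1) show ?thesis by (simp add: pos_less_divide_eq algebra_simps)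
    qed
    finally have small: "2 * \<bar>f y\<bar> * norm n < e/2" .
    show ?case using elim(1) main[OF elim(2) _ small] by blast
  qed
  then show ?thesis using C(3) by blast
qed

end

section \<open>Positivity for the power of the defining function in coordinates\<close>

context local_acs
begin

lemma lev_lower_bound_positive:
  assumes "Ck_on 2 g G" "x \<in> G" "\<And>t. t \<noteq> 0 \<Longrightarrow> lev J g x t > 0"
  shows "\<exists>c>0. eventually (\<lambda>y. y \<in> G \<and> (\<forall>t. lev J g y t \<ge> c * (norm t)\<^sup>2)) (nhds x)"
proof -
  have bl: "bilinear (lev_bil J g x)" by (rule lev_bil_bilinear[OF assms(1,2)])
  then have "bounded_bilinear (lev_bil J g x)" by (simp add: bilinear_conv_bounded_bilinear)
  then have "continuous_on (sphere 0 1) (\<lambda>t. lev_bil J g x t t)"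
    by (rule bounded_bilinear.continuous_on) (intro continuous_intros)+
  moreover have "sphere (0::'e) 1 \<noteq> {}" by simp
  ultimately obtain t0 where t0: "t0 \<in> sphere 0 1" "\<forall>t\<in>sphere 0 1. lev_bil J g x t0 t0 \<le> lev_bil J g x t t"
    using continuous_attains_inf[OF compact_sphere] by blast
  \<comment> \<open>Half of the minimum on the unit sphere; the other half is given up when the
    point moves.\<close>
  define c where "c = lev_bil J g x t0 t0 / 2"
  have "t0 \<noteq> 0" using t0(1) by auto
  then have c: "c > 0" using assms(3)[of t0] by (simp add: c_def lev_eq_bil[OF assms(1,2)])
  have low: "lev_bil J g x t t \<ge> 2 * c * (norm t)\<^sup>2" for t
  proof (cases "t = 0")
    case True
    then show ?thesis by (simp add: bilinear_lzero[OF bl])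
  next
    case False
    define u where "u = (1 / norm t) *\<^sub>R t"
    have "u \<in> sphere 0 1" using False by (simp add: u_def)
    then have "lev_bil J g x u u \<ge> 2 * c" using t0(2) by (simp add: c_def)
    moreover have "lev_bil J g x t t = (norm t)\<^sup>2 * lev_bil J g x u u"
    proof -
      have "t = norm t *\<^sub>R u" using False by (simp add: u_def)
      then have "lev_bil J g x t t = lev_bil J g x (norm t *\<^sub>R u) (norm t *\<^sub>R u)" by simp
      also have "\<dots> = (norm t)\<^sup>2 * lev_bil J g x u u"
        by (simp add: bilinear_lmul[OF bl] bilinear_rmul[OF bl] power2_eq_square)
      finally show ?thesis .
    qed
    ultimately show ?thesis using mult_left_mono[of "2 * c" "lev_bil J g x u u" "(norm t)\<^sup>2"]
      by (simp add: mult.commute)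
  qed
  have "eventually (\<lambda>y. y \<in> G \<and> (\<forall>t. lev J g y t \<ge> c * (norm t)\<^sup>2)) (nhds x)"
    using lev_bil_continuous[OF assms(1,2) c]
  proof eventually_elim
    case (elim y)
    have "lev J g y t \<ge> c * (norm t)\<^sup>2" for t
    proof -
      have "\<bar>lev_bil J g y t t - lev_bil J g x t t\<bar> \<le> c * norm t * norm t" using elim by blast
      then have "\<bar>lev_bil J g y t t - lev_bil J g x t t\<bar> \<le> c * (norm t)\<^sup>2" by (simp add: power2_eq_square mult.assoc)
      moreover have "2 * c * (norm t)\<^sup>2 = c * (norm t)\<^sup>2 + c * (norm t)\<^sup>2" by simp
      moreover have "lev J g y t = lev_bil J g y t t" using elim lev_eq_bil[OF assms(1)] by blast
      ultimately show ?thesis using low[of t] by linarith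
    qed
    then show ?case using elim by blast
  qed
  then show ?thesis using c by blast
qed

text \<open>Two applications of the chain rule, with -ln(-s) and with -exp(-eta s), after which a
  positive factor comes out. Negativity of \<open>f\<close> on all of \<open>G\<close> makes the
  logarithm a C^2 function there; it is arranged by shrinking the domain.\<close>

lemma lev_powr_formula:
  assumes f: "Ck_on 2 f G" and g: "Ck_on 2 g G" and y: "y \<in> G" and neg: "\<And>q. q \<in> G \<Longrightarrow> f q < 0"
  shows "lev J (\<lambda>q. - ((- f q * exp (- A * g q)) powr \<eta>)) y t =
    \<eta> * (- f y * exp (- A * g y)) powr \<eta> *
      (lev J f y t / \<bar>f y\<bar> + ((fd f y t / \<bar>f y\<bar>)\<^sup>2 + (fd f y (J y t) / \<bar>f y\<bar>)\<^sup>2) + A * lev J g y t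
       - \<eta> * ((fd f y t / \<bar>f y\<bar> + A * fd g y t)\<^sup>2 + (fd f y (J y t) / \<bar>f y\<bar> + A * fd g y (J y t))\<^sup>2))"
proof -
  define l where "l q = - ln (- f q)" for q
  define u where "u q = l q + A * g q" for q
  have l_der: "((\<lambda>s. - ln (- s)) has_real_derivative - 1 / f q) (at (f q))" if "q \<in> G" for q
    using neg[OF that] by (auto intro!: derivative_eq_intros simp: field_simps)
  have l_der2: "((\<lambda>s. - 1 / s) has_real_derivative 1 / (f y)\<^sup>2) (at (f y))"
    using neg[OF y] by (auto intro!: derivative_eq_intros simp: field_simps power2_eq_square)
  have lev_l: "lev J l y t = - 1 / f y * lev J f y t + 1 / (f y)\<^sup>2 * ((fd f y t)\<^sup>2 + (fd f y (J y t))\<^sup>2)"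
    unfolding l_def by (rule lev_compose[where h' = "\<lambda>s. - 1 / s", OF f y l_der l_der2])
  have f2: "Ck_on (Suc (Suc 0)) f G" using f by (simp only: numeral_2_eq_2)
  have dl: "(l has_derivative (\<lambda>v. - 1 / f q * fd f q v)) (at q)" if "q \<in> G" for q
    unfolding l_def using that by (intro has_derivative_real_compose fd_works C2_differentiable[OF f] l_der)
  \<comment> \<open>The derivative of \<open>l\<close> is \<open>- 1 / f\<close> times that of
    \<open>f\<close>, so class C^2 of \<open>l\<close> reduces to class C^1 of this factor.\<close>
  have inv: "Ck_on (Suc 0) (\<lambda>q. - 1 / f q) G"
  proof (rule Ck_on_SucI[OF open_G])
    show "((\<lambda>q. - 1 / f q) has_derivative (\<lambda>v. 1 / (f q)\<^sup>2 * fd f q v)) (at q)" if "q \<in> G" for q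
    proof (rule has_derivative_real_compose[where h = "\<lambda>s. - 1 / s"])
      show "(f has_derivative fd f q) (at q)" using that by (intro fd_works C2_differentiable[OF f])
      show "((\<lambda>s. - 1 / s) has_real_derivative 1 / (f q)\<^sup>2) (at (f q))"
        using neg[OF that] by (auto intro!: derivative_eq_intros simp: field_simps power2_eq_square)
    qed
    have "continuous_on G f" by (rule Ck_on_continuous_on[OF f])
    moreover have "continuous_on G (\<lambda>q. fd f q v)" for v by (rule Ck_on_continuous_on[OF Ck_on_fd[OF f2]])
    moreover have "\<forall>q\<in>G. (f q)\<^sup>2 \<noteq> 0" using neg by fastforce
    ultimately show "Ck_on 0 (\<lambda>q. 1 / (f q)\<^sup>2 * fd f q v) G" for v
      by (simp only: Ck_on.simps) (intro continuous_intros)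
  qed
  have "Ck_on (Suc (Suc 0)) l G"
    by (rule Ck_on_SucI[OF open_G dl]) (assumption, intro Ck_on_mult open_G inv Ck_on_fd[OF f2])
  then have lC: "Ck_on 2 l G" by (simp only: numeral_2_eq_2)
  have "Ck_on 2 (\<lambda>q. A * g q) G" by (intro Ck_on_mult open_G Ck_on_const g)
  then have uC: "Ck_on 2 u G" unfolding u_def using lC by (intro Ck_on_add open_G)
  have lev_u: "lev J u y t = lev J l y t + A * lev J g y t"
    unfolding u_def by (rule lev_add_scale[OF lC g y])
  have du: "fd u y v = - 1 / f y * fd f y v + A * fd g y v" for v
  proof -
    have "(u has_derivative (\<lambda>v. - 1 / f y * fd f y v + A * fd g y v)) (at y)"
      unfolding u_def
      by (intro has_derivative_add has_derivative_mult_right dl y fd_works C2_differentiable[OF g])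
    from fd_eqI[OF this] show ?thesis by (rule fun_cong)
  qed
  have rho: "- ((- f q * exp (- A * g q)) powr \<eta>) = - exp (- \<eta> * u q)" if "q \<in> G" for q
  proof -
    have "(- f q * exp (- A * g q)) powr \<eta> = exp (\<eta> * ln (- f q * exp (- A * g q)))"
      using neg[OF that] by (simp add: powr_def)
    also have "ln (- f q * exp (- A * g q)) = - u q"
      using neg[OF that] ln_mult_pos[of "- f q" "exp (- A * g q)"] by (simp add: u_def l_def)
    finally show ?thesis by simp
  qed
  have "lev J (\<lambda>q. - ((- f q * exp (- A * g q)) powr \<eta>)) y t = lev J (\<lambda>q. - exp (- \<eta> * u q)) y t"
    by (rule lev_cong[OF open_G y rho])
  also have "\<dots> = \<eta> * exp (- \<eta> * u y) * lev J u y t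
      + (- \<eta>\<^sup>2 * exp (- \<eta> * u y)) * ((fd u y t)\<^sup>2 + (fd u y (J y t))\<^sup>2)"
  proof (rule lev_compose[where h = "\<lambda>s. - exp (- \<eta> * s)" and h' = "\<lambda>s. \<eta> * exp (- \<eta> * s)", OF uC y])
    show "((\<lambda>s. - exp (- \<eta> * s)) has_real_derivative \<eta> * exp (- \<eta> * s)) (at s)" for s
      by (auto intro!: derivative_eq_intros)
    show "((\<lambda>s. \<eta> * exp (- \<eta> * s)) has_real_derivative - \<eta>\<^sup>2 * exp (- \<eta> * u y)) (at (u y))"
      by (auto intro!: derivative_eq_intros simp: power2_eq_square)
  qed
  also have "\<dots> = \<eta> * exp (- \<eta> * u y) * (lev J u y t - \<eta> * ((fd u y t)\<^sup>2 + (fd u y (J y t))\<^sup>2))"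
    by (simp add: algebra_simps power2_eq_square)
  also have "exp (- \<eta> * u y) = (- f y * exp (- A * g y)) powr \<eta>" using rho[OF y] by simp
  also have "lev J u y t - \<eta> * ((fd u y t)\<^sup>2 + (fd u y (J y t))\<^sup>2) =
     lev J f y t / \<bar>f y\<bar> + ((fd f y t / \<bar>f y\<bar>)\<^sup>2 + (fd f y (J y t) / \<bar>f y\<bar>)\<^sup>2) + A * lev J g y t
       - \<eta> * ((fd f y t / \<bar>f y\<bar> + A * fd g y t)\<^sup>2 + (fd f y (J y t) / \<bar>f y\<bar> + A * fd g y (J y t))\<^sup>2)"
    using neg[OF y] by (simp add: lev_u lev_l du power_divide add_divide_distrib)
  finally show ?thesis .
qed

text \<open>The neighbourhood \<open>V\<close> and the threshold \<open>A0\<close> precede A, and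
  only the bound on eta follows it: this order is what permits a common A for finitely many
  neighbourhoods.\<close>

lemma local_psh_powr:
  assumes f: "Ck_on 2 f G" and g: "Ck_on 2 g G" and x: "x \<in> G"
    and pos: "\<And>t. t \<noteq> 0 \<Longrightarrow> lev J g x t > 0"
    and C: "C \<ge> 0" "eventually (\<lambda>y. y \<in> G \<and> (f y < 0 \<longrightarrow> (\<forall>t. lev J f y t \<ge>
      - C * \<bar>f y\<bar> * (norm t)\<^sup>2 - C * norm t * (\<bar>fd f y t\<bar> + \<bar>fd f y (J y t)\<bar>)))) (nhds x)"
  shows "\<exists>A0>0. \<exists>V. open V \<and> x \<in> V \<and> V \<subseteq> G \<and> (\<forall>A\<ge>A0. \<exists>\<eta>0>0. \<forall>\<eta>. 0 < \<eta> \<and> \<eta> \<le> \<eta>0 \<longrightarrow>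
    (\<forall>y\<in>V. f y < 0 \<longrightarrow> (\<forall>t. t \<noteq> 0 \<longrightarrow> lev J (\<lambda>q. - ((- f q * exp (- A * g q)) powr \<eta>)) y t > 0)))"
proof -
  obtain c where c: "c > 0" "eventually (\<lambda>y. y \<in> G \<and> (\<forall>t. lev J g y t \<ge> c * (norm t)\<^sup>2)) (nhds x)"
    using lev_lower_bound_positive[OF g x pos] by blast
  have g2: "Ck_on (Suc (Suc 0)) g G" using g by (simp only: numeral_2_eq_2)
  have lin_g: "linear (fd g y)" if "y \<in> G" for y by (rule fd_linear[OF C2_differentiable(1)[OF g that]])
  have lin_w: "linear (\<lambda>v. fd g y (J y v))" if "y \<in> G" for y
    using linear_compose[OF J_linear[OF that] lin_g[OF that]] by (simp add: o_def)
  have "\<exists>K\<ge>0. eventually (\<lambda>y. y \<in> G \<and> (\<forall>v. norm (fd g y v) \<le> K * norm v)) (nhds x)"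
    by (rule linear_family_bounded[OF open_G x lin_g Ck_on_continuous_on[OF Ck_on_fd[OF g2]]])
  then obtain K where K: "eventually (\<lambda>y. y \<in> G \<and> (\<forall>v. norm (fd g y v) \<le> K * norm v)) (nhds x)" by blast
  have "\<exists>K\<ge>0. eventually (\<lambda>y. y \<in> G \<and> (\<forall>v. norm (fd g y (J y v)) \<le> K * norm v)) (nhds x)"
    by (rule linear_family_bounded[where L = "\<lambda>y v. fd g y (J y v)", OF open_G x lin_w Ck_on_continuous_on[OF form_C[OF g2]]])
  then obtain M where M: "eventually (\<lambda>y. y \<in> G \<and> (\<forall>v. norm (fd g y (J y v)) \<le> M * norm v)) (nhds x)" by blast
  have "eventually (\<lambda>y. y \<in> G \<and> (f y < 0 \<longrightarrow> (\<forall>t. lev J f y t \<ge>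
      - C * \<bar>f y\<bar> * (norm t)\<^sup>2 - C * norm t * (\<bar>fd f y t\<bar> + \<bar>fd f y (J y t)\<bar>)))
      \<and> (\<forall>t. lev J g y t \<ge> c * (norm t)\<^sup>2) \<and> (\<forall>v. norm (fd g y v) \<le> K * norm v)
      \<and> (\<forall>v. norm (fd g y (J y v)) \<le> M * norm v)) (nhds x)"
    using C(2) c(2) K M by eventually_elim blast
  then obtain e where e: "e > 0" "\<forall>y\<in>ball x e. y \<in> G \<and> (f y < 0 \<longrightarrow> (\<forall>t. lev J f y t \<ge>
      - C * \<bar>f y\<bar> * (norm t)\<^sup>2 - C * norm t * (\<bar>fd f y t\<bar> + \<bar>fd f y (J y t)\<bar>)))
      \<and> (\<forall>t. lev J g y t \<ge> c * (norm t)\<^sup>2) \<and> (\<forall>v. norm (fd g y v) \<le> K * norm v)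
      \<and> (\<forall>v. norm (fd g y (J y v)) \<le> M * norm v)"
    by (rule eventually_nhds_ballE)
  \<comment> \<open>Makes \<open>A * c\<close> reach the amount needed to absorb every negative
    multiple of the squared norm of \<open>t\<close>.\<close>
  define A0 where "A0 = (C + C\<^sup>2 + 2) / c"
  have A0: "A0 > 0" using C(1) c(1) by (simp add: A0_def add_nonneg_pos)
  \<comment> \<open>Encodes both smallness conditions on eta; the 1 keeps the denominator positive
    even if the bounds \<open>K\<close> and \<open>M\<close> on d psi vanish.\<close>
  define E where "E A = min (1/4) (1 / (2 * A\<^sup>2 * (K\<^sup>2 + M\<^sup>2) + 1))" for A :: real
  have E: "E A > 0" for A by (simp add: E_def add_nonneg_pos)
  have main: "lev J (\<lambda>q. - ((- f q * exp (- A * g q)) powr \<eta>)) y t > 0"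
    if A: "A \<ge> A0" and eta: "0 < \<eta>" "\<eta> \<le> E A" and y: "y \<in> ball x e" "f y < 0" and t: "t \<noteq> 0" for A \<eta> y t
  proof -
    have yG: "y \<in> G" using e(2) y(1) by blast
    \<comment> \<open>The logarithm exists only where \<open>f\<close> is negative. The Levi form is
      local, so it may be computed on this open part.\<close>
    define S where "S = {q \<in> G. f q < 0}"
    have oS: "open S"
    proof -
      have "S = f -` {..<0} \<inter> G" by (auto simp: S_def)
      then show ?thesis using continuous_on_open_vimage[OF open_G] Ck_on_continuous_on[OF f] open_lessThan by metis
    qed
    have SG: "S \<subseteq> G" by (auto simp: S_def)
    interpret S: local_acs S J by (rule restrict[OF oS SG])
    have yS: "y \<in> S" using yG y(2) by (simp add: S_def)
    have formula: "lev J (\<lambda>q. - ((- f q * exp (- A * g q)) powr \<eta>)) y t =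
      \<eta> * (- f y * exp (- A * g y)) powr \<eta> *
      (lev J f y t / \<bar>f y\<bar> + ((fd f y t / \<bar>f y\<bar>)\<^sup>2 + (fd f y (J y t) / \<bar>f y\<bar>)\<^sup>2) + A * lev J g y t
       - \<eta> * ((fd f y t / \<bar>f y\<bar> + A * fd g y t)\<^sup>2 + (fd f y (J y t) / \<bar>f y\<bar> + A * fd g y (J y t))\<^sup>2))"
      by (rule S.lev_powr_formula[OF Ck_on_subset[OF f SG] Ck_on_subset[OF g SG] yS]) (simp add: S_def)
    have fy: "\<bar>f y\<bar> > 0" using y(2) by simp
    define T P Q where "T = norm t" and "P = fd f y t / \<bar>f y\<bar>" and "Q = fd f y (J y t) / \<bar>f y\<bar>"
    have low_f: "lev J f y t / \<bar>f y\<bar> \<ge> - C * T\<^sup>2 - C * T * (\<bar>P\<bar> + \<bar>Q\<bar>)"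
    proof -
      have "lev J f y t \<ge> - C * \<bar>f y\<bar> * (norm t)\<^sup>2 - C * norm t * (\<bar>fd f y t\<bar> + \<bar>fd f y (J y t)\<bar>)"
        using e(2) y by blast
      also have "- C * \<bar>f y\<bar> * (norm t)\<^sup>2 - C * norm t * (\<bar>fd f y t\<bar> + \<bar>fd f y (J y t)\<bar>)
        = (- C * T\<^sup>2 - C * T * (\<bar>P\<bar> + \<bar>Q\<bar>)) * \<bar>f y\<bar>"
        using fy by (simp add: T_def P_def Q_def algebra_simps)
      finally show ?thesis using fy by (simp add: pos_le_divide_eq)
    qed
    have "A0 * c = C + C\<^sup>2 + 2" using c(1) by (simp add: A0_def)
    then have Ac: "A * c \<ge> C + C\<^sup>2 + 2" using mult_right_mono[OF A, of c] c(1) by simp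
    have A_pos: "A > 0" using A A0 by simp
    have "lev J g y t \<ge> c * T\<^sup>2" using e(2) y(1) unfolding T_def by blast
    then have low_g: "A * lev J g y t \<ge> A * (c * T\<^sup>2)" using A_pos by simp
    have d: "2 * A\<^sup>2 * (K\<^sup>2 + M\<^sup>2) + 1 > 0" by (simp add: add_nonneg_pos)
    have eta2: "\<eta> * (2 * A\<^sup>2 * (K\<^sup>2 + M\<^sup>2)) \<le> 1"
    proof -
      have "\<eta> \<le> 1 / (2 * A\<^sup>2 * (K\<^sup>2 + M\<^sup>2) + 1)" using eta(2) by (simp add: E_def)
      then have "\<eta> * (2 * A\<^sup>2 * (K\<^sup>2 + M\<^sup>2) + 1) \<le> 1" using d by (simp add: pos_le_divide_eq)
      then show ?thesis using eta(1) by (simp add: distrib_left)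
    qed
    have "lev J f y t / \<bar>f y\<bar> + (P\<^sup>2 + Q\<^sup>2) + A * lev J g y t - \<eta> * ((P + A * fd g y t)\<^sup>2 + (Q + A * fd g y (J y t))\<^sup>2) > 0"
    proof (rule levi_powr_inequality[OF c(1) Ac])
      show "T > 0" using t by (simp add: T_def)
      show "- C * T\<^sup>2 - C * T * (\<bar>P\<bar> + \<bar>Q\<bar>) + P\<^sup>2 + Q\<^sup>2 + A * (c * T\<^sup>2) \<le> lev J f y t / \<bar>f y\<bar> + (P\<^sup>2 + Q\<^sup>2) + A * lev J g y t"
        using low_f low_g by linarith
      show "\<bar>fd g y t\<bar> \<le> K * T" "\<bar>fd g y (J y t)\<bar> \<le> M * T" using e(2) y(1) by (auto simp: T_def)
      show "\<eta> \<le> 1/4" using eta(2) by (simp add: E_def)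
    qed (fact eta(1) eta2)+
    moreover have "\<eta> * (- f y * exp (- A * g y)) powr \<eta> > 0" using eta(1) y(2) by simp
    ultimately show ?thesis unfolding formula P_def Q_def by (rule mult_pos_pos[rotated])
  qed
  show ?thesis
  proof (rule exI[of _ A0], rule conjI[OF A0], rule exI[of _ "ball x e"], intro conjI allI impI)
    fix A assume A: "A \<ge> A0"
    show "\<exists>\<eta>0>0. \<forall>\<eta>. 0 < \<eta> \<and> \<eta> \<le> \<eta>0 \<longrightarrow>
      (\<forall>y\<in>ball x e. f y < 0 \<longrightarrow> (\<forall>t. t \<noteq> 0 \<longrightarrow> lev J (\<lambda>q. - ((- f q * exp (- A * g q)) powr \<eta>)) y t > 0))"
      using main[OF A] E[of A] by blast
  qed (use e in auto)
qed

end

section \<open>Almost complex manifolds\<close>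

text \<open>The exterior derivative commutes with pullback, here for the form \<open>w\<close> and a
  map intertwining the two complex structures. In coordinates, second derivatives of
  \<open>\<Phi>\<close> appear in both terms of \<open>lev\<close>.\<close>

lemma lev_pullback:
  fixes \<Phi> :: "'e::euclidean_space \<Rightarrow> 'e"
  assumes S: "open S" "x \<in> S" and acs: "local_acs S0 J0" and \<Phi>: "Ck_on 2 \<Phi> S" "\<And>y. y \<in> S \<Longrightarrow> \<Phi> y \<in> S0"
    and f0: "Ck_on 2 f0 S0" and f: "\<And>y. y \<in> S \<Longrightarrow> f y = f0 (\<Phi> y)"
    and J: "\<And>y v. y \<in> S \<Longrightarrow> fd \<Phi> y (J1 y v) = J0 (\<Phi> y) (fd \<Phi> y v)"
  shows "lev J1 f x t = lev J0 f0 (\<Phi> x) (fd \<Phi> x t)"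
proof -
  interpret S0: local_acs S0 J0 by (rule acs)
  have \<Phi>2: "Ck_on (Suc (Suc 0)) \<Phi> S" using \<Phi>(1) by (simp only: numeral_2_eq_2)
  have d\<Phi>: "(\<Phi> has_derivative fd \<Phi> y) (at y)" if "y \<in> S" for y
    by (rule fd_works[OF Ck_on_Suc_differentiable[OF \<Phi>2 that]])
  define w where "w z v = fd f0 z (J0 z v)" for z v
  have lin_w: "linear (w z)" if "z \<in> S0" for z
    using linear_compose[OF S0.J_linear[OF that] fd_linear[OF S0.C2_differentiable(1)[OF f0 that]]]
    by (simp add: o_def w_def[abs_def])
  have dw: "((\<lambda>z. w z v) has_derivative fd (\<lambda>z. w z v) z) (at z)" if "z \<in> S0" for z v
    unfolding w_def by (rule fd_works[OF S0.form_differentiable[OF f0 that]])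
  have form: "fd f y (J1 y v) = w (\<Phi> y) (fd \<Phi> y v)" if y: "y \<in> S" for y v
  proof -
    have "fd f y = fd (\<lambda>y. f0 (\<Phi> y)) y" by (rule fd_cong_open[OF S(1) y f])
    moreover have "((\<lambda>y. f0 (\<Phi> y)) has_derivative (\<lambda>v. fd f0 (\<Phi> y) (fd \<Phi> y v))) (at y)"
      by (rule has_derivative_compose[OF d\<Phi>[OF y] fd_works[OF S0.C2_differentiable(1)[OF f0 \<Phi>(2)[OF y]]]])
    ultimately have "fd f y = (\<lambda>v. fd f0 (\<Phi> y) (fd \<Phi> y v))" by (simp only: fd_eqI)
    then show ?thesis by (simp add: w_def J[OF y])
  qed
  have comp_der: "((\<lambda>y. w (\<Phi> y) a) has_derivative (\<lambda>s. fd (\<lambda>z. w z a) (\<Phi> x) (fd \<Phi> x s))) (at x)" for a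
    by (rule has_derivative_compose[OF d\<Phi>[OF S(2)] dw[OF \<Phi>(2)[OF S(2)]]])
  have comp: "fd (\<lambda>y. w (\<Phi> y) a) x s = fd (\<lambda>z. w z a) (\<Phi> x) (fd \<Phi> x s)" for a s
    by (rule fun_cong[OF fd_eqI[OF comp_der]])
  have main: "fd (\<lambda>y. fd f y (J1 y v)) x s = fd (\<lambda>z. w z (fd \<Phi> x v)) (\<Phi> x) (fd \<Phi> x s)
      + w (\<Phi> x) (fd (\<lambda>y. fd \<Phi> y v) x s)" for v s
  proof -
    have 1: "fd (\<lambda>y. fd f y (J1 y v)) x = fd (\<lambda>y. w (\<Phi> y) (fd \<Phi> y v)) x"
      by (rule fd_cong_open[OF S form])
    have 2: "((\<lambda>y. w (\<Phi> y) (fd \<Phi> y v)) has_derivative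
        (\<lambda>s. fd (\<lambda>y. w (\<Phi> y) (fd \<Phi> x v)) x s + w (\<Phi> x) (fd (\<lambda>y. fd \<Phi> y v) x s))) (at x)"
    proof (rule linear_family_has_derivative[OF S])
      show "linear (w (\<Phi> y))" if "y \<in> S" for y by (rule lin_w[OF \<Phi>(2)[OF that]])
      show "(\<lambda>y. w (\<Phi> y) v) differentiable (at x)" for v by (rule differentiableI[OF comp_der])
      show "((\<lambda>y. fd \<Phi> y v) has_derivative fd (\<lambda>y. fd \<Phi> y v) x) (at x)"
        by (rule fd_works[OF Ck_on_Suc_differentiable[OF Ck_on_fd[OF \<Phi>2] S(2)]])
    qed
    show ?thesis unfolding 1 fun_cong[OF fd_eqI[OF 2]] comp ..
  qed
  \<comment> \<open>The two contributions of second derivatives are equal by symmetry and cancel in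
    the difference.\<close>
  have "fd (\<lambda>y. fd \<Phi> y t) x (J1 x t) = fd (\<lambda>y. fd \<Phi> y (J1 x t)) x t"
    by (rule second_derivative_symmetric[OF S(1) \<Phi>(1) S(2)])
  then show ?thesis
    unfolding lev_def main by (simp add: J[OF S(2)] w_def)
qed

section \<open>Tangent vectors and the complex structure in charts\<close>

locale almost_complex_mfd =
  fixes \<A> :: "('m::{t2_space, second_countable_topology}, 'e::euclidean_space) chart set"
    and J :: "'m \<Rightarrow> ('m, 'e) tvec \<Rightarrow> ('m, 'e) tvec"
  assumes acm: "almost_complex_manifold \<A> J"
begin

abbreviation "T \<equiv> tangent_space \<A>"

definition chart_J :: "('m, 'e) chart \<Rightarrow> 'e \<Rightarrow> 'e \<Rightarrow> 'e" where
  "chart_J c x v = J (chart_inv c x) (coord_vec \<A> c (chart_inv c x) v) c"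

lemma atlas: "smooth_atlas \<A>"
  using acm by (simp add: almost_complex_manifold_def)

lemma is_chart: "c \<in> \<A> \<Longrightarrow> is_chart c"
  using atlas by (simp add: smooth_atlas_def)

lemma charts_at_iff: "c \<in> charts_at \<A> p \<longleftrightarrow> c \<in> \<A> \<and> p \<in> chart_dom c"
  by (simp add: charts_at_def)

lemma chart_at_in: "chart_at \<A> p \<in> charts_at \<A> p"
proof -
  have "p \<in> (\<Union>c\<in>\<A>. chart_dom c)" using atlas by (simp add: smooth_atlas_def)
  then have "\<exists>c. c \<in> charts_at \<A> p" by (auto simp: charts_at_iff)
  then show ?thesis unfolding chart_at_def by (rule someI_ex)
qed

lemma open_chart_dom: "c \<in> \<A> \<Longrightarrow> open (chart_dom c)"
  using is_chart by (simp add: is_chart_def)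

lemma chart_homeo: "c \<in> \<A> \<Longrightarrow> homeomorphism (chart_dom c) (chart_map c ` chart_dom c) (chart_map c) (chart_inv c)"
  using is_chart by (simp add: is_chart_def)

lemma chart_inv_map: "c \<in> \<A> \<Longrightarrow> p \<in> chart_dom c \<Longrightarrow> chart_inv c (chart_map c p) = p"
  using chart_homeo by (simp add: homeomorphism_def)

lemma chart_inv_in:
  assumes "c \<in> \<A>" "x \<in> chart_map c ` (chart_dom c \<inter> W)"
  shows "chart_inv c x \<in> chart_dom c" "chart_inv c x \<in> W" "chart_map c (chart_inv c x) = x"
  using assms(2) by (auto simp: chart_inv_map[OF assms(1)])

lemma open_chart_image:
  assumes "c \<in> \<A>" "open W" shows "open (chart_map c ` (chart_dom c \<inter> W))"
proof -
  have "openin (top_of_set (chart_dom c)) (chart_dom c \<inter> W)"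
    using assms(2) by blast
  from homeomorphism_imp_open_map[OF chart_homeo[OF assms(1)] this]
  have "openin (top_of_set (chart_map c ` chart_dom c)) (chart_map c ` (chart_dom c \<inter> W))" .
  then show ?thesis using is_chart[OF assms(1)] openin_open_trans by (auto simp: is_chart_def)
qed

lemma open_chart_preimage:
  assumes "c \<in> \<A>" "open S" shows "open {q \<in> chart_dom c. chart_map c q \<in> S}"
proof -
  have "continuous_on (chart_dom c) (chart_map c)" using chart_homeo[OF assms(1)] by (simp add: homeomorphism_def)
  then have "open (chart_map c -` S \<inter> chart_dom c)"
    using continuous_on_open_vimage[OF open_chart_dom[OF assms(1)]] assms(2) by blast
  then show ?thesis by (simp add: vimage_def Int_def conj_commute)
qed

lemma transition_smooth:
  assumes "c \<in> \<A>" "c' \<in> \<A>"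
  shows "Ck_on k (transition c c') (chart_map c ` (chart_dom c \<inter> chart_dom c'))"
  using atlas assms by (simp add: smooth_atlas_def smooth_on_def)

lemma transition_has_derivative:
  assumes "c \<in> charts_at \<A> p" "c' \<in> charts_at \<A> p"
  shows "(transition c c' has_derivative fd (transition c c') (chart_map c p)) (at (chart_map c p))"
proof -
  have c: "c \<in> \<A>" "c' \<in> \<A>" "p \<in> chart_dom c" "p \<in> chart_dom c'" using assms by (auto simp: charts_at_iff)
  have "chart_map c p \<in> chart_map c ` (chart_dom c \<inter> chart_dom c')" using c by blast
  from fd_works[OF Ck_on_Suc_differentiable[OF transition_smooth[OF c(1,2), of "Suc 0"] this]]
  show ?thesis .
qed

lemma transition_at:
  "c \<in> charts_at \<A> p \<Longrightarrow> transition c c' (chart_map c p) = chart_map c' p"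
  by (simp add: transition_def charts_at_iff chart_inv_map)

text \<open>Chain rule for the cocycle relation of transition maps; it makes coordinate vectors
  compatible families.\<close>

lemma transition_fd_comp:
  assumes "c \<in> charts_at \<A> p" "c' \<in> charts_at \<A> p" "c'' \<in> charts_at \<A> p"
  shows "fd (transition c c'') (chart_map c p) v
    = fd (transition c' c'') (chart_map c' p) (fd (transition c c') (chart_map c p) v)"
proof -
  have c: "c \<in> \<A>" "c' \<in> \<A>" "p \<in> chart_dom c" "p \<in> chart_dom c'" using assms by (auto simp: charts_at_iff)
  have 1: "(transition c' c'' has_derivative fd (transition c' c'') (chart_map c' p)) (at (transition c c' (chart_map c p)))"
    unfolding transition_at[OF assms(1)] by (rule transition_has_derivative[OF assms(2,3)])
  have d: "((\<lambda>y. transition c' c'' (transition c c' y)) has_derivative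
    (\<lambda>v. fd (transition c' c'') (chart_map c' p) (fd (transition c c') (chart_map c p) v))) (at (chart_map c p))"
    by (rule has_derivative_compose[OF transition_has_derivative[OF assms(1,2)] 1])
  have "fd (\<lambda>y. transition c' c'' (transition c c' y)) (chart_map c p) = fd (transition c c'') (chart_map c p)"
  proof (rule fd_cong_open[OF open_chart_image[OF c(1) open_chart_dom[OF c(2)]]])
    show "chart_map c p \<in> chart_map c ` (chart_dom c \<inter> chart_dom c')" using c by blast
    fix y assume "y \<in> chart_map c ` (chart_dom c \<inter> chart_dom c')"
    from chart_inv_in[OF c(1) this] show "transition c' c'' (transition c c' y) = transition c c'' y"
      by (simp add: transition_def chart_inv_map[OF c(2)])
  qed
  then show ?thesis using fun_cong[OF fd_eqI[OF d], of v] by simp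
qed

lemma transition_fd_self:
  assumes "c \<in> charts_at \<A> p" shows "fd (transition c c) (chart_map c p) v = v"
proof -
  have c: "c \<in> \<A>" "p \<in> chart_dom c" using assms by (auto simp: charts_at_iff)
  have "fd (transition c c) (chart_map c p) = fd (\<lambda>y. y) (chart_map c p)"
  proof (rule fd_cong_open[OF open_chart_image[OF c(1) open_UNIV]])
    show "chart_map c p \<in> chart_map c ` (chart_dom c \<inter> UNIV)" using c by blast
    show "transition c c y = y" if "y \<in> chart_map c ` (chart_dom c \<inter> UNIV)" for y
      using chart_inv_in[OF c(1) that] by (simp add: transition_def)
  qed
  moreover have "fd (\<lambda>y. y) (chart_map c p) = (\<lambda>v. v)" by (rule fd_eqI) (rule has_derivative_ident)
  ultimately show ?thesis by simp
qed

lemma tangent_component: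
  "t \<in> T p \<Longrightarrow> c \<in> charts_at \<A> p \<Longrightarrow> c' \<in> charts_at \<A> p \<Longrightarrow> t c' = fd (transition c c') (chart_map c p) (t c)"
  unfolding tangent_space_def by blast

lemma coord_vec_self: "c \<in> charts_at \<A> p \<Longrightarrow> coord_vec \<A> c p v c = v"
  by (simp add: coord_vec_def transition_fd_self)

lemma coord_vec_in:
  assumes "c \<in> charts_at \<A> p" shows "coord_vec \<A> c p v \<in> T p"
  unfolding tangent_space_def
proof (intro CollectI conjI allI impI ballI)
  fix c' c'' assume c: "c' \<in> charts_at \<A> p" "c'' \<in> charts_at \<A> p"
  show "coord_vec \<A> c p v c'' = fd (transition c' c'') (chart_map c' p) (coord_vec \<A> c p v c')"
    using transition_fd_comp[OF assms c] c by (simp add: coord_vec_def)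
qed (simp add: coord_vec_def)

text \<open>One component determines a tangent vector, so each chart identifies the tangent space
  with the model space.\<close>

lemma coord_vec_component:
  assumes "t \<in> T p" "c \<in> charts_at \<A> p" shows "coord_vec \<A> c p (t c) = t"
proof
  fix c' show "coord_vec \<A> c p (t c) c' = t c'"
  proof (cases "c' \<in> charts_at \<A> p")
    case True
    from tangent_component[OF assms True, symmetric] show ?thesis by (simp only: coord_vec_def True if_True)
  next
    case False
    then have "t c' = 0" using assms(1) unfolding tangent_space_def by blast
    with False show ?thesis by (simp add: coord_vec_def)
  qed
qed

lemma coord_vec_linear:
  assumes "c \<in> charts_at \<A> p"
  shows "coord_vec \<A> c p (a *\<^sub>R v + b *\<^sub>R w) = (\<lambda>c'. a *\<^sub>R coord_vec \<A> c p v c' + b *\<^sub>R coord_vec \<A> c p w c')"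
proof
  fix c'
  show "coord_vec \<A> c p (a *\<^sub>R v + b *\<^sub>R w) c' = a *\<^sub>R coord_vec \<A> c p v c' + b *\<^sub>R coord_vec \<A> c p w c'"
  proof (cases "c' \<in> charts_at \<A> p")
    case True
    have "linear (fd (transition c c') (chart_map c p))"
      by (rule has_derivative_linear[OF transition_has_derivative[OF assms True]])
    then show ?thesis using True by (simp add: coord_vec_def linear_add linear_cmul)
  qed (simp add: coord_vec_def)
qed

lemma J_in: "t \<in> T p \<Longrightarrow> J p t \<in> T p"
  using acm by (simp add: almost_complex_manifold_def)

lemma J_J: "t \<in> T p \<Longrightarrow> J p (J p t) = (\<lambda>c. - t c)"
  using acm by (simp add: almost_complex_manifold_def)

lemma J_lin: "s \<in> T p \<Longrightarrow> t \<in> T p \<Longrightarrow> J p (\<lambda>c. a *\<^sub>R s c + b *\<^sub>R t c) = (\<lambda>c. a *\<^sub>R J p s c + b *\<^sub>R J p t c)"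
  using acm by (simp add: almost_complex_manifold_def)

lemma J_component:
  assumes "t \<in> T p" "c \<in> charts_at \<A> p" shows "J p t c = chart_J c (chart_map c p) (t c)"
  using assms by (simp add: chart_J_def charts_at_iff chart_inv_map coord_vec_component)

text \<open>The bridge to the coordinate results. The square of \<open>J\<close> survives the
  passage because \<open>J p t\<close> can be recovered from its component in
  \<open>c\<close>.\<close>

lemma chart_local_acs:
  assumes c: "c \<in> \<A>" and W: "open W"
  shows "local_acs (chart_map c ` (chart_dom c \<inter> W)) (chart_J c)"
proof (rule local_acs.intro)
  let ?G = "chart_map c ` (chart_dom c \<inter> W)"
  show "open ?G" by (rule open_chart_image[OF c W])
  have at: "c \<in> charts_at \<A> (chart_inv c x)" if "x \<in> ?G" for x
    using chart_inv_in[OF c that] c by (simp add: charts_at_iff)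
  have lin: "chart_J c x (a *\<^sub>R v + b *\<^sub>R w) = a *\<^sub>R chart_J c x v + b *\<^sub>R chart_J c x w" if "x \<in> ?G" for x a b v w
    unfolding chart_J_def coord_vec_linear[OF at[OF that]]
      J_lin[OF coord_vec_in[OF at[OF that]] coord_vec_in[OF at[OF that]]] ..
  show "linear (chart_J c x)" if "x \<in> ?G" for x
  proof (rule linearI)
    show "chart_J c x (v + w) = chart_J c x v + chart_J c x w" for v w
      using lin[OF that, of 1 v 1 w] by simp
    show "chart_J c x (a *\<^sub>R v) = a *\<^sub>R chart_J c x v" for a v
      using lin[OF that, of a v 0 v] by simp
  qed
  show "chart_J c x (chart_J c x v) = - v" if "x \<in> ?G" for x v
  proof -
    let ?p = "chart_inv c x" and ?t = "coord_vec \<A> c (chart_inv c x) v"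
    have t: "?t \<in> T ?p" by (rule coord_vec_in[OF at[OF that]])
    have "chart_J c x (chart_J c x v) = J ?p (coord_vec \<A> c ?p (J ?p ?t c)) c" by (simp add: chart_J_def)
    also have "\<dots> = J ?p (J ?p ?t) c" by (simp add: coord_vec_component[OF J_in[OF t] at[OF that]])
    also have "\<dots> = - v" by (simp add: J_J[OF t] coord_vec_self[OF at[OF that]])
    finally show ?thesis .
  qed
  have "smooth_on (\<lambda>x. chart_J c x v) (chart_map c ` chart_dom c)" for v
  proof -
    have "\<forall>c\<in>\<A>. \<forall>v. smooth_on (\<lambda>x. J (chart_inv c x) (coord_vec \<A> c (chart_inv c x) v) c) (chart_map c ` chart_dom c)"
      by (rule acm[unfolded almost_complex_manifold_def, THEN conjunct2, THEN conjunct2, THEN conjunct2])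
    from bspec[OF this c] show ?thesis unfolding chart_J_def by (rule spec)
  qed
  then have "Ck_on k (\<lambda>x. chart_J c x v) (chart_map c ` chart_dom c)" for k v
    unfolding smooth_on_def by (rule spec)
  then show "Ck_on k (\<lambda>x. chart_J c x v) ?G" for k v by (rule Ck_on_subset) blast
qed

section \<open>Chart independence of the differential and the Levi form\<close>

lemma chart_C:
  assumes "Ck_fun_on \<A> k u W" "c \<in> \<A>"
  shows "Ck_on k (u \<circ> chart_inv c) (chart_map c ` (chart_dom c \<inter> W))"
  using assms by (simp add: Ck_fun_on_def)

lemma chart_map_in: "c \<in> charts_at \<A> p \<Longrightarrow> p \<in> W \<Longrightarrow> chart_map c p \<in> chart_map c ` (chart_dom c \<inter> W)"
  by (auto simp: charts_at_iff)

text \<open>The chart chosen by \<open>chart_at\<close> may jump from point to point. Replacing it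
  by a fixed chart is what makes it possible to differentiate the differential.\<close>

lemma differential_chart:
  assumes u: "Ck_fun_on \<A> (Suc k) u W" and p: "open W" "p \<in> W" and c: "c \<in> charts_at \<A> p" and t: "t \<in> T p"
  shows "differential \<A> u p t = fd (u \<circ> chart_inv c) (chart_map c p) (t c)"
proof -
  let ?c = "chart_at \<A> p"
  note c0 = chart_at_in[of p]
  have A: "c \<in> \<A>" "?c \<in> \<A>" "p \<in> chart_dom c" "p \<in> chart_dom ?c" using c c0 by (auto simp: charts_at_iff)
  have d: "((u \<circ> chart_inv c) has_derivative fd (u \<circ> chart_inv c) (chart_map c p)) (at (transition ?c c (chart_map ?c p)))"
    unfolding transition_at[OF c0]
    by (rule fd_works[OF Ck_on_Suc_differentiable[OF chart_C[OF u A(1)] chart_map_in[OF c p(2)]]])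
  have "((\<lambda>y. (u \<circ> chart_inv c) (transition ?c c y)) has_derivative
     (\<lambda>v. fd (u \<circ> chart_inv c) (chart_map c p) (fd (transition ?c c) (chart_map ?c p) v))) (at (chart_map ?c p))"
    by (rule has_derivative_compose[OF transition_has_derivative[OF c0 c] d])
  note comp = fd_eqI[OF this]
  have "fd (u \<circ> chart_inv ?c) (chart_map ?c p) = fd (\<lambda>y. (u \<circ> chart_inv c) (transition ?c c y)) (chart_map ?c p)"
  proof (rule fd_cong_open[OF open_chart_image[OF A(2) open_chart_dom[OF A(1)]]])
    show "chart_map ?c p \<in> chart_map ?c ` (chart_dom ?c \<inter> chart_dom c)" using A by blast
    fix y assume "y \<in> chart_map ?c ` (chart_dom ?c \<inter> chart_dom c)"
    from chart_inv_in[OF A(2) this] show "(u \<circ> chart_inv ?c) y = (u \<circ> chart_inv c) (transition ?c c y)"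
      by (simp add: transition_def chart_inv_map[OF A(1)])
  qed
  then show ?thesis
    unfolding differential_def Let_def tangent_component[OF t c0 c] by (simp only: comp)
qed

lemma chart_J_transition:
  assumes c: "c \<in> \<A>" "c' \<in> \<A>" and y: "y \<in> chart_map c ` (chart_dom c \<inter> chart_dom c')"
  shows "fd (transition c c') y (chart_J c y v) = chart_J c' (transition c c' y) (fd (transition c c') y v)"
proof -
  define p where "p = chart_inv c y"
  note p = chart_inv_in[OF c(1) y, folded p_def]
  have at: "c \<in> charts_at \<A> p" "c' \<in> charts_at \<A> p" using p c by (auto simp: charts_at_iff)
  define t where "t = coord_vec \<A> c p v"
  have t: "t \<in> T p" unfolding t_def by (rule coord_vec_in[OF at(1)])
  have tc: "t c = v" unfolding t_def by (rule coord_vec_self[OF at(1)])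
  have "chart_J c y v = J p t c" by (simp add: chart_J_def t_def p_def)
  moreover have "chart_J c' (transition c c' y) (fd (transition c c') y v) = J p t c'"
    using J_component[OF t at(2)] tangent_component[OF t at] transition_at[OF at(1), of c'] by (simp add: p(3) tc)
  moreover have "J p t c' = fd (transition c c') y (J p t c)"
    using tangent_component[OF J_in[OF t] at] by (simp add: p(3))
  ultimately show ?thesis by simp
qed

lemma levi_form_chart:
  assumes u: "Ck_fun_on \<A> 2 u W" and W: "open W" and p: "p \<in> W" and c: "c \<in> charts_at \<A> p" and t: "t \<in> T p"
  shows "levi_form \<A> J u p t = lev (chart_J c) (u \<circ> chart_inv c) (chart_map c p) (t c)"
proof -
  let ?c = "chart_at \<A> p"
  note c0 = chart_at_in[of p]
  have A: "c \<in> \<A>" "?c \<in> \<A>" "p \<in> chart_dom c" "p \<in> chart_dom ?c" using c c0 by (auto simp: charts_at_iff)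
  have u2: "Ck_fun_on \<A> (Suc (Suc 0)) u W" using u by (simp only: numeral_2_eq_2)
  let ?x = "chart_map ?c p" and ?G = "chart_map ?c ` (chart_dom ?c \<inter> W)"
  have G: "open ?G" "?x \<in> ?G" by (rule open_chart_image[OF A(2) W], rule chart_map_in[OF c0 p])
  \<comment> \<open>At nearby points the differential may be computed in other charts, so it is
    first rewritten in the one chosen at \<open>p\<close>; passing from that chart to
    \<open>c\<close> is then a pullback by the transition map.\<close>
  have lf: "local_form \<A> (J_pullback J (differential \<A> u)) ?c v x = fd (u \<circ> chart_inv ?c) x (chart_J ?c x v)"
    if x: "x \<in> ?G" for x v
  proof -
    note q = chart_inv_in[OF A(2) x]
    have at: "?c \<in> charts_at \<A> (chart_inv ?c x)" using q A by (simp add: charts_at_iff)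
    have "J (chart_inv ?c x) (coord_vec \<A> ?c (chart_inv ?c x) v) \<in> T (chart_inv ?c x)"
      by (rule J_in[OF coord_vec_in[OF at]])
    from differential_chart[OF u2 W q(2) at this] show ?thesis
      by (simp add: local_form_def J_pullback_def chart_J_def q(3))
  qed
  have fd_lf: "fd (local_form \<A> (J_pullback J (differential \<A> u)) ?c v) ?x
    = fd (\<lambda>x. fd (u \<circ> chart_inv ?c) x (chart_J ?c x v)) ?x" for v
    by (rule fd_cong_open[OF G lf])
  have "levi_form \<A> J u p t = lev (chart_J ?c) (u \<circ> chart_inv ?c) ?x (t ?c)"
    by (simp add: levi_form_def ext_deriv_def Let_def fd_lf lev_def J_component[OF t c0])
  also have "\<dots> = lev (chart_J c) (u \<circ> chart_inv c) (transition ?c c ?x) (fd (transition ?c c) ?x (t ?c))"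
  proof (rule lev_pullback[where S = "chart_map ?c ` (chart_dom ?c \<inter> (chart_dom c \<inter> W))" and S0 = "chart_map c ` (chart_dom c \<inter> W)"])
    let ?S = "chart_map ?c ` (chart_dom ?c \<inter> (chart_dom c \<inter> W))"
    have sub: "?S \<subseteq> chart_map ?c ` (chart_dom ?c \<inter> chart_dom c)" by blast
    show "open ?S" by (intro open_chart_image A(2) open_Int W open_chart_dom A(1))
    show "?x \<in> ?S" using A p by blast
    show "local_acs (chart_map c ` (chart_dom c \<inter> W)) (chart_J c)" by (rule chart_local_acs[OF A(1) W])
    show "Ck_on 2 (transition ?c c) ?S" by (rule Ck_on_subset[OF transition_smooth[OF A(2,1)] sub])
    show "Ck_on 2 (u \<circ> chart_inv c) (chart_map c ` (chart_dom c \<inter> W))" by (rule chart_C[OF u A(1)])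
    show "transition ?c c y \<in> chart_map c ` (chart_dom c \<inter> W)" if "y \<in> ?S" for y
      using chart_inv_in[OF A(2) that] by (auto simp: transition_def)
    show "(u \<circ> chart_inv ?c) y = (u \<circ> chart_inv c) (transition ?c c y)" if "y \<in> ?S" for y
      using chart_inv_in[OF A(2) that] by (simp add: transition_def chart_inv_map[OF A(1)])
    show "fd (transition ?c c) y (chart_J ?c y v) = chart_J c (transition ?c c y) (fd (transition ?c c) y v)"
      if "y \<in> ?S" for y v
      by (rule chart_J_transition[OF A(2,1)]) (use that sub in blast)
  qed
  also have "transition ?c c ?x = chart_map c p" by (rule transition_at[OF c0])
  also have "fd (transition ?c c) ?x (t ?c) = t c" by (rule tangent_component[OF t c0 c, symmetric])
  finally show ?thesis .
qed

end

section \<open>Levi convex domains\<close>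

locale levi_convex_setup = almost_complex_mfd \<A> J
  for \<A> :: "('m::{t2_space, second_countable_topology}, 'e::euclidean_space) chart set"
    and J :: "'m \<Rightarrow> ('m, 'e) tvec \<Rightarrow> ('m, 'e) tvec" +
  fixes \<Omega> U :: "'m set" and \<psi> r :: "'m \<Rightarrow> real"
  assumes convex: "levi_convex \<A> J \<Omega>"
    and open_U: "open U"
    and psh: "strictly_psh_on \<A> J \<psi> U"
    and def_fun: "defining_function \<A> 3 \<Omega> U r"
begin

definition rho :: "real \<Rightarrow> real \<Rightarrow> 'm \<Rightarrow> real" where
  "rho A \<eta> = (\<lambda>q. - ((- r q * exp (- A * \<psi> q)) powr \<eta>))"

lemma open_Omega: "open \<Omega>"
  using convex by (simp add: levi_convex_def relatively_compact_domain_def)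

lemma r_neg_iff: "q \<in> U \<Longrightarrow> r q < 0 \<longleftrightarrow> q \<in> \<Omega>"
  using def_fun unfolding defining_function_def by blast

lemma r_C: "Ck_fun_on \<A> 3 r U"
  using def_fun by (simp add: defining_function_def)

lemma psi_C: "Ck_fun_on \<A> 2 \<psi> U"
  using psh by (simp add: strictly_psh_on_def)

text \<open>Openness of \<open>\<Omega>\<close> excludes negative values at a boundary point, and by
  continuity a positive value would give a neighbourhood missing \<open>\<Omega>\<close>. The order
  \<open>k\<close> is free because both \<open>r\<close> and the local C^2 functions from Levi
  convexity are treated.\<close>

lemma defining_function_frontier:
  assumes "open V" "defining_function \<A> k \<Omega> V s" "p \<in> V" "p \<in> frontier \<Omega>"
  shows "s p = 0"
proof -
  have neg: "q \<in> V \<Longrightarrow> s q < 0 \<longleftrightarrow> q \<in> \<Omega>" for q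
    using assms(2) unfolding defining_function_def by blast
  have "p \<notin> \<Omega>" using assms(4) open_Omega by (simp add: frontier_def interior_open)
  then have "s p \<ge> 0" using neg[OF assms(3)] by linarith
  moreover have "\<not> s p > 0"
  proof
    assume pos: "s p > 0"
    define c where "c = chart_at \<A> p"
    have c: "c \<in> charts_at \<A> p" unfolding c_def by (rule chart_at_in)
    then have cA: "c \<in> \<A>" "p \<in> chart_dom c" by (auto simp: charts_at_iff)
    let ?G = "chart_map c ` (chart_dom c \<inter> V)"
    have "Ck_fun_on \<A> k s V" using assms(2) by (simp add: defining_function_def)
    then have cont: "continuous_on ?G (s \<circ> chart_inv c)" by (rule Ck_on_continuous_on[OF chart_C[OF _ cA(1)]])
    define S where "S = (s \<circ> chart_inv c) -` {0<..} \<inter> ?G"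
    have "open S" unfolding S_def
      using continuous_on_open_vimage[OF open_chart_image[OF cA(1) assms(1)]] cont open_greaterThan by blast
    then have "open {q \<in> chart_dom c. chart_map c q \<in> S}" by (rule open_chart_preimage[OF cA(1)])
    moreover have "p \<in> {q \<in> chart_dom c. chart_map c q \<in> S}"
      using cA assms(3) pos by (simp add: S_def chart_inv_map)
    ultimately have "{q \<in> chart_dom c. chart_map c q \<in> S} \<inter> \<Omega> \<noteq> {}"
      using assms(4) open_Int_closure_eq_empty unfolding frontier_def by blast
    then obtain q where q: "q \<in> chart_dom c" "chart_map c q \<in> S" "q \<in> \<Omega>" by blast
    have "q \<in> V" using chart_inv_in(2)[OF cA(1), of "chart_map c q" V] q by (simp add: S_def chart_inv_map[OF cA(1)])
    moreover have "s q > 0" using q by (simp add: S_def chart_inv_map[OF cA(1)])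
    ultimately show False using neg q(3) by force
  qed
  ultimately show ?thesis by linarith
qed

text \<open>A zero off the closure of \<open>\<Omega>\<close> is a local minimum, as
  \<open>r\<close> is nonnegative outside \<open>\<Omega>\<close>; its differential would
  vanish.\<close>

lemma zero_in_frontier:
  assumes p: "p \<in> U" "r p = 0" and c: "c \<in> charts_at \<A> p"
    and ne: "fd (r \<circ> chart_inv c) (chart_map c p) v \<noteq> 0"
  shows "p \<in> frontier \<Omega>"
proof -
  have cA: "c \<in> \<A>" "p \<in> chart_dom c" using c by (auto simp: charts_at_iff)
  have "p \<notin> \<Omega>" using r_neg_iff[OF p(1)] p(2) by simp
  moreover have "p \<in> closure \<Omega>"
  proof (rule ccontr)
    assume no: "p \<notin> closure \<Omega>"
    let ?W = "U - closure \<Omega>" and ?f = "r \<circ> chart_inv c"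
    have W: "open ?W" using open_U by (intro open_Diff) auto
    let ?G = "chart_map c ` (chart_dom c \<inter> ?W)"
    have G: "open ?G" "chart_map c p \<in> ?G"
      using open_chart_image[OF cA(1) W] chart_map_in[OF c, of ?W] no p(1) by blast+
    have r3: "Ck_on (Suc (Suc (Suc 0))) ?f (chart_map c ` (chart_dom c \<inter> U))"
      using chart_C[OF r_C cA(1)] by (simp only: numeral_3_eq_3)
    have der: "(?f has_derivative fd ?f (chart_map c p)) (at (chart_map c p))"
      by (rule fd_works[OF Ck_on_Suc_differentiable[OF r3 chart_map_in[OF c p(1)]]])
    have "?f (chart_map c p) \<le> ?f y" if "y \<in> ?G" for y
    proof -
      have q: "chart_inv c y \<in> ?W" by (rule chart_inv_in(2)[OF cA(1) that])
      then have "chart_inv c y \<notin> \<Omega>" using closure_subset by blast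
      then have "\<not> r (chart_inv c y) < 0" using r_neg_iff q by blast
      then show ?thesis by (simp add: chart_inv_map[OF cA] p(2))
    qed
    then have "fd ?f (chart_map c p) = (\<lambda>v. 0)"
      by (intro differential_zero_maxmin[OF G(2,1) der]) blast
    then show False using ne by simp
  qed
  ultimately show ?thesis using open_Omega by (simp add: frontier_def interior_open)
qed

text \<open>Transfers nonnegativity from the local function \<open>s\<close> granted by Levi
  convexity to the given \<open>r\<close>, through the comparison at a common zero.\<close>

lemma levi_nonneg_chart:
  assumes p: "p \<in> U" "r p = 0" and c: "c \<in> charts_at \<A> p"
    and ne: "fd (r \<circ> chart_inv c) (chart_map c p) n \<noteq> 0"
    and t: "fd (r \<circ> chart_inv c) (chart_map c p) t = 0"
      "fd (r \<circ> chart_inv c) (chart_map c p) (chart_J c (chart_map c p) t) = 0"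
  shows "lev (chart_J c) (r \<circ> chart_inv c) (chart_map c p) t \<ge> 0"
proof -
  have cA: "c \<in> \<A>" "p \<in> chart_dom c" using c by (auto simp: charts_at_iff)
  let ?x = "chart_map c p" and ?f = "r \<circ> chart_inv c"
  have fr: "p \<in> frontier \<Omega>" by (rule zero_in_frontier[OF p c ne])
  have "\<forall>p\<in>frontier \<Omega>. \<exists>V r. open V \<and> p \<in> V \<and> defining_function \<A> 2 \<Omega> V r \<and>
    (\<forall>t \<in> bdry_tangent \<A> r p \<inter> J p ` bdry_tangent \<A> r p. levi_form \<A> J r p t \<ge> 0)"
    using convex unfolding levi_convex_def by (rule conjunct2)
  from bspec[OF this fr] obtain V s where V: "open V" "p \<in> V" "defining_function \<A> 2 \<Omega> V s"
    and lev_s: "\<forall>t \<in> bdry_tangent \<A> s p \<inter> J p ` bdry_tangent \<A> s p. levi_form \<A> J s p t \<ge> 0"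
    by (elim exE conjE)
  let ?g = "s \<circ> chart_inv c"
  have s_C: "Ck_fun_on \<A> 2 s V" using V(3) by (simp add: defining_function_def)
  then have s_C': "Ck_fun_on \<A> (Suc (Suc 0)) s V" by (simp only: numeral_2_eq_2)
  have s_zero: "s p = 0" by (rule defining_function_frontier[OF V(1,3,2) fr])
  have diff_s: "differential \<A> s p u = fd ?g ?x (u c)" if "u \<in> T p" for u
    by (rule differential_chart[OF s_C' V(1,2) c that])
  have "\<forall>p\<in>frontier \<Omega> \<inter> V. \<exists>t\<in>T p. differential \<A> s p t \<noteq> 0"
    using V(3) by (simp add: defining_function_def)
  with fr V(2) obtain u where u: "u \<in> T p" "differential \<A> s p u \<noteq> 0" by blast
  let ?W = "U \<inter> V"
  have W: "open ?W" using open_U V(1) by (rule open_Int)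
  interpret G: local_acs "chart_map c ` (chart_dom c \<inter> ?W)" "chart_J c" by (rule chart_local_acs[OF cA(1) W])
  let ?G = "chart_map c ` (chart_dom c \<inter> ?W)"
  have xG: "?x \<in> ?G" by (rule chart_map_in[OF c]) (simp add: p(1) V(2))
  have f2: "Ck_on 2 ?f ?G"
    by (rule Ck_on_subset[OF Ck_on_mono[OF chart_C[OF r_C cA(1)]]]) auto
  have g2: "Ck_on 2 ?g ?G" by (rule Ck_on_subset[OF chart_C[OF s_C cA(1)]]) auto
  have lin_f: "linear (fd ?f ?x)" by (rule fd_linear[OF G.C2_differentiable(1)[OF f2 xG]])
  have "\<exists>m. fd ?f ?x m > 0"
  proof (cases "fd ?f ?x n > 0")
    case False
    then have "fd ?f ?x (- n) > 0" using ne by (simp add: linear_neg[OF lin_f])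
    then show ?thesis by blast
  qed blast
  then obtain m where m: "fd ?f ?x m > 0" by blast
  \<comment> \<open>Both functions are negative exactly on \<open>\<Omega>\<close> within
    \<open>U \<inter> V\<close>; this is the sign hypothesis of the comparison.\<close>
  have imp: "?g y \<le> 0" if y: "y \<in> ?G" "?f y < 0" for y
  proof -
    note q = chart_inv_in[OF cA(1) y(1)]
    have "chart_inv c y \<in> \<Omega>" using r_neg_iff[of "chart_inv c y"] q(2) y(2) by simp
    then have "chart_inv c y \<in> \<Omega> \<inter> V" using q(2) by blast
    then have "s (chart_inv c y) < 0" using V(3) unfolding defining_function_def by simp
    then show ?thesis by simp
  qed
  have "\<exists>l>0. (\<forall>v. fd ?g ?x v = l * fd ?f ?x v) \<and>
    (\<forall>t. fd ?f ?x t = 0 \<longrightarrow> fd ?f ?x (chart_J c ?x t) = 0 \<longrightarrow> lev (chart_J c) ?g ?x t \<le> l * lev (chart_J c) ?f ?x t)"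
  proof (rule G.lev_boundary_compare[OF f2 g2 xG _ _ imp m])
    show "?f ?x = 0" "?g ?x = 0" using p(2) s_zero by (simp_all add: chart_inv_map[OF cA])
    show "fd ?g ?x (u c) \<noteq> 0" using u diff_s by simp
  qed
  then obtain l where l0: "l > 0" "\<forall>v. fd ?g ?x v = l * fd ?f ?x v"
    "\<forall>t. fd ?f ?x t = 0 \<longrightarrow> fd ?f ?x (chart_J c ?x t) = 0 \<longrightarrow> lev (chart_J c) ?g ?x t \<le> l * lev (chart_J c) ?f ?x t"
    by (elim exE conjE)
  note l = l0(1) l0(2)[rule_format] l0(3)[rule_format, OF t]
  define tt where "tt = coord_vec \<A> c p t"
  have tt: "tt \<in> T p" "tt c = t" unfolding tt_def by (rule coord_vec_in[OF c], rule coord_vec_self[OF c])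
  have Jc: "J p tt c = chart_J c ?x t" using J_component[OF tt(1) c] tt(2) by simp
  \<comment> \<open>The preimage of \<open>tt\<close> under \<open>J\<close>: vanishing of the
    differential on \<open>J t\<close> says that \<open>ww\<close> is tangent to the boundary, which
    puts \<open>tt\<close> in the image of the tangent space.\<close>
  define ww where "ww = (\<lambda>c. - J p tt c)"
  have Jt: "J p tt \<in> T p" by (rule J_in[OF tt(1)])
  have ww: "ww = coord_vec \<A> c p (- (J p tt c))"
  proof -
    have "coord_vec \<A> c p ((-1) *\<^sub>R J p tt c + 0 *\<^sub>R J p tt c) = (\<lambda>c'. (-1) *\<^sub>R J p tt c' + 0 *\<^sub>R J p tt c')"
      by (simp only: coord_vec_linear[OF c] coord_vec_component[OF Jt c])
    then show ?thesis by (simp add: ww_def)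
  qed
  then have wT: "ww \<in> T p" by (simp add: coord_vec_in[OF c])
  have "J p (\<lambda>c. (-1) *\<^sub>R J p tt c + 0 *\<^sub>R J p tt c) = (\<lambda>c. (-1) *\<^sub>R J p (J p tt) c + 0 *\<^sub>R J p (J p tt) c)"
    by (rule J_lin[OF Jt Jt])
  then have "J p ww = tt" by (simp add: ww_def J_J[OF tt(1)])
  moreover have "ww \<in> bdry_tangent \<A> s p"
    using wT t(2) by (simp add: bdry_tangent_def diff_s ww_def Jc l(2) linear_neg[OF lin_f])
  moreover have "tt \<in> bdry_tangent \<A> s p"
    using tt t(1) by (simp add: bdry_tangent_def diff_s l(2))
  ultimately have "tt \<in> bdry_tangent \<A> s p \<inter> J p ` bdry_tangent \<A> s p"
    by (intro IntI image_eqI[of _ _ ww]) simp_all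
  then have "levi_form \<A> J s p tt \<ge> 0" by (rule bspec[OF lev_s])
  also have "levi_form \<A> J s p tt = lev (chart_J c) ?g ?x t"
    using levi_form_chart[OF s_C V(1,2) c tt(1)] tt(2) by simp
  finally have "0 \<le> l * lev (chart_J c) ?f ?x t" using l(3) by linarith
  then show ?thesis using l(1) by (simp add: zero_le_mult_iff)
qed

lemma rho_C:
  assumes "W \<subseteq> U" "open W" shows "Ck_fun_on \<A> 2 (rho A \<eta>) (\<Omega> \<inter> W)"
  unfolding Ck_fun_on_def
proof
  fix c assume c: "c \<in> \<A>"
  let ?S = "chart_map c ` (chart_dom c \<inter> (\<Omega> \<inter> W))"
  have S: "open ?S" by (intro open_chart_image c open_Int open_Omega assms(2))
  have sub: "?S \<subseteq> chart_map c ` (chart_dom c \<inter> U)" using assms(1) by blast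
  have r2: "Ck_on 2 (r \<circ> chart_inv c) ?S"
    by (rule Ck_on_subset[OF Ck_on_mono[OF chart_C[OF r_C c]] sub]) simp
  have p2: "Ck_on 2 (\<psi> \<circ> chart_inv c) ?S" by (rule Ck_on_subset[OF chart_C[OF psi_C c] sub])
  have pos: "- (r \<circ> chart_inv c) x * exp (- A * (\<psi> \<circ> chart_inv c) x) > 0" if "x \<in> ?S" for x
  proof -
    have "chart_inv c x \<in> \<Omega> \<inter> W" by (rule chart_inv_in(2)[OF c that])
    then have "r (chart_inv c x) < 0" using r_neg_iff[of "chart_inv c x"] assms(1) by blast
    then show ?thesis by (simp add: mult_neg_pos)
  qed
  have "Ck_on 2 (\<lambda>x. - ((- (r \<circ> chart_inv c) x * exp (- A * (\<psi> \<circ> chart_inv c) x)) powr \<eta>)) ?S"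
    by (intro Ck_on_minus[OF S] Ck_on_powr[OF S] Ck_on_mult[OF S] Ck_on_exp[OF S] Ck_on_const r2 p2 pos)
  moreover have "rho A \<eta> \<circ> chart_inv c = (\<lambda>x. - ((- (r \<circ> chart_inv c) x * exp (- A * (\<psi> \<circ> chart_inv c) x)) powr \<eta>))"
    by (simp add: fun_eq_iff rho_def)
  ultimately show "Ck_on 2 (rho A \<eta> \<circ> chart_inv c) ?S" by simp
qed

text \<open>Interior and boundary points give a lower bound of the same form, so the closure can be
  covered in the same way as the boundary.\<close>

lemma rho_psh_near:
  assumes p: "p \<in> U" "p \<in> closure \<Omega>"
  shows "\<exists>A0>0. \<exists>V. open V \<and> p \<in> V \<and> V \<subseteq> U \<and> (\<forall>A\<ge>A0. \<exists>\<eta>0>0. \<forall>\<eta>. 0 < \<eta> \<and> \<eta> \<le> \<eta>0 \<longrightarrow>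
    (\<forall>q\<in>\<Omega> \<inter> V. \<forall>t\<in>T q. t \<noteq> (\<lambda>_. 0) \<longrightarrow> levi_form \<A> J (rho A \<eta>) q t > 0))"
proof -
  define c where "c = chart_at \<A> p"
  have c: "c \<in> charts_at \<A> p" unfolding c_def by (rule chart_at_in)
  then have cA: "c \<in> \<A>" "p \<in> chart_dom c" by (auto simp: charts_at_iff)
  let ?G = "chart_map c ` (chart_dom c \<inter> U)" and ?x = "chart_map c p"
  let ?f = "r \<circ> chart_inv c" and ?g = "\<psi> \<circ> chart_inv c"
  interpret G: local_acs ?G "chart_J c" by (rule chart_local_acs[OF cA(1) open_U])
  have xG: "?x \<in> ?G" by (rule chart_map_in[OF c p(1)])
  have f3: "Ck_on 3 ?f ?G" by (rule chart_C[OF r_C cA(1)])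
  then have f2: "Ck_on 2 ?f ?G" by (rule Ck_on_mono) simp
  have g2: "Ck_on 2 ?g ?G" by (rule chart_C[OF psi_C cA(1)])
  have pos: "lev (chart_J c) ?g ?x v > 0" if "v \<noteq> 0" for v
  proof -
    let ?t = "coord_vec \<A> c p v"
    have t: "?t \<in> T p" "?t c = v" by (rule coord_vec_in[OF c], rule coord_vec_self[OF c])
    have "?t \<noteq> (\<lambda>_. 0)"
    proof
      assume "?t = (\<lambda>_. 0)"
      then have "?t c = 0" by simp
      then show False using that t(2) by simp
    qed
    moreover have "\<forall>p\<in>U. \<forall>t\<in>T p. t \<noteq> (\<lambda>_. 0) \<longrightarrow> levi_form \<A> J \<psi> p t > 0"
      using psh unfolding strictly_psh_on_def by (rule conjunct2)
    ultimately have "levi_form \<A> J \<psi> p ?t > 0" using p(1) t(1) by simp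
    then show ?thesis using levi_form_chart[OF psi_C open_U p(1) c t(1)] t(2) by simp
  qed
  have "\<exists>C\<ge>0. eventually (\<lambda>y. y \<in> ?G \<and> (?f y < 0 \<longrightarrow> (\<forall>t. lev (chart_J c) ?f y t \<ge>
    - C * \<bar>?f y\<bar> * (norm t)\<^sup>2 - C * norm t * (\<bar>fd ?f y t\<bar> + \<bar>fd ?f y (chart_J c y t)\<bar>)))) (nhds ?x)"
  proof (cases "p \<in> \<Omega>")
    case True
    then have "?f ?x < 0" using r_neg_iff[OF p(1)] by (simp add: chart_inv_map[OF cA])
    then show ?thesis by (rule G.levi_lower_bound_interior[OF f2 xG])
  next
    case False
    then have fr: "p \<in> frontier \<Omega>" using p(2) open_Omega by (simp add: frontier_def interior_open)
    have r0: "r p = 0" by (rule defining_function_frontier[OF open_U def_fun p(1) fr])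
    have r3: "Ck_fun_on \<A> (Suc 2) r U" using r_C by (simp add: numeral_3_eq_3 numeral_2_eq_2)
    have "\<forall>p\<in>frontier \<Omega> \<inter> U. \<exists>t\<in>T p. differential \<A> r p t \<noteq> 0"
      using def_fun by (simp add: defining_function_def)
    with fr p(1) obtain u where u: "u \<in> T p" "differential \<A> r p u \<noteq> 0" by blast
    have ne: "fd ?f ?x (u c) \<noteq> 0" using u(2) differential_chart[OF r3 open_U p(1) c u(1)] by simp
    show ?thesis
    proof (rule G.levi_lower_bound_boundary[OF f3 xG _ ne])
      show "?f ?x = 0" using r0 by (simp add: chart_inv_map[OF cA])
      fix y v t assume y: "y \<in> ?G" "?f y = 0" "fd ?f y v \<noteq> 0" "fd ?f y t = 0" "fd ?f y (chart_J c y t) = 0"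
      note q = chart_inv_in[OF cA(1) y(1)]
      have at: "c \<in> charts_at \<A> (chart_inv c y)" using q cA by (simp add: charts_at_iff)
      have "r (chart_inv c y) = 0" using y(2) by simp
      from levi_nonneg_chart[OF q(2) this at, unfolded q(3), OF y(3-5)]
      show "lev (chart_J c) ?f y t \<ge> 0" .
    qed
  qed
  then obtain C where C: "C \<ge> 0" "eventually (\<lambda>y. y \<in> ?G \<and> (?f y < 0 \<longrightarrow> (\<forall>t. lev (chart_J c) ?f y t \<ge>
    - C * \<bar>?f y\<bar> * (norm t)\<^sup>2 - C * norm t * (\<bar>fd ?f y t\<bar> + \<bar>fd ?f y (chart_J c y t)\<bar>)))) (nhds ?x)" by (elim exE conjE)
  have "\<exists>A0>0. \<exists>V. open V \<and> ?x \<in> V \<and> V \<subseteq> ?G \<and> (\<forall>A\<ge>A0. \<exists>\<eta>0>0. \<forall>\<eta>. 0 < \<eta> \<and> \<eta> \<le> \<eta>0 \<longrightarrow>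
    (\<forall>y\<in>V. ?f y < 0 \<longrightarrow> (\<forall>t. t \<noteq> 0 \<longrightarrow> lev (chart_J c) (\<lambda>q. - ((- ?f q * exp (- A * ?g q)) powr \<eta>)) y t > 0)))"
    by (rule G.local_psh_powr[OF f2 g2 xG _ C]) (rule pos)
  then obtain A0 V where A0: "A0 > 0" and V: "open V" "?x \<in> V" "V \<subseteq> ?G" and main: "\<forall>A\<ge>A0. \<exists>\<eta>0>0. \<forall>\<eta>. 0 < \<eta> \<and> \<eta> \<le> \<eta>0 \<longrightarrow>
    (\<forall>y\<in>V. ?f y < 0 \<longrightarrow> (\<forall>t. t \<noteq> 0 \<longrightarrow> lev (chart_J c) (\<lambda>q. - ((- ?f q * exp (- A * ?g q)) powr \<eta>)) y t > 0))"
    by (elim exE conjE)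
  define V' where "V' = {q \<in> chart_dom c. chart_map c q \<in> V}"
  have V': "open V'" "p \<in> V'" unfolding V'_def by (rule open_chart_preimage[OF cA(1) V(1)], use cA V in simp)
  have VU: "V' \<subseteq> U"
  proof
    fix q assume "q \<in> V'"
    then have q: "q \<in> chart_dom c" "chart_map c q \<in> ?G" using V(3) by (auto simp: V'_def)
    from chart_inv_in(2)[OF cA(1) q(2)] show "q \<in> U" by (simp add: chart_inv_map[OF cA(1) q(1)])
  qed
  have rho: "rho A \<eta> \<circ> chart_inv c = (\<lambda>q. - ((- ?f q * exp (- A * ?g q)) powr \<eta>))" for A \<eta>
    by (simp add: fun_eq_iff rho_def)
  have fin: "\<exists>\<eta>0>0. \<forall>\<eta>. 0 < \<eta> \<and> \<eta> \<le> \<eta>0 \<longrightarrow>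
    (\<forall>q\<in>\<Omega> \<inter> V'. \<forall>t\<in>T q. t \<noteq> (\<lambda>_. 0) \<longrightarrow> levi_form \<A> J (rho A \<eta>) q t > 0)" if A: "A \<ge> A0" for A
  proof -
    from main[THEN spec, THEN mp, OF A] obtain \<eta>0 where e0: "\<eta>0 > 0" and e': "\<forall>\<eta>. 0 < \<eta> \<and> \<eta> \<le> \<eta>0 \<longrightarrow>
      (\<forall>y\<in>V. ?f y < 0 \<longrightarrow> (\<forall>t. t \<noteq> 0 \<longrightarrow> lev (chart_J c) (\<lambda>q. - ((- ?f q * exp (- A * ?g q)) powr \<eta>)) y t > 0))"
      by (elim exE conjE)
    have e: "lev (chart_J c) (\<lambda>q. - ((- ?f q * exp (- A * ?g q)) powr \<eta>)) y t > 0"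
      if "0 < \<eta>" "\<eta> \<le> \<eta>0" "y \<in> V" "?f y < 0" "t \<noteq> 0" for \<eta> y t
      by (rule e'[rule_format, OF conjI[OF that(1,2)] that(3-5)])
    have "levi_form \<A> J (rho A \<eta>) q t > 0"
      if eta: "0 < \<eta>" "\<eta> \<le> \<eta>0" and q: "q \<in> \<Omega> \<inter> V'" and t: "t \<in> T q" "t \<noteq> (\<lambda>_. 0)" for \<eta> q t
    proof -
      have qc: "c \<in> charts_at \<A> q" using q cA by (simp add: charts_at_iff V'_def)
      have qU: "q \<in> U" using q VU by blast
      have "t c \<noteq> 0"
      proof
        assume "t c = 0"
        then have "t = coord_vec \<A> c q (0 *\<^sub>R 0 + 0 *\<^sub>R 0)" using coord_vec_component[OF t(1) qc] by simp
        also have "\<dots> = (\<lambda>_. 0)" unfolding coord_vec_linear[OF qc] by simp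
        finally show False using t(2) by simp
      qed
      moreover have "?f (chart_map c q) < 0"
        using q r_neg_iff[OF qU] by (simp add: V'_def chart_inv_map[OF cA(1)])
      moreover have "chart_map c q \<in> V" using q by (simp add: V'_def)
      ultimately have "lev (chart_J c) (rho A \<eta> \<circ> chart_inv c) (chart_map c q) (t c) > 0"
        unfolding rho by (intro e[OF eta])
      moreover have "levi_form \<A> J (rho A \<eta>) q t = lev (chart_J c) (rho A \<eta> \<circ> chart_inv c) (chart_map c q) (t c)"
        by (rule levi_form_chart[OF rho_C[OF subset_refl open_U] open_Int[OF open_Omega open_U] _ qc t(1)]) (use q qU in simp)
      ultimately show ?thesis by simp
    qed
    then show ?thesis using e0 by blast
  qed
  show ?thesis
    by (rule exI[of _ A0], rule conjI[OF A0], rule exI[of _ V']) (use V' VU fin in simp)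
qed

text \<open>Used for \<open>K\<close> the boundary and for \<open>K\<close> the closure, which give
  the two claims.\<close>

lemma rho_psh_compact:
  assumes K: "compact K" "K \<subseteq> U" "K \<subseteq> closure \<Omega>"
  shows "\<exists>U' A \<eta>0. open U' \<and> K \<subseteq> U' \<and> U' \<subseteq> U \<and> A > 0 \<and> 0 < \<eta>0 \<and> \<eta>0 < 1 \<and>
    (\<forall>\<eta>. 0 < \<eta> \<and> \<eta> \<le> \<eta>0 \<longrightarrow> strictly_psh_on \<A> J (rho A \<eta>) (\<Omega> \<inter> U'))"
proof -
  define good where "good V A \<eta>0 \<longleftrightarrow> (\<forall>\<eta>. 0 < \<eta> \<and> \<eta> \<le> \<eta>0 \<longrightarrow>
    (\<forall>q\<in>\<Omega> \<inter> V. \<forall>t\<in>T q. t \<noteq> (\<lambda>_. 0) \<longrightarrow> levi_form \<A> J (rho A \<eta>) q t > 0))" for V A \<eta>0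
  have "\<forall>p\<in>K. \<exists>a V. a > 0 \<and> open V \<and> p \<in> V \<and> V \<subseteq> U \<and> (\<forall>A\<ge>a. \<exists>\<eta>0>0. good V A \<eta>0)"
  proof
    fix p assume "p \<in> K"
    then have "p \<in> U" "p \<in> closure \<Omega>" using K(2,3) by blast+
    from rho_psh_near[OF this]
    show "\<exists>a V. a > 0 \<and> open V \<and> p \<in> V \<and> V \<subseteq> U \<and> (\<forall>A\<ge>a. \<exists>\<eta>0>0. good V A \<eta>0)"
      unfolding good_def by blast
  qed
  then obtain a V where aV: "\<forall>p\<in>K. a p > 0 \<and> open (V p) \<and> p \<in> V p \<and> V p \<subseteq> U \<and> (\<forall>A\<ge>a p. \<exists>\<eta>0>0. good (V p) A \<eta>0)"
    unfolding bchoice_iff by (elim exE)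
  obtain D where D: "D \<subseteq> K" "finite D" "K \<subseteq> (\<Union>p\<in>D. V p)"
    by (rule compactE_image[OF K(1), of K V]) (use aV in auto)
  \<comment> \<open>Every local statement holds for all larger A, so the sum dominates all
    thresholds. The 1 keeps A positive for an empty cover, as for an empty boundary.\<close>
  define A where "A = 1 + (\<Sum>p\<in>D. a p)"
  have nn: "0 \<le> a p" if "p \<in> D" for p using aV D(1) that by (auto intro: less_imp_le)
  have A: "A > 0" using sum_nonneg[of D a] nn by (simp add: A_def add_pos_nonneg)
  have "a p \<le> A" if "p \<in> D" for p
    using member_le_sum[OF that, of a] nn D(2) by (simp add: A_def)
  then have "\<forall>p\<in>D. \<exists>\<eta>0>0. good (V p) A \<eta>0" using aV D(1) by blast
  then obtain h where h: "\<forall>p\<in>D. h p > 0 \<and> good (V p) A (h p)" unfolding bchoice_iff by (elim exE)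
  \<comment> \<open>Possible only now, since each \<open>h p\<close> was obtained for the common A.
    Inserting 1/2 keeps the bound below 1 and the set nonempty.\<close>
  define \<eta>0 where "\<eta>0 = Min (insert (1/2) (h ` D))"
  have e_pos: "\<eta>0 > 0" using h D(2) by (simp add: \<eta>0_def)
  have e_half: "\<eta>0 \<le> 1/2" unfolding \<eta>0_def by (rule Min_le) (simp_all add: D(2))
  have e_h: "\<eta>0 \<le> h p" if "p \<in> D" for p using D(2) that by (simp add: \<eta>0_def)
  define U' where "U' = (\<Union>p\<in>D. V p)"
  have U': "open U'" "K \<subseteq> U'" "U' \<subseteq> U" using aV D by (auto simp: U'_def)
  have "strictly_psh_on \<A> J (rho A \<eta>) (\<Omega> \<inter> U')" if eta: "0 < \<eta>" "\<eta> \<le> \<eta>0" for \<eta>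
    unfolding strictly_psh_on_def
  proof (intro conjI ballI impI)
    show "Ck_fun_on \<A> 2 (rho A \<eta>) (\<Omega> \<inter> U')" by (rule rho_C[OF U'(3,1)])
    fix q t assume q: "q \<in> \<Omega> \<inter> U'" "t \<in> T q" "t \<noteq> (\<lambda>_. 0)"
    then obtain p where p: "p \<in> D" "q \<in> \<Omega> \<inter> V p" by (auto simp: U'_def)
    have "\<eta> \<le> h p" using e_h[OF p(1)] eta(2) by linarith
    then show "levi_form \<A> J (rho A \<eta>) q t > 0"
      using h p q eta(1) unfolding good_def by blast
  qed
  then show ?thesis using U' A e_pos e_half by (intro exI[of _ U'] exI[of _ A] exI[of _ \<eta>0]) auto
qed

end

theorem theorem4p2:
  fixes \<A> :: "('m::{t2_space, second_countable_topology}, 'e::euclidean_space) chart set"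
    and J :: "'m \<Rightarrow> ('m, 'e) tvec \<Rightarrow> ('m, 'e) tvec"
    and \<Omega> U :: "'m set"
    and \<psi> r :: "'m \<Rightarrow> real"
  assumes "almost_complex_manifold \<A> J"
    and "relatively_compact_domain \<Omega>"
    and "Ck_boundary \<A> 3 \<Omega>"
    and "levi_convex \<A> J \<Omega>"
    and "open U" and "frontier \<Omega> \<subseteq> U"
    and "strictly_psh_on \<A> J \<psi> U"
    and "defining_function \<A> 3 \<Omega> U r"
  shows "(\<exists>U' A \<eta>\<^sub>0. open U' \<and> frontier \<Omega> \<subseteq> U' \<and> U' \<subseteq> U \<and> A > 0 \<and> 0 < \<eta>\<^sub>0 \<and> \<eta>\<^sub>0 < 1 \<and>
            (\<forall>\<eta>. 0 < \<eta> \<and> \<eta> \<le> \<eta>\<^sub>0 \<longrightarrow>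
               strictly_psh_on \<A> J (\<lambda>q. - ((- r q * exp (- A * \<psi> q)) powr \<eta>)) (\<Omega> \<inter> U')))
       \<and> (closure \<Omega> \<subseteq> U \<longrightarrow>
            (\<exists>A \<eta>\<^sub>0. A > 0 \<and> 0 < \<eta>\<^sub>0 \<and> \<eta>\<^sub>0 < 1 \<and>
               (\<forall>\<eta>. 0 < \<eta> \<and> \<eta> \<le> \<eta>\<^sub>0 \<longrightarrow>
                  strictly_psh_on \<A> J (\<lambda>q. - ((- r q * exp (- A * \<psi> q)) powr \<eta>)) \<Omega>)))"
proof -
  interpret levi_convex_setup \<A> J \<Omega> U \<psi> r
    by (intro levi_convex_setup.intro almost_complex_mfd.intro levi_convex_setup_axioms.intro assms)
  have cl: "compact (closure \<Omega>)" using assms(2) by (simp add: relatively_compact_domain_def)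
  have "frontier \<Omega> \<subseteq> closure \<Omega>" by (simp add: frontier_def)
  moreover have "compact (frontier \<Omega>)"
    using compact_Int_closed[OF cl frontier_closed[of \<Omega>]] calculation by (simp add: Int_absorb1)
  ultimately have 1: "\<exists>U' A \<eta>0. open U' \<and> frontier \<Omega> \<subseteq> U' \<and> U' \<subseteq> U \<and> A > 0 \<and> 0 < \<eta>0 \<and> \<eta>0 < 1 \<and>
    (\<forall>\<eta>. 0 < \<eta> \<and> \<eta> \<le> \<eta>0 \<longrightarrow> strictly_psh_on \<A> J (rho A \<eta>) (\<Omega> \<inter> U'))"
    using rho_psh_compact[of "frontier \<Omega>"] assms(6) by blast
  have 2: "\<exists>A \<eta>0. A > 0 \<and> 0 < \<eta>0 \<and> \<eta>0 < 1 \<and> (\<forall>\<eta>. 0 < \<eta> \<and> \<eta> \<le> \<eta>0 \<longrightarrow> strictly_psh_on \<A> J (rho A \<eta>) \<Omega>)"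
    if cU: "closure \<Omega> \<subseteq> U"
  proof -
    obtain U' A \<eta>0 where U': "closure \<Omega> \<subseteq> U'" "A > 0" "0 < \<eta>0" "\<eta>0 < 1"
      "\<forall>\<eta>. 0 < \<eta> \<and> \<eta> \<le> \<eta>0 \<longrightarrow> strictly_psh_on \<A> J (rho A \<eta>) (\<Omega> \<inter> U')"
      using rho_psh_compact[OF cl cU subset_refl] by blast
    have "\<Omega> \<inter> U' = \<Omega>" using U'(1) closure_subset by blast
    then show ?thesis using U' by auto
  qed
  show ?thesis using 1 2 unfolding rho_def by blast
qed

end
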